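(* Let $\mathbb{M},\mu,L,\Gamma,\Gamma^Z,P_t$ be as in the context. Assume: (a) there is an increasing sequence $h_k\in C_0^\infty(\mathbb{M})$ with $h_k\nearrow1$ on $\mathbb{M}$ and $\|\Gamma(h_k)\|_\infty+\|\Gamma^Z(h_k)\|_\infty\to0$ as $k\to\infty$; (b) $\Gamma(f,\Gamma^Z(f))=\Gamma^Z(f,\Gamma(f))$ for every $f\in C^\infty(\mathbb{M})$; (c) $P_t1=1$ for every $t\ge0$, and for every $f\in C_0^\infty(\mathbb{M})$ and $T\ge0$, $\sup_{t\in[0,T]}(\|\Gamma(P_tf)\|_\infty+\|\Gamma^Z(P_tf)\|_\infty)<\infty$; (d) for some $\rho_1\ge0$, $\rho_2>0$, $\kappa\ge0$, $0<d<\infty$, the inequality $\Gamma_2(f)+\nu\Gamma_2^Z(f)\ge\frac1d(Lf)^2+(\rho_1-\frac\kappa\nu)\Gamma(f)+\rho_2\Gamma^Z(f)$ holds for every $f\in C^\infty(\mathbb{M})$ and every $\nu>0$. Then there exist no bounded solutions to $Lf=0$ on $\mathbb{M}$ other than the constants.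
   Context: $\mathbb{M}$ is a smooth connected manifold with a smooth measure $\mu$; $L$ is a smooth second-order diffusion operator with real coefficients, $L1=0$, symmetric and non-positive: $\int fLg\,d\mu=\int gLf\,d\mu$, $\int fLf\,d\mu\le0$ for $f,g\in C_0^\infty(\mathbb{M})$ (smooth compactly supported). $L$ is locally subelliptic (Fefferman-Phong): locally, estimates $\|f\|^2_{H^\epsilon}\le C(-\int fLf\,d\mu+\int f^2d\mu)$ hold for test functions, for some $\epsilon>0$; in particular $L$ is hypoelliptic and solutions of $Lf=0$ are smooth. $\Gamma(f,g)=\frac12(L(fg)-fLg-gLf)$, $\Gamma(f)=\Gamma(f,f)\ge 0$. Locally $L=-\sum_iX_i^*X_i$ with Lipschitz vector fields $X_i$; $v\in T_x\mathbb{M}$ is subunit if $v=\sum a_iX_i(x)$ with $\sum a_i^2\le1$; a Lipschitz path is subunit if its velocity is subunit a.e. Any two points are assumed to be joined by a subunit path, and $d(x,y)=\sup\{|f(x)-f(y)|:f\in C^\infty(\mathbb{M}),\|\Gamma(f)\|_\infty\le1\}$, which equals the infimum of $T$ over subunit paths $[0,T]\to\mathbb{M}$ from $x$ to $y$; $(\mathbb{M},d)$ is assumed complete (the distance $d(\cdot,\cdot)$ is not to be confused with the constant $d$). $\Gamma^Z$ is a smooth symmetric first-order differential bilinear form on $C^\infty(\mathbb{M})$, $\Gamma^Z(fg,h)=f\Gamma^Z(g,h)+g\Gamma^Z(f,h)$, with $\Gamma^Z(f)=\Gamma^Z(f,f)\ge0$. $\Gamma_2(f)=\frac12[L\Gamma(f)-2\Gamma(f,Lf)]$,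 $\Gamma_2^Z(f)=\frac12[L\Gamma^Z(f)-2\Gamma^Z(f,Lf)]$. $L$ is essentially self-adjoint on $C_0^\infty(\mathbb{M})$; $P_t=e^{tL}$ is the heat semigroup, with smooth positive symmetric heat kernel $p(x,y,t)$, $P_tf(x)=\int p(x,y,t)f(y)d\mu(y)$. *)

theory Defs
  imports "HOL-Analysis.Analysis"
begin

section \<open>Smooth functions on open subsets of a Euclidean space\<close>

abbreviation pderiv_dir ::
  "'e::real_normed_vector \<Rightarrow> ('e \<Rightarrow> 'b::real_normed_vector) \<Rightarrow> 'e \<Rightarrow> 'b" where
  "pderiv_dir v f y \<equiv> frechet_derivative f (at y) v"

text \<open>Only meant for open \<open>S\<close>: the derivatives are two-sided, so values of \<open>f\<close> off \<open>S\<close> play no role.\<close>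

primrec Ck_on ::
  "nat \<Rightarrow> 'e::euclidean_space set \<Rightarrow> ('e \<Rightarrow> 'b::real_normed_vector) \<Rightarrow> bool" where
  "Ck_on 0 S f \<longleftrightarrow> continuous_on S f"
| "Ck_on (Suc k) S f \<longleftrightarrow>
     (\<forall>y\<in>S. f differentiable (at y)) \<and> (\<forall>v\<in>Basis. Ck_on k S (pderiv_dir v f))"

definition smooth_on ::
  "'e::euclidean_space set \<Rightarrow> ('e \<Rightarrow> 'b::real_normed_vector) \<Rightarrow> bool" where
  "smooth_on S f \<longleftrightarrow> (\<forall>k. Ck_on k S f)"

section \<open>Smooth manifolds, functions and measures\<close>

text \<open>The manifold is the whole topological space \<open>'a\<close>, modelled on \<open>'e\<close>. A chart is a triple
  \<open>(U, \<phi>, \<psi>)\<close> with \<open>\<phi>\<close> a homeomorphism of \<open>U\<close> onto \<open>\<phi> ` U\<close> and \<open>\<psi>\<close> its inverse.\<close>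

type_synonym ('a, 'e) chart = "'a set \<times> ('a \<Rightarrow> 'e) \<times> ('e \<Rightarrow> 'a)"

definition smooth_atlas ::
  "('a::topological_space, 'e::euclidean_space) chart set \<Rightarrow> bool" where
  "smooth_atlas A \<longleftrightarrow>
     (\<Union>(U, \<phi>, \<psi>)\<in>A. U) = UNIV \<and>
     (\<forall>(U, \<phi>, \<psi>)\<in>A. open U \<and> open (\<phi> ` U) \<and> homeomorphism U (\<phi> ` U) \<phi> \<psi>) \<and>
     (\<forall>(U, \<phi>, \<psi>)\<in>A. \<forall>(U', \<phi>', \<psi>')\<in>A. smooth_on (\<phi> ` (U \<inter> U')) (\<phi>' \<circ> \<psi>))"

definition smooth_fun ::
  "('a, 'e::euclidean_space) chart set \<Rightarrow> ('a \<Rightarrow> real) \<Rightarrow> bool" where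
  "smooth_fun A f \<longleftrightarrow> (\<forall>(U, \<phi>, \<psi>)\<in>A. smooth_on (\<phi> ` U) (f \<circ> \<psi>))"

definition fun_supp :: "('a::topological_space \<Rightarrow> real) \<Rightarrow> 'a set" where
  "fun_supp f = closure {x. f x \<noteq> 0}"

definition test_fun ::
  "('a::topological_space, 'e::euclidean_space) chart set \<Rightarrow> ('a \<Rightarrow> real) \<Rightarrow> bool" where
  "test_fun A f \<longleftrightarrow> smooth_fun A f \<and> compact (fun_supp f)"

text \<open>In every chart the measure has a smooth positive density with respect to Lebesgue measure.\<close>

definition smooth_measure ::
  "('a::topological_space, 'e::euclidean_space) chart set \<Rightarrow> 'a measure \<Rightarrow> bool" where
  "smooth_measure A \<mu> \<longleftrightarrow> sets \<mu> = sets borel \<and>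
     (\<forall>(U, \<phi>, \<psi>)\<in>A. \<exists>w. smooth_on (\<phi> ` U) w \<and> (\<forall>y\<in>\<phi> ` U. 0 < w y) \<and>
        (\<forall>B\<in>sets borel. B \<subseteq> U \<longrightarrow>
           emeasure \<mu> B = (\<integral>\<^sup>+ y. ennreal (w y) * indicator (\<phi> ` B) y \<partial>lborel)))"

definition sup_norm :: "('a \<Rightarrow> real) \<Rightarrow> ennreal" where
  "sup_norm f = (SUP x. ennreal \<bar>f x\<bar>)"

section \<open>The operator and the bilinear forms\<close>

text \<open>Second-order differential operator with smooth real coefficients and non-negative
  symmetric principal part. The zeroth-order coefficient \<open>c\<close> is killed by \<open>L 1 = 0\<close>.
  Nothing is said about \<open>L\<close> on non-smooth functions.\<close>

definition diffusion_operator ::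
  "('a, 'e::euclidean_space) chart set \<Rightarrow> (('a \<Rightarrow> real) \<Rightarrow> 'a \<Rightarrow> real) \<Rightarrow> bool" where
  "diffusion_operator A L \<longleftrightarrow>
     (\<forall>(U, \<phi>, \<psi>)\<in>A. \<exists>a b c.
        (\<forall>i\<in>Basis. \<forall>j\<in>Basis. smooth_on (\<phi> ` U) (a i j)) \<and>
        (\<forall>i\<in>Basis. smooth_on (\<phi> ` U) (b i)) \<and> smooth_on (\<phi> ` U) c \<and>
        (\<forall>y\<in>\<phi> ` U. (\<forall>i\<in>Basis. \<forall>j\<in>Basis. a i j y = a j i y) \<and>
            (\<forall>\<xi>. 0 \<le> (\<Sum>i\<in>Basis. \<Sum>j\<in>Basis. a i j y * (\<xi> \<bullet> i) * (\<xi> \<bullet> j)))) \<and>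
        (\<forall>f. smooth_fun A f \<longrightarrow> (\<forall>x\<in>U.
           L f x = (\<Sum>i\<in>Basis. \<Sum>j\<in>Basis.
                      a i j (\<phi> x) * pderiv_dir i (pderiv_dir j (f \<circ> \<psi>)) (\<phi> x))
                 + (\<Sum>i\<in>Basis. b i (\<phi> x) * pderiv_dir i (f \<circ> \<psi>) (\<phi> x))
                 + c (\<phi> x) * f x)))"

definition symmetric_nonpositive ::
  "('a::topological_space, 'e::euclidean_space) chart set \<Rightarrow> 'a measure
     \<Rightarrow> (('a \<Rightarrow> real) \<Rightarrow> 'a \<Rightarrow> real) \<Rightarrow> bool" where
  "symmetric_nonpositive A \<mu> L \<longleftrightarrow>
     (\<forall>f g. test_fun A f \<longrightarrow> test_fun A g \<longrightarrow>
        (LINT x|\<mu>. f x * L g x) = (LINT x|\<mu>. g x * L f x)) \<and>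
     (\<forall>f. test_fun A f \<longrightarrow> (LINT x|\<mu>. f x * L f x) \<le> 0)"

definition Gam ::
  "(('a \<Rightarrow> real) \<Rightarrow> 'a \<Rightarrow> real) \<Rightarrow> ('a \<Rightarrow> real) \<Rightarrow> ('a \<Rightarrow> real) \<Rightarrow> 'a \<Rightarrow> real" where
  "Gam L f g = (\<lambda>x. 1/2 * (L (\<lambda>y. f y * g y) x - f x * L g x - g x * L f x))"

definition Gam2 ::
  "(('a \<Rightarrow> real) \<Rightarrow> 'a \<Rightarrow> real) \<Rightarrow> ('a \<Rightarrow> real) \<Rightarrow> 'a \<Rightarrow> real" where
  "Gam2 L f = (\<lambda>x. 1/2 * (L (Gam L f f) x - 2 * Gam L f (L f) x))"

definition Gam2Z ::
  "(('a \<Rightarrow> real) \<Rightarrow> 'a \<Rightarrow> real) \<Rightarrow> (('a \<Rightarrow> real) \<Rightarrow> ('a \<Rightarrow> real) \<Rightarrow> 'a \<Rightarrow> real)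
     \<Rightarrow> ('a \<Rightarrow> real) \<Rightarrow> 'a \<Rightarrow> real" where
  "Gam2Z L GZ f = (\<lambda>x. 1/2 * (L (GZ f f) x - 2 * GZ f (L f) x))"

definition first_order_form ::
  "('a, 'e::euclidean_space) chart set
     \<Rightarrow> (('a \<Rightarrow> real) \<Rightarrow> ('a \<Rightarrow> real) \<Rightarrow> 'a \<Rightarrow> real) \<Rightarrow> bool" where
  "first_order_form A GZ \<longleftrightarrow>
     (\<forall>f g. smooth_fun A f \<longrightarrow> smooth_fun A g \<longrightarrow> smooth_fun A (GZ f g) \<and> GZ f g = GZ g f) \<and>
     (\<forall>f g h. smooth_fun A f \<longrightarrow> smooth_fun A g \<longrightarrow> smooth_fun A h \<longrightarrow>
        (\<forall>r s x. GZ (\<lambda>y. r * f y + s * g y) h x = r * GZ f h x + s * GZ g h x) \<and>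
        (\<forall>x. GZ (\<lambda>y. f y * g y) h x = f x * GZ g h x + g x * GZ f h x))"

section \<open>Local subellipticity\<close>

definition fourier :: "('e::euclidean_space \<Rightarrow> real) \<Rightarrow> 'e \<Rightarrow> complex" where
  "fourier u \<xi> = (LINT y|lborel. cis (- (\<xi> \<bullet> y)) * complex_of_real (u y))"

text \<open>Squared norm of the fractional Sobolev space of order \<open>\<epsilon>\<close>, up to a power of \<open>2 * pi\<close>.\<close>

definition sobolev_sq :: "real \<Rightarrow> ('e::euclidean_space \<Rightarrow> real) \<Rightarrow> ennreal" where
  "sobolev_sq \<epsilon> u =
     (\<integral>\<^sup>+ \<xi>. ennreal ((1 + (norm \<xi>)\<^sup>2) powr \<epsilon> * (cmod (fourier u \<xi>))\<^sup>2) \<partial>lborel)"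

text \<open>Near each point the estimate holds for test functions supported in a chart; there the Sobolev
  norm is that of the coordinate expression, extended by zero.\<close>

definition locally_subelliptic ::
  "('a::topological_space, 'e::euclidean_space) chart set \<Rightarrow> 'a measure
     \<Rightarrow> (('a \<Rightarrow> real) \<Rightarrow> 'a \<Rightarrow> real) \<Rightarrow> bool" where
  "locally_subelliptic A \<mu> L \<longleftrightarrow>
     (\<forall>x. \<exists>(U, \<phi>, \<psi>)\<in>A. \<exists>V \<epsilon> C. open V \<and> x \<in> V \<and> V \<subseteq> U \<and> 0 < \<epsilon> \<and>
        (\<forall>f. test_fun A f \<longrightarrow> fun_supp f \<subseteq> V \<longrightarrow>
           sobolev_sq \<epsilon> (\<lambda>y. if y \<in> \<phi> ` U then f (\<psi> y) else 0)
             \<le> ennreal (C * (- (LINT z|\<mu>. f z * L f z) + (LINT z|\<mu>. (f z)\<^sup>2)))))"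

section \<open>Subunit paths and the distance\<close>

text \<open>Derivative of \<open>f\<close> along the vector field whose components in the chart are \<open>X\<close>.\<close>

definition chart_deriv ::
  "('a, 'e::euclidean_space) chart \<Rightarrow> ('e \<Rightarrow> 'e) \<Rightarrow> ('a \<Rightarrow> real) \<Rightarrow> 'a \<Rightarrow> real" where
  "chart_deriv = (\<lambda>(U, \<phi>, \<psi>) X f x. pderiv_dir (X (\<phi> x)) (f \<circ> \<psi>) (\<phi> x))"

text \<open>\<open>L = - (\<Sum>i<m. X\<^sub>i\<^sup>* X\<^sub>i)\<close> on \<open>V\<close>, with Lipschitz vector fields given by their components in a chart.
  The adjoints are formal adjoints with respect to \<open>\<mu>\<close>, so the identity is tested against \<open>g\<close>;
  \<open>chart_deriv\<close> is meaningless off the chart domain, hence the integral over \<open>V\<close>.\<close>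

definition sum_of_squares_on ::
  "('a::topological_space, 'e::euclidean_space) chart set \<Rightarrow> 'a measure
     \<Rightarrow> (('a \<Rightarrow> real) \<Rightarrow> 'a \<Rightarrow> real) \<Rightarrow> ('a, 'e) chart \<Rightarrow> 'a set
     \<Rightarrow> nat \<Rightarrow> (nat \<Rightarrow> 'e \<Rightarrow> 'e) \<Rightarrow> bool" where
  "sum_of_squares_on A \<mu> L c V m X \<longleftrightarrow>
     open V \<and> V \<subseteq> fst c \<and>
     (\<forall>i<m. \<exists>C. C-lipschitz_on (fst (snd c) ` V) (X i)) \<and>
     (\<forall>f g. test_fun A f \<longrightarrow> test_fun A g \<longrightarrow> fun_supp f \<subseteq> V \<longrightarrow> fun_supp g \<subseteq> V \<longrightarrow>
        (LINT x|\<mu>. g x * L f x)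
          = - (\<Sum>i<m. LINT x:V|\<mu>. chart_deriv c (X i) g x * chart_deriv c (X i) f x))"

definition locally_sum_of_squares ::
  "('a::topological_space, 'e::euclidean_space) chart set \<Rightarrow> 'a measure
     \<Rightarrow> (('a \<Rightarrow> real) \<Rightarrow> 'a \<Rightarrow> real) \<Rightarrow> bool" where
  "locally_sum_of_squares A \<mu> L \<longleftrightarrow>
     (\<forall>x. \<exists>c\<in>A. \<exists>V m X. x \<in> V \<and> sum_of_squares_on A \<mu> L c V m X)"

text \<open>A tangent vector at \<open>x\<close> is given by its components \<open>v\<close> in the chart \<open>c\<close>. Being subunit does not
  depend on the choice of the fields, hence the existential quantifier.\<close>

definition subunit_vector ::
  "('a::topological_space, 'e::euclidean_space) chart set \<Rightarrow> 'a measure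
     \<Rightarrow> (('a \<Rightarrow> real) \<Rightarrow> 'a \<Rightarrow> real) \<Rightarrow> ('a, 'e) chart \<Rightarrow> 'a \<Rightarrow> 'e \<Rightarrow> bool" where
  "subunit_vector A \<mu> L c x v \<longleftrightarrow>
     (\<exists>V m X. x \<in> V \<and> sum_of_squares_on A \<mu> L c V m X \<and>
        (\<exists>a::nat \<Rightarrow> real. (\<Sum>i<m. (a i)\<^sup>2) \<le> 1 \<and>
           v = (\<Sum>i<m. a i *\<^sub>R X i (fst (snd c) x))))"

text \<open>On a compact interval, Lipschitz means Lipschitz in charts near every parameter value.\<close>

definition lipschitz_path ::
  "('a, 'e::euclidean_space) chart set \<Rightarrow> real \<Rightarrow> (real \<Rightarrow> 'a) \<Rightarrow> bool" where
  "lipschitz_path A T \<gamma> \<longleftrightarrow>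
     (\<forall>t\<in>{0..T}. \<exists>(U, \<phi>, \<psi>)\<in>A. \<exists>\<delta>>0. \<exists>C.
        \<gamma> ` ({0..T} \<inter> ball t \<delta>) \<subseteq> U \<and> C-lipschitz_on ({0..T} \<inter> ball t \<delta>) (\<phi> \<circ> \<gamma>))"

definition subunit_path ::
  "('a::topological_space, 'e::euclidean_space) chart set \<Rightarrow> 'a measure
     \<Rightarrow> (('a \<Rightarrow> real) \<Rightarrow> 'a \<Rightarrow> real) \<Rightarrow> real \<Rightarrow> (real \<Rightarrow> 'a) \<Rightarrow> bool" where
  "subunit_path A \<mu> L T \<gamma> \<longleftrightarrow>
     0 \<le> T \<and> lipschitz_path A T \<gamma> \<and>
     (AE t in lborel. t \<in> {0<..<T} \<longrightarrow>
        (\<exists>(U, \<phi>, \<psi>)\<in>A. \<gamma> t \<in> U \<and>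
           (\<exists>v. ((\<phi> \<circ> \<gamma>) has_vector_derivative v) (at t) \<and>
                subunit_vector A \<mu> L (U, \<phi>, \<psi>) (\<gamma> t) v)))"

definition subunit_connected ::
  "('a::topological_space, 'e::euclidean_space) chart set \<Rightarrow> 'a measure
     \<Rightarrow> (('a \<Rightarrow> real) \<Rightarrow> 'a \<Rightarrow> real) \<Rightarrow> bool" where
  "subunit_connected A \<mu> L \<longleftrightarrow>
     (\<forall>x y. \<exists>T \<gamma>. subunit_path A \<mu> L T \<gamma> \<and> \<gamma> 0 = x \<and> \<gamma> T = y)"

text \<open>The supremum is taken in the extended reals. Should it be infinite, \<open>enn2real\<close> gives 0 and the
  result is not a metric, so requiring \<open>Metric_space UNIV\<close> of it excludes this.\<close>

definition carnot_dist ::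
  "('a, 'e::euclidean_space) chart set \<Rightarrow> (('a \<Rightarrow> real) \<Rightarrow> 'a \<Rightarrow> real)
     \<Rightarrow> 'a \<Rightarrow> 'a \<Rightarrow> real" where
  "carnot_dist A L x y =
     enn2real (SUP f\<in>{f. smooth_fun A f \<and> sup_norm (Gam L f f) \<le> 1}. ennreal \<bar>f x - f y\<bar>)"

section \<open>Essential self-adjointness\<close>

text \<open>Elements of \<open>L\<^sup>2(\<mu>)\<close> are represented by functions, unbounded operators by their graphs; all graphs
  below except \<open>test_graph\<close> are closed under changes on null sets.\<close>

definition L2_fun :: "'a measure \<Rightarrow> ('a \<Rightarrow> real) set" where
  "L2_fun \<mu> = {f \<in> borel_measurable \<mu>. integrable \<mu> (\<lambda>x. (f x)\<^sup>2)}"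

definition L2_dist :: "'a measure \<Rightarrow> ('a \<Rightarrow> real) \<Rightarrow> ('a \<Rightarrow> real) \<Rightarrow> real" where
  "L2_dist \<mu> f g = sqrt (LINT x|\<mu>. (f x - g x)\<^sup>2)"

type_synonym 'a graph = "(('a \<Rightarrow> real) \<times> ('a \<Rightarrow> real)) set"

definition test_graph ::
  "('a::topological_space, 'e::euclidean_space) chart set
     \<Rightarrow> (('a \<Rightarrow> real) \<Rightarrow> 'a \<Rightarrow> real) \<Rightarrow> 'a graph" where
  "test_graph A L = {(f, L f) | f. test_fun A f}"

definition op_closure :: "'a measure \<Rightarrow> 'a graph \<Rightarrow> 'a graph" where
  "op_closure \<mu> G = {(u, v). u \<in> L2_fun \<mu> \<and> v \<in> L2_fun \<mu> \<and>
     (\<exists>f g. (\<forall>n::nat. (f n, g n) \<in> G) \<and>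
        (\<lambda>n. L2_dist \<mu> (f n) u) \<longlonglongrightarrow> 0 \<and> (\<lambda>n. L2_dist \<mu> (g n) v) \<longlonglongrightarrow> 0)}"

definition op_adjoint :: "'a measure \<Rightarrow> 'a graph \<Rightarrow> 'a graph" where
  "op_adjoint \<mu> G = {(u, v). u \<in> L2_fun \<mu> \<and> v \<in> L2_fun \<mu> \<and>
     (\<forall>(f, g)\<in>G. (LINT x|\<mu>. u x * g x) = (LINT x|\<mu>. v x * f x))}"

definition essentially_self_adjoint :: "'a measure \<Rightarrow> 'a graph \<Rightarrow> bool" where
  "essentially_self_adjoint \<mu> G \<longleftrightarrow> op_adjoint \<mu> (op_closure \<mu> G) = op_closure \<mu> G"

section \<open>The heat semigroup\<close>

text \<open>\<open>Q t = exp (t G)\<close>: strongly continuous contraction semigroup on \<open>L\<^sup>2(\<mu>)\<close> with generator \<open>G\<close>.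
  By the Hille--Yosida theorem \<open>G\<close> determines \<open>Q\<close> up to null sets.\<close>

definition generates ::
  "'a measure \<Rightarrow> 'a graph \<Rightarrow> (real \<Rightarrow> ('a \<Rightarrow> real) \<Rightarrow> 'a \<Rightarrow> real) \<Rightarrow> bool" where
  "generates \<mu> G Q \<longleftrightarrow>
     (\<forall>t\<ge>0. \<forall>f\<in>L2_fun \<mu>. Q t f \<in> L2_fun \<mu> \<and>
        L2_dist \<mu> (Q t f) (\<lambda>_. 0) \<le> L2_dist \<mu> f (\<lambda>_. 0)) \<and>
     (\<forall>t\<ge>0. \<forall>f\<in>L2_fun \<mu>. \<forall>g\<in>L2_fun \<mu>. \<forall>r s.
        AE x in \<mu>. Q t (\<lambda>y. r * f y + s * g y) x = r * Q t f x + s * Q t g x) \<and>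
     (\<forall>f\<in>L2_fun \<mu>. AE x in \<mu>. Q 0 f x = f x) \<and>
     (\<forall>s\<ge>0. \<forall>t\<ge>0. \<forall>f\<in>L2_fun \<mu>. AE x in \<mu>. Q (s + t) f x = Q s (Q t f) x) \<and>
     (\<forall>f\<in>L2_fun \<mu>. ((\<lambda>t. L2_dist \<mu> (Q t f) f) \<longlongrightarrow> 0) (at_right 0)) \<and>
     G = {(u, v). u \<in> L2_fun \<mu> \<and> v \<in> L2_fun \<mu> \<and>
            ((\<lambda>t. L2_dist \<mu> (\<lambda>x. (Q t u x - u x) / t) v) \<longlongrightarrow> 0) (at_right 0)}"

definition heat_op ::
  "'a measure \<Rightarrow> ('a \<Rightarrow> 'a \<Rightarrow> real \<Rightarrow> real) \<Rightarrow> real \<Rightarrow> ('a \<Rightarrow> real) \<Rightarrow> 'a \<Rightarrow> real" where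
  "heat_op \<mu> p t f x = (if t = 0 then f x else (LINT y|\<mu>. p x y t * f y))"

text \<open>\<open>p\<close> is the smooth positive symmetric kernel of the semigroup generated by the closure of \<open>L\<close>.
  Values \<open>p x y t\<close> with \<open>t \<le> 0\<close> are irrelevant.\<close>

definition heat_kernel ::
  "('a::topological_space, 'e::euclidean_space) chart set \<Rightarrow> 'a measure
     \<Rightarrow> (('a \<Rightarrow> real) \<Rightarrow> 'a \<Rightarrow> real) \<Rightarrow> ('a \<Rightarrow> 'a \<Rightarrow> real \<Rightarrow> real) \<Rightarrow> bool" where
  "heat_kernel A \<mu> L p \<longleftrightarrow>
     (\<forall>(U, \<phi>, \<psi>)\<in>A. \<forall>(U', \<phi>', \<psi>')\<in>A.
        smooth_on (\<phi> ` U \<times> \<phi>' ` U' \<times> {0<..}) (\<lambda>(y, y', t). p (\<psi> y) (\<psi>' y') t)) \<and>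
     (\<forall>x y. \<forall>t>0. 0 < p x y t \<and> p x y t = p y x t) \<and>
     (\<forall>x. \<forall>t>0. \<forall>f\<in>L2_fun \<mu>. integrable \<mu> (\<lambda>y. p x y t * f y)) \<and>
     generates \<mu> (op_closure \<mu> (test_graph A L)) (heat_op \<mu> p)"

end

theory Submission
  imports Defs
begin

text \<open>
  For a test function \<open>g\<close> put \<open>u t = P t g\<close> and
  \<open>G t = t / \<rho>2 * \<Gamma>(u t) + t\<^sup>2 * \<Gamma>\<^sup>Z(u t) + K / 2 * (u t)\<^sup>2\<close>. The curvature-dimension inequality with
  \<open>\<nu> = t * \<rho>2\<close> shows that \<open>G\<close> is a subsolution of the heat equation for a suitable constant \<open>K\<close>, so that the
  maximum principle gives \<open>t / \<rho>2 * \<Gamma>(P t g) \<le> K / 2 * sup g\<^sup>2\<close>. A bounded harmonic \<open>f\<close> is \<open>P t f\<close>, the limit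
  of \<open>P t (h k * f)\<close>; these functions have gradient \<open>O(1 / sqrt t)\<close> uniformly in \<open>k\<close>, and letting \<open>t\<close> tend to
  infinity leaves no room for oscillation.

  The maximum principle holds for subsolutions \<open>v \<le> 0\<close> with \<open>v \<le> - g\<close> at time \<open>0\<close> and says \<open>v \<le> - P t g\<close>.
  Its proof only uses cut-offs with small gradients, because the positive part of \<open>v + P t g\<close> lies below \<open>P t g\<close> and is
  therefore square integrable. Taking \<open>g\<close> to be a multiple of \<open>h k\<close> and letting \<open>k\<close> tend to infinity, conservativeness
  turns it into the maximum principle for bounded subsolutions.
\<close>

section \<open>Calculus of smooth functions\<close>

text \<open>The obstacle is that nothing is known about \<open>L (h k)\<close>: cut-offs cannot
  localise a bounded subsolution pointwise, and an energy argument that sees only the gradients of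
  the \<open>h k\<close> needs square integrability, which bounded functions lack. The comparison
  with \<open>P t g\<close> supplies it. As \<open>L\<close> is specified on smooth functions only,
  the positive part is replaced by the smooth function exp (- 1 / s), which is convex only for small
  s; hence the scaling of subsolutions before truncation.

  The powers of t in \<open>G\<close> are those of parabolic scaling: t goes with \<Gamma> and t^2
  with \<open>GZ\<close>. With \<nu> proportional to t, the term \<kappa> / \<nu>, singular at time
  0, meets a factor t; a constant multiple of \<Gamma> remains, and L u^2 - dt u^2 = 2 \<Gamma>(u)
  pays for it.

  The semigroup is given by a kernel and by L2 statements, so the smoothness of \<open>P t g\<close>
  and the pointwise heat equation must be derived. Gradients turn into oscillations through the
  distance itself, a supremum over functions of gradient at most 1.\<close>

lemma pderiv_dir_eq: "(f has_derivative D) (at y) \<Longrightarrow> pderiv_dir v f y = D v"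
  by (metis frechet_derivative_at)

lemma pderiv_dir_cong:
  assumes "open S" "y \<in> S" "\<And>z. z \<in> S \<Longrightarrow> f z = g z"
  shows "pderiv_dir v f y = pderiv_dir v g y"
proof -
  have "(f has_derivative D) (at y) \<longleftrightarrow> (g has_derivative D) (at y)" for D
    using has_derivative_transform_within_open[OF _ assms(1,2)] assms(3) by metis
  then show ?thesis
    unfolding frechet_derivative_def by simp
qed

lemma differentiable_cong_open:
  assumes "open S" "y \<in> S" "\<And>z. z \<in> S \<Longrightarrow> f z = g z"
  shows "f differentiable (at y) \<longleftrightarrow> g differentiable (at y)"
  unfolding differentiable_def
  using has_derivative_transform_within_open[OF _ assms(1,2)] assms(3) by metis

lemma Ck_on_cong:
  assumes "open S" "\<And>z. z \<in> S \<Longrightarrow> f z = g z"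
  shows "Ck_on k S f \<longleftrightarrow> Ck_on k S g"
  using assms(2)
proof (induction k arbitrary: f g)
  case 0
  then show ?case by (simp cong: continuous_on_cong)
next
  case (Suc k)
  have "Ck_on k S (pderiv_dir v f) \<longleftrightarrow> Ck_on k S (pderiv_dir v g)" for v
    using Suc.IH[of "pderiv_dir v f" "pderiv_dir v g"] pderiv_dir_cong[OF assms(1)] Suc.prems by blast
  then show ?case
    using differentiable_cong_open[OF assms(1) _ Suc.prems] by auto
qed

lemma Ck_on_subset: "Ck_on k S f \<Longrightarrow> T \<subseteq> S \<Longrightarrow> Ck_on k T f"
  by (induction k arbitrary: f) (auto intro: continuous_on_subset)

lemma Ck_on_imp_continuous_on:
  assumes "Ck_on k S f"
  shows "continuous_on S f"
proof (cases k)
  case (Suc k')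
  then have "\<forall>y\<in>S. f differentiable (at y)"
    using assms by simp
  then show ?thesis
    by (intro continuous_at_imp_continuous_on ballI differentiable_imp_continuous_within) blast
qed (use assms in simp)

lemma Ck_on_SucD: "Ck_on (Suc k) S f \<Longrightarrow> Ck_on k S f"
proof (induction k arbitrary: f)
  case 0
  then show ?case using Ck_on_imp_continuous_on[OF 0] by (simp only: Ck_on.simps)
next
  case (Suc k)
  then show ?case by simp
qed

lemma Ck_on_local:
  assumes "\<And>y. y \<in> S \<Longrightarrow> \<exists>N. open N \<and> y \<in> N \<and> Ck_on k N f"
  shows "Ck_on k S f"
  using assms
proof (induction k arbitrary: f)
  case 0
  then have "isCont f y" if "y \<in> S" for y
    using that by (meson Ck_on.simps(1) continuous_on_eq_continuous_at)
  then show ?case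
    by (simp add: continuous_at_imp_continuous_on)
next
  case (Suc k)
  have "f differentiable (at y)" if "y \<in> S" for y
    using Suc.prems[OF that] by auto
  moreover have "Ck_on k S (pderiv_dir v f)" if v: "v \<in> Basis" for v
  proof (rule Suc.IH)
    fix y assume "y \<in> S"
    then obtain N where "open N" "y \<in> N" "Ck_on (Suc k) N f"
      using Suc.prems by blast
    then show "\<exists>N. open N \<and> y \<in> N \<and> Ck_on k N (pderiv_dir v f)"
      using v by (intro exI[of _ N]) simp
  qed
  ultimately show ?case by simp
qed

lemma Ck_on_const: "Ck_on k S (\<lambda>_. c)"
  by (induction k arbitrary: c) auto

lemma Ck_on_ident: "Ck_on k S (\<lambda>y. y)"
  by (cases k) (auto intro: Ck_on_const)

lemma Ck_on_add:
  assumes "open S" "Ck_on k S f" "Ck_on k S g"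
  shows "Ck_on k S (\<lambda>y. f y + g y)"
  using assms(2,3)
proof (induction k arbitrary: f g)
  case 0
  then show ?case by (auto intro: continuous_intros)
next
  case (Suc k)
  have "Ck_on k S (pderiv_dir v (\<lambda>y. f y + g y))" if v: "v \<in> Basis" for v
  proof (subst Ck_on_cong[OF assms(1)])
    show "pderiv_dir v (\<lambda>y. f y + g y) y = pderiv_dir v f y + pderiv_dir v g y" if "y \<in> S" for y
      using Suc.prems that
      by (intro pderiv_dir_eq has_derivative_add) (auto simp: frechet_derivative_works)
    show "Ck_on k S (\<lambda>y. pderiv_dir v f y + pderiv_dir v g y)"
      using Suc v by auto
  qed
  then show ?case using Suc.prems by auto
qed

lemma Ck_on_bounded_linear:
  assumes "open S" "bounded_linear h" "Ck_on k S f"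
  shows "Ck_on k S (\<lambda>y. h (f y))"
  using assms(3)
proof (induction k arbitrary: f)
  case 0
  then show ?case using bounded_linear.continuous_on[OF assms(2)] by auto
next
  case (Suc k)
  have D: "((\<lambda>y. h (f y)) has_derivative (\<lambda>w. h (frechet_derivative f (at y) w))) (at y)"
    if "y \<in> S" for y
    using Suc.prems that bounded_linear.has_derivative[OF assms(2)]
    by (auto simp: frechet_derivative_works)
  have "Ck_on k S (pderiv_dir v (\<lambda>y. h (f y)))" if v: "v \<in> Basis" for v
  proof (subst Ck_on_cong[OF assms(1)])
    show "pderiv_dir v (\<lambda>y. h (f y)) y = h (pderiv_dir v f y)" if "y \<in> S" for y
      using D that pderiv_dir_eq by blast
    show "Ck_on k S (\<lambda>y. h (pderiv_dir v f y))"
      using Suc v by auto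
  qed
  then show ?case using D by (auto simp: differentiable_def)
qed

lemma Ck_on_scaleR:
  assumes "open S" "Ck_on k S f" "Ck_on k S g"
  shows "Ck_on k S (\<lambda>y. f y *\<^sub>R g y)"
  using assms(2,3)
proof (induction k arbitrary: f g)
  case 0
  then show ?case by (auto intro: continuous_intros)
next
  case (Suc k)
  have D: "((\<lambda>y. f y *\<^sub>R g y) has_derivative
      (\<lambda>w. f y *\<^sub>R frechet_derivative g (at y) w + frechet_derivative f (at y) w *\<^sub>R g y)) (at y)"
    if "y \<in> S" for y
    using Suc.prems that
    by (intro has_derivative_scaleR) (auto simp: frechet_derivative_works)
  have "Ck_on k S (pderiv_dir v (\<lambda>y. f y *\<^sub>R g y))" if v: "v \<in> Basis" for v
  proof (subst Ck_on_cong[OF assms(1)])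
    show "pderiv_dir v (\<lambda>y. f y *\<^sub>R g y) y
      = f y *\<^sub>R pderiv_dir v g y + pderiv_dir v f y *\<^sub>R g y" if "y \<in> S" for y
      using D that pderiv_dir_eq by blast
    show "Ck_on k S (\<lambda>y. f y *\<^sub>R pderiv_dir v g y + pderiv_dir v f y *\<^sub>R g y)"
      using Suc.prems v Ck_on_SucD[OF Suc.prems(1)] Ck_on_SucD[OF Suc.prems(2)]
      by (intro Ck_on_add assms(1) Suc.IH) simp_all
  qed
  then show ?case using D by (auto simp: differentiable_def)
qed

lemma Ck_on_sum:
  assumes "open S" "\<And>i. i \<in> I \<Longrightarrow> Ck_on k S (f i)"
  shows "Ck_on k S (\<lambda>y. \<Sum>i\<in>I. f i y)"
  using assms(2) by (induction I rule: infinite_finite_induct) (auto intro: Ck_on_const Ck_on_add assms(1))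

lemma pderiv_dir_compose:
  assumes "f differentiable (at y)" "g differentiable (at (f y))"
  shows "pderiv_dir v (\<lambda>y. g (f y)) y = pderiv_dir (pderiv_dir v f y) g (f y)"
  using frechet_derivative_compose[OF assms] by (simp add: o_def)

lemma pderiv_dir_sum_Basis:
  fixes g :: "'e::euclidean_space \<Rightarrow> 'b::real_normed_vector"
  assumes "g differentiable (at y)"
  shows "pderiv_dir w g y = (\<Sum>i\<in>Basis. (w \<bullet> i) *\<^sub>R pderiv_dir i g y)"
proof -
  interpret linear "frechet_derivative g (at y)"
    using assms by (rule linear_frechet_derivative)
  have "frechet_derivative g (at y) (\<Sum>i\<in>Basis. (w \<bullet> i) *\<^sub>R i) = (\<Sum>i\<in>Basis. (w \<bullet> i) *\<^sub>R pderiv_dir i g y)"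
    by (simp add: sum scaleR)
  then show ?thesis by (simp add: euclidean_representation)
qed

text \<open>The direction \<open>pderiv_dir v f y\<close> varies with y, whereas
  \<open>Ck_on\<close> speaks of basis directions only. Expanding it in the basis turns the chain
  rule into a sum of products to which the induction hypothesis applies.\<close>

lemma Ck_on_compose:
  fixes f :: "'e::euclidean_space \<Rightarrow> 'f::euclidean_space"
  assumes "open S" "open T" "f ` S \<subseteq> T" "Ck_on k S f" "Ck_on k T g"
  shows "Ck_on k S (\<lambda>y. g (f y))"
  using assms(4,5)
proof (induction k arbitrary: g)
  case 0
  then show ?case using assms(3) by (auto intro: continuous_on_compose2)
next
  case (Suc k)
  have d: "f differentiable (at y)" "g differentiable (at (f y))" if "y \<in> S" for y
    using Suc.prems that assms(3) by auto
  have D: "(\<lambda>y. g (f y)) differentiable (at y)" if "y \<in> S" for y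
    using differentiable_chain_at[OF d[OF that]] by (simp add: o_def)
  have "Ck_on k S (pderiv_dir v (\<lambda>y. g (f y)))" if v: "v \<in> Basis" for v
  proof (subst Ck_on_cong[OF assms(1)])
    show "pderiv_dir v (\<lambda>y. g (f y)) y
       = (\<Sum>i\<in>Basis. (pderiv_dir v f y \<bullet> i) *\<^sub>R pderiv_dir i g (f y))" if "y \<in> S" for y
      unfolding pderiv_dir_compose[OF d[OF that]] using pderiv_dir_sum_Basis[OF d(2)[OF that]] .
    have "Ck_on k S (\<lambda>y. pderiv_dir v f y \<bullet> i)" for i
      using Suc.prems v by (intro Ck_on_bounded_linear[where h="\<lambda>y. y \<bullet> i"] assms(1) bounded_linear_inner_left) auto
    moreover have "Ck_on k S (\<lambda>y. pderiv_dir i g (f y))" if "i \<in> Basis" for i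
      using Suc.prems Ck_on_SucD that by (intro Suc.IH) auto
    ultimately show "Ck_on k S (\<lambda>y. \<Sum>i\<in>Basis. (pderiv_dir v f y \<bullet> i) *\<^sub>R pderiv_dir i g (f y))"
      by (intro Ck_on_sum Ck_on_scaleR assms(1))
  qed
  then show ?case using D by auto
qed

subsection \<open>Smooth functions\<close>

named_theorems smooth_intros

lemma smooth_on_cong:
  assumes "open S" "\<And>z. z \<in> S \<Longrightarrow> f z = g z"
  shows "smooth_on S f \<longleftrightarrow> smooth_on S g"
  unfolding smooth_on_def using Ck_on_cong[OF assms] by auto

lemma smooth_on_subset: "smooth_on S f \<Longrightarrow> T \<subseteq> S \<Longrightarrow> smooth_on T f"
  unfolding smooth_on_def using Ck_on_subset by blast

lemma smooth_on_imp_continuous_on: "smooth_on S f \<Longrightarrow> continuous_on S f"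
  unfolding smooth_on_def using Ck_on_imp_continuous_on by blast

lemma smooth_on_imp_differentiable: "smooth_on S f \<Longrightarrow> y \<in> S \<Longrightarrow> f differentiable (at y)"
  unfolding smooth_on_def by (meson Ck_on.simps(2))

lemma smooth_on_local:
  assumes "\<And>y. y \<in> S \<Longrightarrow> \<exists>N. open N \<and> y \<in> N \<and> smooth_on N f"
  shows "smooth_on S f"
  unfolding smooth_on_def
proof (intro allI Ck_on_local)
  fix k y assume "y \<in> S"
  then obtain N where "open N" "y \<in> N" "smooth_on N f"
    using assms by blast
  then show "\<exists>N. open N \<and> y \<in> N \<and> Ck_on k N f"
    by (auto simp: smooth_on_def)
qed

lemma smooth_on_const [smooth_intros]: "smooth_on S (\<lambda>_. c)"
  unfolding smooth_on_def using Ck_on_const by blast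

lemma smooth_on_ident [smooth_intros]: "smooth_on S (\<lambda>y. y)"
  unfolding smooth_on_def using Ck_on_ident by blast

lemma smooth_on_add [smooth_intros]:
  "smooth_on S f \<Longrightarrow> smooth_on S g \<Longrightarrow> open S \<Longrightarrow> smooth_on S (\<lambda>y. f y + g y)"
  unfolding smooth_on_def using Ck_on_add by blast

lemma smooth_on_bounded_linear:
  "smooth_on S f \<Longrightarrow> bounded_linear h \<Longrightarrow> open S \<Longrightarrow> smooth_on S (\<lambda>y. h (f y))"
  unfolding smooth_on_def using Ck_on_bounded_linear by blast

lemma smooth_on_scaleR [smooth_intros]:
  "smooth_on S f \<Longrightarrow> smooth_on S g \<Longrightarrow> open S \<Longrightarrow> smooth_on S (\<lambda>y. f y *\<^sub>R g y)"
  unfolding smooth_on_def using Ck_on_scaleR by blast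

lemma smooth_on_mult [smooth_intros]:
  fixes f g :: "'e::euclidean_space \<Rightarrow> real"
  shows "smooth_on S f \<Longrightarrow> smooth_on S g \<Longrightarrow> open S \<Longrightarrow> smooth_on S (\<lambda>y. f y * g y)"
  using smooth_on_scaleR[of S f g] by simp

lemma smooth_on_sum [smooth_intros]:
  "(\<And>i. i \<in> I \<Longrightarrow> smooth_on S (f i)) \<Longrightarrow> open S \<Longrightarrow> smooth_on S (\<lambda>y. \<Sum>i\<in>I. f i y)"
  unfolding smooth_on_def using Ck_on_sum[of S I] by blast

lemma smooth_on_inner [smooth_intros]:
  "smooth_on S f \<Longrightarrow> open S \<Longrightarrow> smooth_on S (\<lambda>y. f y \<bullet> i)"
  using smooth_on_bounded_linear[OF _ bounded_linear_inner_left] .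

lemma smooth_on_fst [smooth_intros]: "smooth_on S f \<Longrightarrow> open S \<Longrightarrow> smooth_on S (\<lambda>y. fst (f y))"
  using smooth_on_bounded_linear[OF _ bounded_linear_fst] .

lemma smooth_on_snd [smooth_intros]: "smooth_on S f \<Longrightarrow> open S \<Longrightarrow> smooth_on S (\<lambda>y. snd (f y))"
  using smooth_on_bounded_linear[OF _ bounded_linear_snd] .

lemma smooth_on_minus [smooth_intros]: "smooth_on S f \<Longrightarrow> open S \<Longrightarrow> smooth_on S (\<lambda>y. - f y)"
  using smooth_on_bounded_linear[OF _ bounded_linear_minus[OF bounded_linear_ident]] .

lemma smooth_on_diff [smooth_intros]:
  "smooth_on S f \<Longrightarrow> smooth_on S g \<Longrightarrow> open S \<Longrightarrow> smooth_on S (\<lambda>y. f y - g y)"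
  using smooth_on_add[of S f "\<lambda>y. - g y"] smooth_on_minus[of S g] by simp

lemma smooth_on_Pair [smooth_intros]:
  assumes "smooth_on S f" "smooth_on S g" "open S"
  shows "smooth_on S (\<lambda>y. (f y, g y))"
proof -
  have "smooth_on S (\<lambda>y. (f y, 0) + (0, g y))"
    by (intro smooth_on_add assms(3) smooth_on_bounded_linear[OF assms(1), where h = "\<lambda>y. (y, 0)"]
        smooth_on_bounded_linear[OF assms(2), where h = "\<lambda>y. (0, y)"]
        bounded_linear_Pair bounded_linear_ident bounded_linear_zero)
  then show ?thesis by simp
qed

lemma smooth_on_compose:
  fixes f :: "'e::euclidean_space \<Rightarrow> 'f::euclidean_space"
  shows "smooth_on T g \<Longrightarrow> smooth_on S f \<Longrightarrow> f ` S \<subseteq> T \<Longrightarrow> open S \<Longrightarrow> open T \<Longrightarrow>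
    smooth_on S (\<lambda>y. g (f y))"
  unfolding smooth_on_def using Ck_on_compose by blast

lemma smooth_on_pderiv_Basis:
  assumes "smooth_on S f" "v \<in> Basis"
  shows "smooth_on S (pderiv_dir v f)"
proof -
  have "Ck_on (Suc k) S f" for k
    using assms(1) unfolding smooth_on_def by blast
  then show ?thesis
    using assms(2) by (simp add: smooth_on_def)
qed

lemma smooth_on_pderiv [smooth_intros]:
  assumes "smooth_on S f" "open S"
  shows "smooth_on S (pderiv_dir v f)"
proof (subst smooth_on_cong[OF assms(2)])
  show "pderiv_dir v f y = (\<Sum>i\<in>Basis. (v \<bullet> i) *\<^sub>R pderiv_dir i f y)" if "y \<in> S" for y
    by (intro pderiv_dir_sum_Basis smooth_on_imp_differentiable[OF assms(1) that])
  show "smooth_on S (\<lambda>y. \<Sum>i\<in>Basis. (v \<bullet> i) *\<^sub>R pderiv_dir i f y)"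
    by (intro smooth_intros assms smooth_on_pderiv_Basis)
qed

lemma pderiv_dir_add:
  assumes "f differentiable (at y)" "g differentiable (at y)"
  shows "pderiv_dir v (\<lambda>y. f y + g y) y = pderiv_dir v f y + pderiv_dir v g y"
  using assms by (intro pderiv_dir_eq has_derivative_add) (auto simp: frechet_derivative_works)

lemma pderiv_dir_mult:
  fixes f g :: "'e::real_normed_vector \<Rightarrow> real"
  assumes "f differentiable (at y)" "g differentiable (at y)"
  shows "pderiv_dir v (\<lambda>y. f y * g y) y = f y * pderiv_dir v g y + pderiv_dir v f y * g y"
  using assms by (intro pderiv_dir_eq has_derivative_mult) (auto simp: frechet_derivative_works)

lemma pderiv_dir_compose_real:
  fixes f :: "'e::euclidean_space \<Rightarrow> real"
  assumes "f differentiable (at y)" "(g has_real_derivative g') (at (f y))"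
  shows "pderiv_dir v (\<lambda>y. g (f y)) y = g' * pderiv_dir v f y"
proof (rule pderiv_dir_eq)
  have "(f has_derivative frechet_derivative f (at y)) (at y)"
    using assms(1) by (simp add: frechet_derivative_works)
  then show "((\<lambda>y. g (f y)) has_derivative (\<lambda>v. g' * frechet_derivative f (at y) v)) (at y)"
    using has_derivative_compose[of f _ y UNIV g "(*) g'"] assms(2)
    by (auto simp: has_field_derivative_def)
qed

text \<open>The derivative of the inverse is minus its square, so the product rule closes the
  induction.\<close>

lemma smooth_on_inverse: "smooth_on {0<..} (inverse :: real \<Rightarrow> real)"
proof -
  have "Ck_on k {0<..} (inverse :: real \<Rightarrow> real)" for k
  proof (induction k)
    case 0
    then show ?case by (auto intro!: continuous_intros)
  next
    case (Suc k)
    have D: "(inverse has_derivative (\<lambda>v. - (inverse x * v * inverse x))) (at x)" if "x > 0" for x :: real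
      using that by (auto intro!: has_derivative_inverse')
    have "Ck_on k {0<..} (pderiv_dir 1 (inverse :: real \<Rightarrow> real))"
    proof (subst Ck_on_cong)
      show "pderiv_dir 1 inverse x = - (inverse x *\<^sub>R inverse x)" if "x \<in> {0<..}" for x :: real
        using pderiv_dir_eq[OF D] that by simp
      show "Ck_on k {0<..} (\<lambda>x::real. - (inverse x *\<^sub>R inverse x))"
        by (intro Ck_on_bounded_linear[where h=uminus] bounded_linear_minus[OF bounded_linear_ident] Ck_on_scaleR Suc.IH) auto
    qed auto
    then show ?case using D by (auto simp: differentiable_def)
  qed
  then show ?thesis by (simp add: smooth_on_def)
qed

text \<open>The mean value theorem is used twice, first along v for the increment in w, then along
  w. The second difference is symmetric in v and w, so both orders of differentiation can be read
  off from it.\<close>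

lemma pderiv_dir_second_difference:
  fixes f :: "'e::euclidean_space \<Rightarrow> real"
  assumes S: "ball y r \<subseteq> S" and f: "smooth_on S f" "open S"
    and s: "0 < s" "s * (norm v + norm w) < r"
  obtains z where "z \<in> ball y r"
    "f (y + s *\<^sub>R v + s *\<^sub>R w) - f (y + s *\<^sub>R v) - f (y + s *\<^sub>R w) + f y = s * s * pderiv_dir w (pderiv_dir v f) z"
proof -
  have mem: "y + a *\<^sub>R v + b *\<^sub>R w \<in> ball y r" if "0 \<le> a" "a \<le> s" "0 \<le> b" "b \<le> s" for a b
  proof -
    have "norm (a *\<^sub>R v + b *\<^sub>R w) \<le> a * norm v + b * norm w"
      using that by (intro norm_triangle_le) auto
    also have "\<dots> \<le> s * (norm v + norm w)"
      using that by (simp add: distrib_left add_mono mult_right_mono)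
    finally have "dist y (y + (a *\<^sub>R v + b *\<^sub>R w)) < r"
      using s unfolding dist_norm by (subst norm_minus_commute) simp
    then show ?thesis by (simp add: add.assoc)
  qed
  have D: "((\<lambda>a. g (c + a *\<^sub>R u)) has_real_derivative pderiv_dir u g (c + a *\<^sub>R u)) (at a)"
    if g: "smooth_on S g" and c: "c + a *\<^sub>R u \<in> ball y r" for g :: "'e \<Rightarrow> real" and a c u
  proof -
    have d: "g differentiable (at (c + a *\<^sub>R u))" using smooth_on_imp_differentiable[OF g] c S by auto
    have "((\<lambda>a. g (c + a *\<^sub>R u)) has_derivative
        (\<lambda>h. frechet_derivative g (at (c + a *\<^sub>R u)) (h *\<^sub>R u))) (at a)"
      by (rule has_derivative_compose[of "\<lambda>a. c + a *\<^sub>R u" "\<lambda>h. h *\<^sub>R u" a UNIV g,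
            OF _ d[unfolded frechet_derivative_works]]) (auto intro!: derivative_eq_intros)
    then show ?thesis
      by (intro has_derivative_imp_has_field_derivative)
        (auto simp: linear_scale[OF linear_frechet_derivative[OF d]])
  qed
  define g where "g a = f (y + s *\<^sub>R w + a *\<^sub>R v) - f (y + a *\<^sub>R v)" for a
  have "(g has_real_derivative
      pderiv_dir v f (y + s *\<^sub>R w + a *\<^sub>R v) - pderiv_dir v f (y + a *\<^sub>R v)) (at a)"
    if "0 \<le> a" "a \<le> s" for a
    unfolding g_def using mem[of a s] mem[of a 0] that s
    by (intro DERIV_diff D f) (auto simp: algebra_simps)
  from MVT2[OF s(1) this] obtain a where a: "0 < a" "a < s"
    "g s - g 0 = s * (pderiv_dir v f (y + s *\<^sub>R w + a *\<^sub>R v) - pderiv_dir v f (y + a *\<^sub>R v))"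
    by auto
  have "((\<lambda>b. pderiv_dir v f (y + a *\<^sub>R v + b *\<^sub>R w)) has_real_derivative
      pderiv_dir w (pderiv_dir v f) (y + a *\<^sub>R v + b *\<^sub>R w)) (at b)"
    if "0 \<le> b" "b \<le> s" for b
    using mem[of a b] that a(1,2) by (intro D smooth_on_pderiv f) auto
  from MVT2[OF s(1) this] obtain b where b: "0 < b" "b < s"
    "pderiv_dir v f (y + a *\<^sub>R v + s *\<^sub>R w) - pderiv_dir v f (y + a *\<^sub>R v)
      = s * pderiv_dir w (pderiv_dir v f) (y + a *\<^sub>R v + b *\<^sub>R w)"
    by auto
  have "f (y + s *\<^sub>R v + s *\<^sub>R w) - f (y + s *\<^sub>R v) - f (y + s *\<^sub>R w) + f y = g s - g 0"
    by (simp add: g_def algebra_simps)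
  also have "\<dots> = s * (pderiv_dir v f (y + a *\<^sub>R v + s *\<^sub>R w) - pderiv_dir v f (y + a *\<^sub>R v))"
    by (subst a(3)) (simp add: algebra_simps)
  finally show thesis
    using that[OF mem[of a b]] a(1,2) b by simp
qed

text \<open>If the two mixed derivatives differed at y, then by continuity they would be separated
  on a small ball; yet a common second difference equals s^2 times a value of each of them
  there.\<close>

lemma pderiv_dir_commute:
  fixes f :: "'e::euclidean_space \<Rightarrow> real"
  assumes f: "smooth_on S f" "open S" and y: "y \<in> S"
  shows "pderiv_dir v (pderiv_dir w f) y = pderiv_dir w (pderiv_dir v f) y"
proof (rule ccontr)
  let ?g = "pderiv_dir v (pderiv_dir w f)" and ?h = "pderiv_dir w (pderiv_dir v f)"
  assume ne: "?g y \<noteq> ?h y"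
  define e where "e = dist (?g y) (?h y) / 2"
  define V where "V k = S \<inter> (\<lambda>z. dist (k z) (k y)) -` {..<e}" for k :: "'e \<Rightarrow> real"
  let ?U = "V ?g \<inter> V ?h"
  have oV: "open (V k)" if "smooth_on S k" for k
    unfolding V_def
    by (intro continuous_open_preimage continuous_intros smooth_on_imp_continuous_on that f open_lessThan)
  have "open ?U" by (intro open_Int oV smooth_on_pderiv f)
  moreover have "y \<in> ?U" using ne y by (simp add: V_def e_def)
  ultimately obtain r where r: "r > 0" "ball y r \<subseteq> ?U" using openE by blast
  then have rS: "ball y r \<subseteq> S" by (auto simp: V_def)
  \<comment> \<open>Small enough to keep the parallelogram with sides s v and s w inside the ball;
    the summand 1 keeps the denominator positive when v = w = 0.\<close>
  define s where "s = r / (2 * (norm v + norm w + 1))"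
  have n: "norm v + norm w + 1 > 0" by (simp add: add_nonneg_pos)
  have s: "s > 0" using r n by (simp add: s_def)
  have s': "s * (norm v + norm w) < r"
    using r(1) n by (simp add: s_def pos_divide_less_eq)
  obtain z where z: "z \<in> ball y r"
    "f (y + s *\<^sub>R v + s *\<^sub>R w) - f (y + s *\<^sub>R v) - f (y + s *\<^sub>R w) + f y = s * s * ?h z"
    using pderiv_dir_second_difference[OF rS f s s'] by blast
  obtain z' where z': "z' \<in> ball y r"
    "f (y + s *\<^sub>R w + s *\<^sub>R v) - f (y + s *\<^sub>R w) - f (y + s *\<^sub>R v) + f y = s * s * ?g z'"
    using pderiv_dir_second_difference[OF rS f s, of w v] s' by (auto simp: add.commute)
  have "s * s * ?h z = s * s * ?g z'"
    using z(2) z'(2) by (simp add: algebra_simps)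
  then have "?h z = ?g z'" using s by simp
  moreover have "dist (?h z) (?h y) < e" "dist (?g z') (?g y) < e"
    using z(1) z'(1) r(2) by (auto simp: V_def)
  moreover have "dist (?g y) (?h y) \<le> dist (?g z') (?g y) + dist (?g z') (?h y)" by (rule dist_triangle3)
  ultimately show False by (simp add: e_def)
qed

subsection \<open>Flat functions and smooth steps\<close>

text \<open>\<open>flat 0\<close> is the classical function exp (- 1 / x) that vanishes to infinite
  order at 0. Differentiating a member of the family gives a combination of members of higher index,
  so the smoothness of all of them is a single induction.\<close>

definition flat :: "nat \<Rightarrow> real \<Rightarrow> real" where
  "flat n x = (if 0 < x then inverse x ^ n * exp (- inverse x) else 0)"

lemma flat_nonneg: "0 \<le> flat n x"
  by (simp add: flat_def)

lemma flat_pos: "0 < x \<Longrightarrow> 0 < flat n x"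
  by (simp add: flat_def)

text \<open>A single term of the exponential series is at most the whole sum.\<close>

lemma power_le_fact_exp:
  fixes x :: real
  assumes "0 \<le> x"
  shows "x ^ n \<le> fact n * exp x"
proof -
  have "(\<Sum>k\<in>{n}. x ^ k /\<^sub>R fact k) \<le> (\<Sum>k. x ^ k /\<^sub>R fact k)"
    using assms by (intro sum_le_suminf summable_exp_generic) auto
  then show ?thesis
    by (simp add: exp_def field_simps)
qed

text \<open>The quadratic bound serves two purposes: it gives derivative 0 at the origin, and it
  dominates the truncated energy by the square of a square integrable function.\<close>

lemma flat_le: "flat n x \<le> fact (n + 2) * x\<^sup>2"
proof (cases "0 < x")
  case True
  have "inverse x ^ (n + 2) * exp (- inverse x) \<le> fact (n + 2)"
    using power_le_fact_exp[of "inverse x" "n + 2"] True by (simp add: exp_minus field_simps)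
  then have "inverse x ^ (n + 2) * exp (- inverse x) * x\<^sup>2 \<le> fact (n + 2) * x\<^sup>2"
    by (intro mult_right_mono) auto
  then show ?thesis
    using True by (simp add: flat_def power_add field_simps power2_eq_square)
qed (simp add: flat_def)

lemma flat_has_derivative:
  "(flat n has_real_derivative (flat (n + 2) x - n * flat (n + 1) x)) (at x)"
proof -
  consider "x < 0" | "x = 0" | "x > 0" by linarith
  then show ?thesis
  proof cases
    case 1
    have "((\<lambda>_. 0) has_real_derivative 0) (at x)" by simp
    then have "(flat n has_real_derivative 0) (at x)"
      by (rule DERIV_cong_ev[THEN iffD1, rotated -1])
        (use 1 in \<open>auto simp: flat_def eventually_nhds intro!: exI[of _ "{..<0}"]\<close>)
    then show ?thesis using 1 by (simp add: flat_def)
  next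
    case 2
    have "(flat n has_derivative (\<lambda>_. 0)) (at 0)"
      unfolding has_derivative_at_alt
    proof safe
      fix e :: real assume e: "e > 0"
      show "\<exists>d>0. \<forall>y. norm (y - 0) < d \<longrightarrow> norm (flat n y - flat n 0 - 0) \<le> e * norm (y - 0)"
      proof (intro exI[of _ "e / fact (n + 2)"] conjI allI impI)
        fix y :: real assume y: "norm (y - 0) < e / fact (n + 2)"
        have "flat n y \<le> (fact (n + 2) * \<bar>y\<bar>) * \<bar>y\<bar>"
          using flat_le[of n y] by (simp add: power2_eq_square mult.assoc)
        also have "\<dots> \<le> e * \<bar>y\<bar>"
          using y by (intro mult_right_mono) (simp_all add: pos_less_divide_eq mult.commute del: fact_Suc)
        finally show "norm (flat n y - flat n 0 - 0) \<le> e * norm (y - 0)"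
          using flat_nonneg[of n y] by (simp add: flat_def)
      qed (use e in auto)
    qed (rule bounded_linear_zero)
    then show ?thesis
      using 2 by (simp add: has_field_derivative_def flat_def lambda_zero)
  next
    case 3
    have i: "(inverse has_real_derivative - (inverse x * inverse x)) (at x)"
      using DERIV_inverse[of x UNIV] 3 by (simp add: power2_eq_square)
    have p: "((\<lambda>x. inverse x ^ n) has_real_derivative - real n * inverse x ^ (n + 1)) (at x)"
      by (rule DERIV_cong[OF DERIV_power[OF i, of n]]) (cases n; simp add: algebra_simps)
    have e: "((\<lambda>x. exp (- inverse x)) has_real_derivative exp (- inverse x) * (inverse x * inverse x)) (at x)"
      using DERIV_fun_exp[OF DERIV_minus[OF i]] by simp
    have "((\<lambda>x. inverse x ^ n * exp (- inverse x)) has_real_derivative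
        (flat (n + 2) x - n * flat (n + 1) x)) (at x)"
      using 3 by (intro DERIV_cong[OF DERIV_mult'[OF p e]]) (simp add: flat_def algebra_simps)
    then show ?thesis
      by (rule DERIV_cong_ev[THEN iffD1, rotated -1])
        (use 3 in \<open>auto simp: flat_def eventually_nhds intro!: exI[of _ "{0<..}"]\<close>)
  qed
qed

lemma smooth_on_flat: "smooth_on S (flat n)"
proof -
  have "Ck_on k UNIV (flat n)" for k
  proof (induction k arbitrary: n)
    case 0
    then show ?case
      using flat_has_derivative by (auto intro!: continuous_at_imp_continuous_on DERIV_isCont)
  next
    case (Suc k)
    have "pderiv_dir 1 (flat n) = (\<lambda>x. flat (n + 2) x + (- real n) *\<^sub>R flat (n + 1) x)"
      using pderiv_dir_eq[OF flat_has_derivative[unfolded has_field_derivative_def]] by auto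
    moreover have "Ck_on k UNIV \<dots>"
      by (intro Ck_on_add Ck_on_scaleR Ck_on_const Suc.IH open_UNIV)
    moreover have "flat n differentiable (at x)" for x
      using flat_has_derivative by (auto simp: differentiable_def has_field_derivative_def)
    ultimately show ?case by simp
  qed
  then show ?thesis
    by (auto simp: smooth_on_def intro: Ck_on_subset)
qed

definition smooth_step :: "real \<Rightarrow> real" where
  "smooth_step s = flat 0 s * inverse (flat 0 s + flat 0 (1 - s))"

lemma smooth_on_step: "smooth_on UNIV smooth_step"
proof -
  \<comment> \<open>The numbers s and 1 - s are never both nonpositive.\<close>
  have "0 < flat 0 s + flat 0 (1 - s)" for s
    using flat_pos[of s 0] flat_pos[of "1 - s" 0] flat_nonneg[of 0 s] flat_nonneg[of 0 "1 - s"]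
    by (cases "0 < s") (auto intro: add_pos_nonneg add_nonneg_pos)
  moreover have f: "smooth_on UNIV (\<lambda>s. flat 0 (1 - s))"
    by (rule smooth_on_compose[OF smooth_on_flat]) (auto intro!: smooth_intros)
  moreover have "smooth_on UNIV (\<lambda>s. flat 0 s + flat 0 (1 - s))"
    by (intro smooth_on_add smooth_on_flat f) auto
  ultimately have "smooth_on UNIV (\<lambda>s. inverse (flat 0 s + flat 0 (1 - s)))"
    by (intro smooth_on_compose[OF smooth_on_inverse]) auto
  then show ?thesis
    unfolding smooth_step_def by (intro smooth_on_mult smooth_on_flat) auto
qed

lemma smooth_step_nonneg: "0 \<le> smooth_step s"
  unfolding smooth_step_def by (auto intro!: mult_nonneg_nonneg add_nonneg_nonneg flat_nonneg)

lemma smooth_step_eq_0: "s \<le> 0 \<Longrightarrow> smooth_step s = 0"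
  by (simp add: smooth_step_def flat_def)

lemma smooth_step_eq_1: "1 \<le> s \<Longrightarrow> smooth_step s = 1"
  by (simp add: smooth_step_def flat_def)

subsection \<open>Integrals depending on a parameter\<close>

text \<open>Derivatives are taken in z only, with joint continuity in both arguments: the parameter
  x lives in a mere topological space, later the manifold, with no linear structure to differentiate
  along.\<close>

primrec Ck_param ::
  "nat \<Rightarrow> 'a::topological_space set \<Rightarrow> 'e::euclidean_space set \<Rightarrow> ('a \<Rightarrow> 'e \<Rightarrow> real) \<Rightarrow> bool" where
  "Ck_param 0 K S F \<longleftrightarrow> continuous_on (K \<times> S) (\<lambda>(x, z). F x z)"
| "Ck_param (Suc k) K S F \<longleftrightarrow> continuous_on (K \<times> S) (\<lambda>(x, z). F x z) \<and>
     (\<forall>x\<in>K. \<forall>z\<in>S. F x differentiable (at z)) \<and>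
     (\<forall>v\<in>Basis. Ck_param k K S (\<lambda>x. pderiv_dir v (F x)))"

lemma set_integrable_continuous_compact:
  fixes f :: "'a::t2_space \<Rightarrow> real"
  assumes "sets \<mu> = sets borel" "compact K" "emeasure \<mu> K < \<infinity>" "continuous_on K f"
  shows "set_integrable \<mu> K f"
proof -
  have K: "K \<in> sets borel"
    using borel_closed[OF compact_imp_closed[OF assms(2)]] .
  then have m: "(\<lambda>x. indicator K x *\<^sub>R f x) \<in> borel_measurable \<mu>"
    using borel_measurable_continuous_on_indicator[OF K assms(4)] assms(1)
    by (simp cong: measurable_cong_sets)
  obtain B where B: "\<And>x. x \<in> K \<Longrightarrow> norm (f x) \<le> B"
    using compact_imp_bounded[OF compact_continuous_image[OF assms(4,2)]] by (auto simp: bounded_iff)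
  show ?thesis
    unfolding set_integrable_def
    using K assms(1,3) m B by (intro integrableI_bounded_set[where A=K and B=B]) auto
qed

lemma set_integral_norm_le:
  fixes f :: "'a::t2_space \<Rightarrow> real"
  assumes "sets \<mu> = sets borel" "compact K" "emeasure \<mu> K < \<infinity>" "continuous_on K f"
    and "\<And>x. x \<in> K \<Longrightarrow> norm (f x) \<le> B"
  shows "norm (LINT x:K|\<mu>. f x) \<le> B * measure \<mu> K"
proof -
  have K: "K \<in> sets \<mu>"
    using borel_closed[OF compact_imp_closed[OF assms(2)]] assms(1) by simp
  have i: "set_integrable \<mu> K f"
    using set_integrable_continuous_compact[OF assms(1-4)] .
  have c: "set_integrable \<mu> K (\<lambda>_. B)"
    using set_integrable_continuous_compact[OF assms(1-3)] by auto
  have "norm (LINT x:K|\<mu>. f x) \<le> (LINT x:K|\<mu>. norm (f x))"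
    using set_integral_norm_bound[OF i] .
  also have "\<dots> \<le> (LINT x:K|\<mu>. B)"
    using i c assms(5) by (intro set_integral_mono set_integrable_norm) auto
  also have "\<dots> = B * measure \<mu> K"
    using K assms(3) by (subst set_integral_const) auto
  finally show ?thesis .
qed

lemma continuous_on_section:
  fixes F :: "'a::topological_space \<Rightarrow> 'e::topological_space \<Rightarrow> 'b::topological_space"
  assumes "continuous_on (K \<times> S) (\<lambda>(x, z). F x z)" "z \<in> S"
  shows "continuous_on K (\<lambda>x. F x z)"
proof -
  have "continuous_on K (\<lambda>x. (x, z))" by (intro continuous_intros)
  then show ?thesis
    using continuous_on_compose2[OF assms(1), of K "\<lambda>x. (x, z)"] assms(2) by auto
qed

context
  fixes \<mu> :: "'a::t2_space measure" and K :: "'a set" and S :: "'e::euclidean_space set"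
  assumes \<mu>: "sets \<mu> = sets borel" "emeasure \<mu> K < \<infinity>" and K: "compact K" and S: "open S"
begin

text \<open>The tube argument for the compact set K takes the place of uniform continuity, since the
  parameter space carries no metric.\<close>

lemma uniformly_close_section:
  fixes F :: "'a \<Rightarrow> 'e \<Rightarrow> real"
  assumes F: "continuous_on (K \<times> S) (\<lambda>(x, z). F x z)" and z: "z \<in> S" and e: "0 < (e::real)"
  obtains X where "open X" "z \<in> X" "\<And>x y. x \<in> K \<Longrightarrow> y \<in> X \<inter> S \<Longrightarrow> \<bar>F x y - F x z\<bar> \<le> e"
proof -
  have "continuous_on (S \<times> K) (\<lambda>(z, x). F x z)"
    using continuous_on_compose2[OF F continuous_on_swap, of "S \<times> K"]
    by (simp add: case_prod_beta product_swap)
  then obtain X where "z \<in> X" "open X" "\<forall>y\<in>X \<inter> S. \<forall>x\<in>K. dist (F x y) (F x z) \<le> e"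
    using continuous_on_prod_compactE[OF _ K z e, of "\<lambda>(z, x). F x z"] by auto
  then show thesis using that by (auto simp: dist_real_def)
qed

lemma set_integral_diff_le:
  fixes f g :: "'a \<Rightarrow> real"
  assumes "continuous_on K f" "continuous_on K g" "\<And>x. x \<in> K \<Longrightarrow> \<bar>f x - g x\<bar> \<le> e"
  shows "\<bar>(LINT x:K|\<mu>. f x) - (LINT x:K|\<mu>. g x)\<bar> \<le> e * measure \<mu> K"
  using set_integral_norm_le[OF \<mu>(1) K \<mu>(2) continuous_on_diff[OF assms(1,2)], of e] assms(3)
    set_integral_diff(2)[of \<mu> K f g, OF set_integrable_continuous_compact[OF \<mu>(1) K \<mu>(2) assms(1)]
      set_integrable_continuous_compact[OF \<mu>(1) K \<mu>(2) assms(2)]]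
  by simp

lemma continuous_on_parametric_integral:
  fixes F :: "'a \<Rightarrow> 'e \<Rightarrow> real"
  assumes F: "continuous_on (K \<times> S) (\<lambda>(x, z). F x z)"
  shows "continuous_on S (\<lambda>z. LINT x:K|\<mu>. F x z)"
  unfolding continuous_on_iff
proof safe
  fix z and e :: real assume z: "z \<in> S" and e: "e > 0"
  define m where "m = measure \<mu> K + 1"
  have m: "m > 0" "measure \<mu> K < m" by (auto simp: m_def add_nonneg_pos)
  obtain X where X: "open X" "z \<in> X" "\<And>x y. x \<in> K \<Longrightarrow> y \<in> X \<inter> S \<Longrightarrow> \<bar>F x y - F x z\<bar> \<le> e / m"
    using uniformly_close_section[OF F z, of "e / m"] e m by auto
  obtain d where d: "d > 0" "ball z d \<subseteq> X" using X openE by blast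
  have "dist (LINT x:K|\<mu>. F x y) (LINT x:K|\<mu>. F x z) < e" if y: "y \<in> S" "dist y z < d" for y
  proof -
    have "y \<in> X \<inter> S" using y d by (auto simp: dist_commute)
    then have "\<bar>(LINT x:K|\<mu>. F x y) - (LINT x:K|\<mu>. F x z)\<bar> \<le> e / m * measure \<mu> K"
      using X(3) y(1) z by (intro set_integral_diff_le continuous_on_section[OF F]) auto
    also have "\<dots> < e" using e m by (simp add: field_simps)
    finally show ?thesis by (simp add: dist_real_def)
  qed
  then show "\<exists>d>0. \<forall>y\<in>S. dist y z < d \<longrightarrow> dist (LINT x:K|\<mu>. F x y) (LINT x:K|\<mu>. F x z) < e"
    using d(1) by blast
qed

text \<open>On a small ball the partial derivatives differ from those at z by at most a constant,
  uniformly in x \<in> K. The mean value inequality then bounds the error of linearisation uniformly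
  in x, and integrating over a set of finite measure keeps it small.\<close>

lemma has_derivative_parametric_integral:
  fixes F :: "'a \<Rightarrow> 'e \<Rightarrow> real"
  assumes F: "\<And>x z. x \<in> K \<Longrightarrow> z \<in> S \<Longrightarrow> F x differentiable (at z)"
    and c: "\<And>v. v \<in> Basis \<Longrightarrow> continuous_on (K \<times> S) (\<lambda>(x, z). pderiv_dir v (F x) z)"
    and F0: "continuous_on (K \<times> S) (\<lambda>(x, z). F x z)" and z: "z \<in> S"
  shows "((\<lambda>z. LINT x:K|\<mu>. F x z) has_derivative
    (\<lambda>w. \<Sum>v\<in>Basis. (w \<bullet> v) * (LINT x:K|\<mu>. pderiv_dir v (F x) z))) (at z)"
  unfolding has_derivative_at_alt
proof (intro conjI allI impI)
  show "bounded_linear (\<lambda>w. \<Sum>v\<in>Basis. (w \<bullet> v) * (LINT x:K|\<mu>. pderiv_dir v (F x) z))"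
    by (intro bounded_linear_sum bounded_linear_mult_left[THEN bounded_linear_compose] bounded_linear_inner_left)
  fix e :: real assume e: "e > 0"
  define m where "m = measure \<mu> K + 1"
  have m: "m > 0" "measure \<mu> K < m" by (auto simp: m_def add_nonneg_pos)
  \<comment> \<open>Each coordinate contributes an error \<open>e'\<close>, and the integration
    multiplies their sum by less than m.\<close>
  define e' where "e' = e / (m * DIM('e))"
  have e': "e' > 0" using e m by (simp add: e'_def)
  have "\<exists>X. open X \<and> z \<in> X \<and> (\<forall>x\<in>K. \<forall>y\<in>X \<inter> S. \<bar>pderiv_dir v (F x) y - pderiv_dir v (F x) z\<bar> \<le> e')"
    if v: "v \<in> Basis" for v
    using uniformly_close_section[OF c[OF v] z e'] by metis
  then obtain X where X: "\<And>v. v \<in> Basis \<Longrightarrow> open (X v)" "\<And>v. v \<in> Basis \<Longrightarrow> z \<in> X v"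
    "\<And>v x y. v \<in> Basis \<Longrightarrow> x \<in> K \<Longrightarrow> y \<in> X v \<inter> S \<Longrightarrow>
      \<bar>pderiv_dir v (F x) y - pderiv_dir v (F x) z\<bar> \<le> e'"
    by metis
  have "open (S \<inter> (\<Inter>v\<in>Basis. X v))" "z \<in> S \<inter> (\<Inter>v\<in>Basis. X v)"
    using S z X(1,2) by (auto intro!: open_Int open_INT)
  then obtain d where d: "d > 0" "ball z d \<subseteq> S \<inter> (\<Inter>v\<in>Basis. X v)" using openE by blast
  have "norm ((LINT x:K|\<mu>. F x y) - (LINT x:K|\<mu>. F x z)
      - (\<Sum>v\<in>Basis. ((y - z) \<bullet> v) * (LINT x:K|\<mu>. pderiv_dir v (F x) z))) \<le> e * norm (y - z)"
    if y: "norm (y - z) < d" for y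
  proof -
    define G where "G x = (\<Sum>v\<in>Basis. ((y - z) \<bullet> v) * pderiv_dir v (F x) z)" for x
    have yS: "y \<in> S" using y d by (auto simp: dist_norm norm_minus_commute)
    have lin: "\<bar>F x y - (F x z + G x)\<bar> \<le> e' * DIM('e) * norm (y - z)" if x: "x \<in> K" for x
    proof -
      define D where "D u w = (\<Sum>v\<in>Basis. (w \<bullet> v) * (pderiv_dir v (F x) u - pderiv_dir v (F x) z))" for u w
      \<comment> \<open>\<open>F x\<close> minus its linear part at z; its derivative
        \<open>D u\<close> is small on the whole ball.\<close>
      define g where "g u = F x u - (\<Sum>v\<in>Basis. ((u - z) \<bullet> v) * pderiv_dir v (F x) z)" for u
      have "norm (g y - g z) \<le> (e' * DIM('e)) * norm (y - z)"
      proof (rule differentiable_bound[of "ball z d"])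
        fix u assume u: "u \<in> ball z d"
        then have "u \<in> S" using d by auto
        then have Fu: "F x differentiable (at u)" using F[OF x] by blast
        have "frechet_derivative (F x) (at u) = (\<lambda>w. \<Sum>v\<in>Basis. (w \<bullet> v) * pderiv_dir v (F x) u)"
          by (rule ext) (rule pderiv_dir_sum_Basis[OF Fu, unfolded real_scaleR_def])
        then have "(F x has_derivative (\<lambda>w. \<Sum>v\<in>Basis. (w \<bullet> v) * pderiv_dir v (F x) u)) (at u)"
          using Fu unfolding frechet_derivative_works by metis
        moreover have "((\<lambda>u. ((u - z) \<bullet> v) * c) has_derivative (\<lambda>w. (w \<bullet> v) * c)) (at u)" for v c
          by (auto intro!: derivative_eq_intros)
        ultimately have "(g has_derivative (\<lambda>w. (\<Sum>v\<in>Basis. (w \<bullet> v) * pderiv_dir v (F x) u)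
            - (\<Sum>v\<in>Basis. (w \<bullet> v) * pderiv_dir v (F x) z))) (at u)"
          unfolding g_def by (intro has_derivative_diff has_derivative_sum)
        moreover have "D u = (\<lambda>w. (\<Sum>v\<in>Basis. (w \<bullet> v) * pderiv_dir v (F x) u)
            - (\<Sum>v\<in>Basis. (w \<bullet> v) * pderiv_dir v (F x) z))"
          by (simp add: D_def fun_eq_iff sum_subtractf right_diff_distrib)
        ultimately show "(g has_derivative D u) (at u within ball z d)"
          by (simp add: has_derivative_at_withinI)
        have "norm (D u w) \<le> e' * DIM('e) * norm w" for w
        proof -
          have "norm (D u w) \<le> (\<Sum>v\<in>(Basis::'e set). norm w * e')"
            unfolding D_def
          proof (rule sum_norm_le)
            fix v :: 'e assume v: "v \<in> Basis"
            have "\<bar>pderiv_dir v (F x) u - pderiv_dir v (F x) z\<bar> \<le> e'"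
              using X(3)[OF v x, of u] u d(2) v by blast
            then show "norm ((w \<bullet> v) * (pderiv_dir v (F x) u - pderiv_dir v (F x) z)) \<le> norm w * e'"
              using Basis_le_norm[OF v, of w] e' by (simp add: abs_mult mult_mono)
          qed
          then show ?thesis by (simp add: mult_ac)
        qed
        then show "onorm (D u) \<le> e' * DIM('e)" by (rule onorm_le)
      qed (use y d in \<open>auto simp: dist_norm norm_minus_commute\<close>)
      then show ?thesis by (simp add: g_def G_def algebra_simps)
    qed
    have cG: "continuous_on K G"
      unfolding G_def by (intro continuous_intros continuous_on_section[OF c z])
    note cF = continuous_on_section[OF F0 yS] continuous_on_section[OF F0 z]
    have "(LINT x:K|\<mu>. F x z + G x) = (LINT x:K|\<mu>. F x z) + (LINT x:K|\<mu>. G x)"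
      using set_integrable_continuous_compact[OF \<mu>(1) K \<mu>(2)] cF cG by (intro set_integral_add) auto
    moreover have "(LINT x:K|\<mu>. G x) = (\<Sum>v\<in>Basis. ((y - z) \<bullet> v) * (LINT x:K|\<mu>. pderiv_dir v (F x) z))"
      using set_integrable_continuous_compact[OF \<mu>(1) K \<mu>(2) continuous_on_section[OF c z]]
      unfolding G_def set_lebesgue_integral_def set_integrable_def
      by (simp add: sum_distrib_left mult.left_commute[of "indicator _ _"])
    ultimately have "norm ((LINT x:K|\<mu>. F x y) - (LINT x:K|\<mu>. F x z)
        - (\<Sum>v\<in>Basis. ((y - z) \<bullet> v) * (LINT x:K|\<mu>. pderiv_dir v (F x) z)))
      = \<bar>(LINT x:K|\<mu>. F x y) - (LINT x:K|\<mu>. F x z + G x)\<bar>" by simp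
    also have "\<dots> \<le> (e' * DIM('e) * norm (y - z)) * measure \<mu> K"
      by (intro set_integral_diff_le continuous_intros cF cG lin)
    also have "\<dots> \<le> (e' * DIM('e) * norm (y - z)) * m"
      using m e' by (intro mult_left_mono) auto
    also have "\<dots> = e * norm (y - z)" using m by (simp add: e'_def)
    finally show ?thesis .
  qed
  then show "\<exists>d>0. \<forall>y. norm (y - z) < d \<longrightarrow> norm ((LINT x:K|\<mu>. F x y) - (LINT x:K|\<mu>. F x z)
      - (\<Sum>v\<in>Basis. ((y - z) \<bullet> v) * (LINT x:K|\<mu>. pderiv_dir v (F x) z))) \<le> e * norm (y - z)"
    using d(1) by blast
qed

lemma has_derivative_Ck_param_integral:
  assumes "Ck_param (Suc k) K S F" "z \<in> S"
  shows "((\<lambda>z. LINT x:K|\<mu>. F x z) has_derivative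
    (\<lambda>w. \<Sum>v\<in>Basis. (w \<bullet> v) * (LINT x:K|\<mu>. pderiv_dir v (F x) z))) (at z)"
proof (rule has_derivative_parametric_integral[OF _ _ _ assms(2)])
  show "continuous_on (K \<times> S) (\<lambda>(x, z). pderiv_dir v (F x) z)" if "v \<in> Basis" for v
    using assms(1) that by (cases k) simp_all
qed (use assms(1) in simp_all)

lemma pderiv_Ck_param_integral:
  assumes "Ck_param (Suc k) K S F" "z \<in> S" "v \<in> Basis"
  shows "pderiv_dir v (\<lambda>z. LINT x:K|\<mu>. F x z) z = (LINT x:K|\<mu>. pderiv_dir v (F x) z)"
proof -
  have "(\<Sum>u\<in>Basis. (v \<bullet> u) * (LINT x:K|\<mu>. pderiv_dir u (F x) z))
      = (\<Sum>u\<in>Basis. if u = v then (LINT x:K|\<mu>. pderiv_dir v (F x) z) else 0)"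
    using assms(3) by (intro sum.cong) (auto simp: inner_Basis)
  then show ?thesis
    using pderiv_dir_eq[OF has_derivative_Ck_param_integral[OF assms(1,2)], of v] assms(3) by simp
qed

lemma Ck_on_Ck_param_integral:
  "Ck_param k K S F \<Longrightarrow> Ck_on k S (\<lambda>z. LINT x:K|\<mu>. F x z)"
proof (induction k arbitrary: F)
  case 0
  then show ?case using continuous_on_parametric_integral[of F] by simp
next
  case (Suc k)
  have "(\<lambda>z. LINT x:K|\<mu>. F x z) differentiable (at z)" if "z \<in> S" for z
    unfolding differentiable_def using has_derivative_Ck_param_integral[OF Suc.prems that] by blast
  moreover have "Ck_on k S (pderiv_dir v (\<lambda>z. LINT x:K|\<mu>. F x z))" if v: "v \<in> Basis" for v
  proof (subst Ck_on_cong[OF S])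
    show "Ck_on k S (\<lambda>z. LINT x:K|\<mu>. pderiv_dir v (F x) z)"
      using Suc.prems v by (intro Suc.IH) simp
    show "pderiv_dir v (\<lambda>z. LINT x:K|\<mu>. F x z) z = (LINT x:K|\<mu>. pderiv_dir v (F x) z)"
      if "z \<in> S" for z
      by (rule pderiv_Ck_param_integral[OF Suc.prems that v])
  qed
  ultimately show ?case by simp
qed

end

section \<open>Partial derivatives on products and Hadamard's expansion\<close>

lemma slice_snd:
  fixes H :: "'q::real_normed_vector \<times> 'e::real_normed_vector \<Rightarrow> 'b::real_normed_vector"
  assumes "H differentiable (at (q, z))"
  shows "(\<lambda>z. H (q, z)) differentiable (at z)"
    "pderiv_dir v (\<lambda>z. H (q, z)) z = pderiv_dir (0, v) H (q, z)"
proof -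
  have "(H has_derivative frechet_derivative H (at (q, z))) (at (q, z))"
    using assms by (simp add: frechet_derivative_works)
  moreover have "((\<lambda>z. (q, z)) has_derivative (\<lambda>v. (0, v))) (at z)"
    by (auto intro!: derivative_eq_intros)
  ultimately have "((\<lambda>z. H (q, z)) has_derivative (\<lambda>v. pderiv_dir (0, v) H (q, z))) (at z)"
    using has_derivative_compose[of "\<lambda>z. (q, z)" "\<lambda>v. (0, v)" z UNIV H] by blast
  then show "(\<lambda>z. H (q, z)) differentiable (at z)"
    "pderiv_dir v (\<lambda>z. H (q, z)) z = pderiv_dir (0, v) H (q, z)"
    using pderiv_dir_eq by (auto simp: differentiable_def)
qed

lemma slice_fst:
  fixes H :: "real \<times> 'e::real_normed_vector \<Rightarrow> real"
  assumes "H differentiable (at (t, z))"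
  shows "((\<lambda>t. H (t, z)) has_real_derivative pderiv_dir (1, 0) H (t, z)) (at t)"
proof -
  have H: "(H has_derivative frechet_derivative H (at (t, z))) (at (t, z))"
    using assms by (simp add: frechet_derivative_works)
  have "((\<lambda>t. (t, z)) has_derivative (\<lambda>h. h *\<^sub>R (1, 0))) (at t)"
    by (auto intro!: derivative_eq_intros)
  from has_derivative_compose[OF this H]
  have "((\<lambda>t. H (t, z)) has_derivative (\<lambda>h. h *\<^sub>R pderiv_dir (1, 0) H (t, z))) (at t)"
    by (simp only: linear_scale[OF linear_frechet_derivative[OF assms]])
  then show ?thesis
    by (simp add: has_field_derivative_def mult.commute[of _ "pderiv_dir (1, 0) H (t, z)"])
qed

text \<open>The parameter space of \<open>F\<close> need not be Euclidean: near each of its points \<open>F\<close> factors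
  through a smooth function on a Euclidean space.\<close>

lemma Ck_paramI:
  fixes F :: "'a::t2_space \<Rightarrow> 'e::euclidean_space \<Rightarrow> real"
  assumes S: "open S"
    and F: "\<And>x. x \<in> K \<Longrightarrow> \<exists>N (\<phi> :: 'a \<Rightarrow> 'q::euclidean_space) H W. open N \<and> x \<in> N \<and> continuous_on (K \<inter> N) \<phi> \<and>
      open W \<and> smooth_on W H \<and> (\<forall>x'\<in>K \<inter> N. \<forall>z\<in>S. (\<phi> x', z) \<in> W \<and> F x' z = H (\<phi> x', z))"
  shows "Ck_param k K S F"
  using F
proof (induction k arbitrary: F)
  have cont: "continuous_on (K \<times> S) (\<lambda>(x, z). F x z)"
    if F: "\<And>x. x \<in> K \<Longrightarrow> \<exists>N (\<phi> :: 'a \<Rightarrow> 'q) H W. open N \<and> x \<in> N \<and> continuous_on (K \<inter> N) \<phi> \<and>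
      open W \<and> smooth_on W H \<and> (\<forall>x'\<in>K \<inter> N. \<forall>z\<in>S. (\<phi> x', z) \<in> W \<and> F x' z = H (\<phi> x', z))" for F :: "'a \<Rightarrow> 'e \<Rightarrow> real"
  proof (rule continuous_on_eq_continuous_within[THEN iffD2], safe)
    fix x z assume xz: "x \<in> K" "z \<in> S"
    obtain N and \<phi> :: "'a \<Rightarrow> 'q" and H W where N: "open N" "x \<in> N" "continuous_on (K \<inter> N) \<phi>"
      "open W" "smooth_on W H" "\<And>x' z. x' \<in> K \<inter> N \<Longrightarrow> z \<in> S \<Longrightarrow> (\<phi> x', z) \<in> W \<and> F x' z = H (\<phi> x', z)"
      using F[OF xz(1)] by metis
    have "continuous_on ((K \<inter> N) \<times> S) (\<lambda>p. (\<phi> (fst p), snd p))"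
      by (intro continuous_intros continuous_on_compose2[OF N(3)]) auto
    then have "continuous_on ((K \<inter> N) \<times> S) (\<lambda>p. H (\<phi> (fst p), snd p))"
      using N(6) by (intro continuous_on_compose2[OF smooth_on_imp_continuous_on[OF N(5)]]) auto
    then have "continuous_on ((K \<inter> N) \<times> S) (\<lambda>(x, z). F x z)"
      by (rule continuous_on_eq) (use N(6) in auto)
    then have "continuous (at (x, z) within (K \<inter> N) \<times> S) (\<lambda>(x, z). F x z)"
      using xz N(2) by (auto simp: continuous_on_eq_continuous_within)
    moreover have "at (x, z) within (K \<inter> N) \<times> S = at (x, z) within K \<times> S"
      using xz N(1,2) by (intro at_within_nhd[of _ "N \<times> UNIV"]) (auto intro: open_Times)
    ultimately show "continuous (at (x, z) within K \<times> S) (\<lambda>(x, z). F x z)" by simp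
  qed
  {
    case 0
    then show ?case using cont[of F] by simp
  next
    case (Suc k)
    have D: "(\<lambda>z. H (q, z)) differentiable (at z)"
      "pderiv_dir v (\<lambda>z. H (q, z)) z = pderiv_dir (0, v) H (q, z)"
      if "smooth_on W H" "(q, z) \<in> W" for H W v and q :: 'q and z :: 'e
      using slice_snd smooth_on_imp_differentiable[OF that] by auto
    have "F x differentiable (at z)" if xz: "x \<in> K" "z \<in> S" for x z
    proof -
      obtain N and \<phi> :: "'a \<Rightarrow> 'q" and H W where N: "x \<in> N" "smooth_on W H"
        "\<And>z. z \<in> S \<Longrightarrow> (\<phi> x, z) \<in> W \<and> F x z = H (\<phi> x, z)"
        using Suc.prems[OF xz(1)] xz(1) by blast
      have "(\<lambda>z. H (\<phi> x, z)) differentiable (at z)"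
        using D(1)[OF N(2)] N(3) xz by blast
      then show ?thesis
        using differentiable_cong_open[OF S xz(2), of "F x" "\<lambda>z. H (\<phi> x, z)"] N(3) by blast
    qed
    moreover have "Ck_param k K S (\<lambda>x. pderiv_dir v (F x))" if v: "v \<in> Basis" for v
    proof (rule Suc.IH)
      fix x assume "x \<in> K"
      then obtain N and \<phi> :: "'a \<Rightarrow> 'q" and H W where N: "open N" "x \<in> N" "continuous_on (K \<inter> N) \<phi>"
        "open W" "smooth_on W H" "\<And>x' z. x' \<in> K \<inter> N \<Longrightarrow> z \<in> S \<Longrightarrow> (\<phi> x', z) \<in> W \<and> F x' z = H (\<phi> x', z)"
        using Suc.prems by metis
      have "pderiv_dir v (F x') z = pderiv_dir (0, v) H (\<phi> x', z)" if "x' \<in> K \<inter> N" "z \<in> S" for x' z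
        using pderiv_dir_cong[OF S that(2), of "F x'" "\<lambda>z. H (\<phi> x', z)" v] D(2)[OF N(5)] N(6) that by auto
      then show "\<exists>N (\<phi> :: 'a \<Rightarrow> 'q) H W. open N \<and> x \<in> N \<and> continuous_on (K \<inter> N) \<phi> \<and>
          open W \<and> smooth_on W H \<and> (\<forall>x'\<in>K \<inter> N. \<forall>z\<in>S. (\<phi> x', z) \<in> W \<and> pderiv_dir v (F x') z = H (\<phi> x', z))"
        using N smooth_on_pderiv[OF N(5,4)] by (intro exI[of _ N] exI[of _ \<phi>] exI[of _ "pderiv_dir (0, v) H"] exI[of _ W]) auto
    qed
    ultimately show ?case using cont[OF Suc.prems] by simp
  }
qed

text \<open>The derivative of f is integrated along the segment from y0 to y. The coefficients are
  averages of partial derivatives, hence smooth. The expansion is what shows that a form known only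
  by its product rule depends on first derivatives alone.\<close>

lemma Hadamard:
  fixes f :: "'e::euclidean_space \<Rightarrow> real"
  assumes f: "smooth_on (ball y0 r) f"
  obtains g where "\<And>i. smooth_on (ball y0 r) (g i)" "\<And>i. g i y0 = pderiv_dir i f y0"
    "\<And>y. y \<in> ball y0 r \<Longrightarrow> f y = f y0 + (\<Sum>i\<in>Basis. ((y - y0) \<bullet> i) * g i y)"
proof
  let ?B = "ball y0 r"
  define F where "F i s y = pderiv_dir i f (y0 + s *\<^sub>R (y - y0))" for i s y
  define g where "g i y = (LINT s:{0..1}|lborel. F i s y)" for i y
  have mem: "y0 + s *\<^sub>R (y - y0) \<in> ?B" if "s \<in> {0..1}" "y \<in> ?B" for s :: real and y
  proof -
    have "norm (s *\<^sub>R (y - y0)) \<le> norm (y - y0)"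
      using that by (auto intro: mult_left_le_one_le)
    then show ?thesis using that by (simp add: dist_norm norm_minus_commute)
  qed
  have sm: "Ck_param k {0..1} ?B (F i)" for k i
  proof (rule Ck_paramI)
    fix x :: real
    let ?T = "\<lambda>(s, y). y0 + s *\<^sub>R (y - y0)"
    have T: "smooth_on UNIV ?T"
      unfolding case_prod_beta by (intro smooth_intros) auto
    \<comment> \<open>The set of pairs (s, y) whose segment point lies in the ball is open and, by
      convexity, contains all pairs with s \<in> {0..1} and y in the ball.\<close>
    have W: "open (?T -` ?B)"
      by (intro open_vimage) (auto intro!: continuous_intros simp: case_prod_beta)
    show "\<exists>N (\<phi> :: real \<Rightarrow> real) H W. open N \<and> x \<in> N \<and> continuous_on ({0..1} \<inter> N) \<phi> \<and>
      open W \<and> smooth_on W H \<and> (\<forall>x'\<in>{0..1} \<inter> N. \<forall>z\<in>?B. (\<phi> x', z) \<in> W \<and> F i x' z = H (\<phi> x', z))"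
    proof (intro exI conjI)
      show "smooth_on (?T -` ?B) (\<lambda>p. pderiv_dir i f (?T p))"
        using W by (intro smooth_on_compose[OF smooth_on_pderiv[OF f]] smooth_on_subset[OF T]) auto
      show "\<forall>x'\<in>{0..1} \<inter> UNIV. \<forall>z\<in>?B. (x', z) \<in> ?T -` ?B \<and> F i x' z = pderiv_dir i f (?T (x', z))"
        using mem by (auto simp: F_def)
    qed (use W in \<open>auto intro: continuous_intros\<close>)
  qed simp
  show "smooth_on ?B (g i)" for i
    unfolding smooth_on_def g_def using sm
    by (intro allI Ck_on_Ck_param_integral) (auto simp: emeasure_lborel_Icc_eq)
  show "g i y0 = pderiv_dir i f y0" for i
    by (simp add: g_def F_def set_lebesgue_integral_def)
  show "f y = f y0 + (\<Sum>i\<in>Basis. ((y - y0) \<bullet> i) * g i y)" if y: "y \<in> ?B" for y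
  proof -
    have c: "continuous_on {0..1} (\<lambda>s. F i s y)" for i
      using sm[of 0 i] continuous_on_section[of "{0..1}" ?B "F i" y] y by simp
    note int = set_integrable_continuous_compact[of lborel "{0..1}", OF _ _ _ c]
    have "((\<lambda>s. f (y0 + s *\<^sub>R (y - y0))) has_vector_derivative
        (\<Sum>i\<in>Basis. ((y - y0) \<bullet> i) * F i s y)) (at s within {0..1})" if "0 \<le> s" "s \<le> 1" for s
    proof -
      have d: "f differentiable (at (y0 + s *\<^sub>R (y - y0)))"
        using smooth_on_imp_differentiable[OF f] mem[of s y] y that by auto
      have "((\<lambda>s. f (y0 + s *\<^sub>R (y - y0))) has_derivative
          (\<lambda>h. frechet_derivative f (at (y0 + s *\<^sub>R (y - y0))) (h *\<^sub>R (y - y0)))) (at s)"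
      proof (rule has_derivative_compose[of "\<lambda>s. y0 + s *\<^sub>R (y - y0)" "\<lambda>h. h *\<^sub>R (y - y0)" s UNIV f])
        show "((\<lambda>s. y0 + s *\<^sub>R (y - y0)) has_derivative (\<lambda>h. h *\<^sub>R (y - y0))) (at s)"
          by (auto intro!: derivative_eq_intros)
      qed (use d frechet_derivative_works in blast)
      then have "((\<lambda>s. f (y0 + s *\<^sub>R (y - y0))) has_derivative
          (\<lambda>h. h *\<^sub>R pderiv_dir (y - y0) f (y0 + s *\<^sub>R (y - y0)))) (at s)"
        by (simp only: linear_scale[OF linear_frechet_derivative[OF d]])
      moreover have "pderiv_dir (y - y0) f (y0 + s *\<^sub>R (y - y0)) = (\<Sum>i\<in>Basis. ((y - y0) \<bullet> i) * F i s y)"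
        unfolding F_def by (rule pderiv_dir_sum_Basis[OF d, unfolded real_scaleR_def])
      ultimately show ?thesis
        unfolding has_vector_derivative_def by (simp only: has_derivative_at_withinI)
    qed
    then have "(LINT s|lborel. indicator {0..1} s *\<^sub>R (\<Sum>i\<in>Basis. ((y - y0) \<bullet> i) * F i s y))
        = f (y0 + 1 *\<^sub>R (y - y0)) - f (y0 + 0 *\<^sub>R (y - y0))"
      by (intro integral_FTC_Icc continuous_intros c) auto
    moreover have "(LINT s|lborel. indicator {0..1} s *\<^sub>R (\<Sum>i\<in>Basis. ((y - y0) \<bullet> i) * F i s y))
        = (\<Sum>i\<in>Basis. ((y - y0) \<bullet> i) * g i y)"
      using int unfolding g_def set_lebesgue_integral_def set_integrable_def
      by (simp add: sum_distrib_left mult.left_commute[of "indicator _ _"])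
    ultimately show ?thesis by simp
  qed
qed

section \<open>Smooth functions and measures on manifolds\<close>

lemma smooth_on_bump:
  fixes y0 :: "'e::euclidean_space"
  assumes "0 < r"
  obtains \<beta> :: "'e \<Rightarrow> real" where "smooth_on UNIV \<beta>" "\<And>y. 0 \<le> \<beta> y"
    "\<And>y. y \<notin> cball y0 r \<Longrightarrow> \<beta> y = 0" "\<And>y. y \<in> ball y0 (r / 2) \<Longrightarrow> \<beta> y = 1"
proof
  \<comment> \<open>A function of the squared distance, because the norm is not smooth at
    \<open>y0\<close>. The step has argument at least 1 up to distance r / sqrt 2 and at most 0 from
    distance r on.\<close>
  define \<beta> where "\<beta> y = smooth_step (2 - 2 / r\<^sup>2 * ((y - y0) \<bullet> (y - y0)))" for y
  have sq: "smooth_on UNIV (\<lambda>y. (y - y0) \<bullet> (y - y0))"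
  proof -
    have "(\<lambda>y. (y - y0) \<bullet> (y - y0)) = (\<lambda>y. \<Sum>i\<in>Basis. ((y - y0) \<bullet> i) * ((y - y0) \<bullet> i))"
      by (rule ext) (rule euclidean_inner)
    moreover have "smooth_on UNIV \<dots>" by (intro smooth_intros) auto
    ultimately show ?thesis by simp
  qed
  show "smooth_on UNIV \<beta>"
    unfolding \<beta>_def
    by (rule smooth_on_compose[OF smooth_on_step]) (intro smooth_intros sq open_UNIV | simp)+
  show "0 \<le> \<beta> y" for y by (simp add: \<beta>_def smooth_step_nonneg)
  show "\<beta> y = 0" if "y \<notin> cball y0 r" for y
  proof -
    have "r\<^sup>2 \<le> (norm (y - y0))\<^sup>2"
      using that assms by (intro power_mono) (auto simp: dist_norm norm_minus_commute)
    then show ?thesis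
      using assms unfolding \<beta>_def by (intro smooth_step_eq_0) (simp add: field_simps dot_square_norm)
  qed
  show "\<beta> y = 1" if "y \<in> ball y0 (r / 2)" for y
  proof -
    have "(norm (y - y0))\<^sup>2 \<le> (r / 2)\<^sup>2"
      using that assms by (intro power_mono) (auto simp: dist_norm norm_minus_commute)
    then have "2 * (norm (y - y0))\<^sup>2 \<le> r\<^sup>2"
      using assms by (simp add: power_divide) (smt (verit) zero_le_power2)
    then show ?thesis
      using assms unfolding \<beta>_def by (intro smooth_step_eq_1) (simp add: field_simps dot_square_norm)
  qed
qed

lemma fun_supp_closed: "closed (fun_supp f)"
  by (simp add: fun_supp_def)

lemma not_in_fun_supp: "x \<notin> fun_supp f \<Longrightarrow> f x = 0"
  using closure_subset[of "{x. f x \<noteq> 0}"] by (auto simp: fun_supp_def)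

lemma fun_supp_subset_closed: "closed C \<Longrightarrow> (\<And>x. x \<notin> C \<Longrightarrow> f x = 0) \<Longrightarrow> fun_supp f \<subseteq> C"
  unfolding fun_supp_def by (intro closure_minimal) auto

section \<open>Charts, smooth functions and cut-offs\<close>

locale smooth_manifold =
  fixes A :: "('a::{t2_space,second_countable_topology}, 'e::euclidean_space) chart set"
  assumes atlas: "smooth_atlas A"
begin

lemma chart_at: obtains U \<phi> \<psi> where "(U, \<phi>, \<psi>) \<in> A" "x \<in> U"
proof -
  have "x \<in> (\<Union>(U, \<phi>, \<psi>)\<in>A. U)" using atlas by (simp add: smooth_atlas_def)
  then show thesis using that by auto
qed

context
  fixes U \<phi> \<psi> assumes c: "(U, \<phi>, \<psi>) \<in> A"
begin

lemma chart_homeomorphism: "open U" "open (\<phi> ` U)" "homeomorphism U (\<phi> ` U) \<phi> \<psi>"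
  using atlas c by (fastforce simp: smooth_atlas_def)+

lemma chart_inverse [simp]: "x \<in> U \<Longrightarrow> \<psi> (\<phi> x) = x" "y \<in> \<phi> ` U \<Longrightarrow> \<phi> (\<psi> y) = y"
  "y \<in> \<phi> ` U \<Longrightarrow> \<psi> y \<in> U"
  using chart_homeomorphism(3) by (auto simp: homeomorphism_def)

lemma chart_continuous: "continuous_on U \<phi>" "continuous_on (\<phi> ` U) \<psi>"
  using chart_homeomorphism(3) by (auto simp: homeomorphism_def)

lemma open_chart_image:
  assumes "open N" shows "open (\<phi> ` (U \<inter> N))"
proof -
  have "open (\<psi> -` N \<inter> \<phi> ` U)"
    using continuous_on_open_vimage[OF chart_homeomorphism(2)] chart_continuous(2) assms by blast
  moreover have "\<psi> -` N \<inter> \<phi> ` U = \<phi> ` (U \<inter> N)"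
    by (auto simp: image_iff)
  ultimately show ?thesis by simp
qed

lemma open_chart_inverse_image:
  assumes "open V" "V \<subseteq> \<phi> ` U" shows "open (\<psi> ` V)"
proof -
  have "open (\<phi> -` V \<inter> U)"
    using continuous_on_open_vimage[OF chart_homeomorphism(1)] chart_continuous(1) assms by blast
  moreover have "\<phi> -` V \<inter> U = \<psi> ` V"
  proof (intro subset_antisym subsetI)
    show "x \<in> \<psi> ` V" if "x \<in> \<phi> -` V \<inter> U" for x
      using that by (intro image_eqI[of _ _ "\<phi> x"]) simp_all
    fix x assume "x \<in> \<psi> ` V"
    then obtain y where y: "y \<in> V" "x = \<psi> y" by blast
    then have "y \<in> \<phi> ` U" using assms(2) by blast
    then show "x \<in> \<phi> -` V \<inter> U" using y by simp
  qed
  ultimately show ?thesis by simp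
qed

lemma compact_chart_inverse_image:
  assumes "compact K" "K \<subseteq> \<phi> ` U" shows "compact (\<psi> ` K)"
  using assms chart_continuous(2) by (blast intro: compact_continuous_image continuous_on_subset)

lemma smooth_fun_chart: "smooth_fun A f \<Longrightarrow> smooth_on (\<phi> ` U) (f \<circ> \<psi>)"
  using c by (auto simp: smooth_fun_def)

lemma chart_transition: "(U', \<phi>', \<psi>') \<in> A \<Longrightarrow> smooth_on (\<phi> ` (U \<inter> U')) (\<phi>' \<circ> \<psi>)"
  using atlas c by (fastforce simp: smooth_atlas_def)

lemma differentiable_chart: "smooth_fun A f \<Longrightarrow> x \<in> U \<Longrightarrow> (f \<circ> \<psi>) differentiable (at (\<phi> x))"
  using smooth_on_imp_differentiable[OF smooth_fun_chart] by blast

end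

lemma smooth_funI:
  assumes "\<And>U \<phi> \<psi>. (U, \<phi>, \<psi>) \<in> A \<Longrightarrow> smooth_on (\<phi> ` U) (\<lambda>y. f (\<psi> y))"
  shows "smooth_fun A f"
  using assms by (auto simp: smooth_fun_def o_def)

lemma smooth_fun_const: "smooth_fun A (\<lambda>_. c)"
  by (intro smooth_funI smooth_intros)

lemma smooth_fun_add: "smooth_fun A f \<Longrightarrow> smooth_fun A g \<Longrightarrow> smooth_fun A (\<lambda>x. f x + g x)"
  using smooth_fun_chart chart_homeomorphism(2)
  by (intro smooth_funI smooth_intros) (auto simp: o_def)

lemma smooth_fun_mult: "smooth_fun A f \<Longrightarrow> smooth_fun A g \<Longrightarrow> smooth_fun A (\<lambda>x. f x * g x)"
  using smooth_fun_chart chart_homeomorphism(2)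
  by (intro smooth_funI smooth_intros) (auto simp: o_def)

lemma smooth_fun_diff: "smooth_fun A f \<Longrightarrow> smooth_fun A g \<Longrightarrow> smooth_fun A (\<lambda>x. f x - g x)"
  using smooth_fun_chart chart_homeomorphism(2)
  by (intro smooth_funI smooth_intros) (auto simp: o_def)

lemma smooth_fun_sum: "(\<And>i. i \<in> I \<Longrightarrow> smooth_fun A (f i)) \<Longrightarrow> smooth_fun A (\<lambda>x. \<Sum>i\<in>I. f i x)"
  by (induction I rule: infinite_finite_induct) (auto intro: smooth_fun_const smooth_fun_add)

lemma smooth_fun_compose:
  assumes "smooth_on UNIV \<Phi>" "smooth_fun A f"
  shows "smooth_fun A (\<lambda>x. \<Phi> (f x))"
  using smooth_fun_chart[OF _ assms(2)] chart_homeomorphism(2)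
  by (intro smooth_funI smooth_on_compose[OF assms(1)]) (auto simp: o_def)

lemma smooth_fun_continuous: assumes "smooth_fun A f" shows "continuous_on UNIV f"
proof (intro continuous_at_imp_continuous_on ballI)
  fix x :: 'a
  obtain U \<phi> \<psi> where c: "(U, \<phi>, \<psi>) \<in> A" "x \<in> U" by (rule chart_at)
  have "continuous_on U (\<lambda>x. (f \<circ> \<psi>) (\<phi> x))"
    by (rule continuous_on_compose2[OF smooth_on_imp_continuous_on[OF smooth_fun_chart[OF c(1) assms]]
          chart_continuous(1)[OF c(1)]]) auto
  then have "continuous_on U f"
    by (rule continuous_on_eq) (simp add: chart_inverse[OF c(1)])
  then show "isCont f x"
    using chart_homeomorphism(1)[OF c(1)] c(2) by (simp add: continuous_on_eq_continuous_at)
qed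

lemma test_fun_smooth: "test_fun A f \<Longrightarrow> smooth_fun A f"
  by (simp add: test_fun_def)

lemma test_funI:
  assumes "smooth_fun A f" "compact K" "\<And>x. x \<notin> K \<Longrightarrow> f x = 0"
  shows "test_fun A f"
  using assms fun_supp_subset_closed[OF compact_imp_closed[OF assms(2)] assms(3)]
    closed_Int_compact[OF fun_supp_closed[of f] assms(2)]
  by (auto simp: test_fun_def Int_absorb2)

lemma test_fun_mult: "test_fun A f \<Longrightarrow> smooth_fun A g \<Longrightarrow> test_fun A (\<lambda>x. f x * g x)"
  by (rule test_funI[where K="fun_supp f"])
    (auto simp: test_fun_def not_in_fun_supp intro: smooth_fun_mult)

lemma test_fun_mult_right: "smooth_fun A f \<Longrightarrow> test_fun A g \<Longrightarrow> test_fun A (\<lambda>x. f x * g x)"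
  using test_fun_mult[of g f] by (simp add: mult.commute)

lemma test_fun_add: "test_fun A f \<Longrightarrow> test_fun A g \<Longrightarrow> test_fun A (\<lambda>x. f x + g x)"
  by (rule test_funI[where K="fun_supp f \<union> fun_supp g"])
    (auto simp: test_fun_def not_in_fun_supp intro: smooth_fun_add compact_Un)

text \<open>Two open sets cover the manifold: the image of V, where the extension is \<beta>
  composed with a transition map, and the complement of the image of K, where it is 0. The second is
  open because compact sets are closed in a Hausdorff space.\<close>

lemma test_fun_chart_extension:
  assumes c: "(U, \<phi>, \<psi>) \<in> A" and V: "open V" "V \<subseteq> \<phi> ` U" and \<beta>: "smooth_on V \<beta>"
    and K: "compact K" "K \<subseteq> V" "\<And>y. y \<in> V - K \<Longrightarrow> \<beta> y = 0"
  shows "test_fun A (\<lambda>x. if x \<in> \<psi> ` V then \<beta> (\<phi> x) else 0)" (is "test_fun A ?f")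
proof (rule test_funI)
  note inv = chart_inverse[OF c]
  have KU: "K \<subseteq> \<phi> ` U" using K(2) V(2) by blast
  show K': "compact (\<psi> ` K)"
    using compact_chart_inverse_image[OF c K(1) KU] .
  show z: "?f x = 0" if nK: "x \<notin> \<psi> ` K" for x
  proof -
    have "\<beta> (\<phi> x) = 0" if x: "x \<in> \<psi> ` V"
    proof -
      obtain y where "y \<in> V" "x = \<psi> y" using x by blast
      moreover from this have "y \<notin> K" using nK by blast
      ultimately show ?thesis using V(2) inv(2)[of y] K(3)[of y] by auto
    qed
    then show ?thesis by simp
  qed
  show "smooth_fun A ?f"
  proof (rule smooth_funI)
    fix U' \<phi>' \<psi>' assume c': "(U', \<phi>', \<psi>') \<in> A"
    note inv' = chart_inverse[OF c']
    show "smooth_on (\<phi>' ` U') (\<lambda>y. ?f (\<psi>' y))"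
    proof (rule smooth_on_local)
      fix y assume y: "y \<in> \<phi>' ` U'"
      show "\<exists>N. open N \<and> y \<in> N \<and> smooth_on N (\<lambda>y. ?f (\<psi>' y))"
      proof (cases "\<psi>' y \<in> \<psi> ` V")
        case True
        let ?N = "\<phi>' ` (U' \<inter> \<psi> ` V)"
        have VU: "\<psi> ` V \<subseteq> U" using V(2) inv(3) by blast
        have oN: "open ?N"
          using open_chart_image[OF c' open_chart_inverse_image[OF c V]] .
        have tr: "smooth_on ?N (\<phi> \<circ> \<psi>')"
          by (rule smooth_on_subset[OF chart_transition[OF c' c]]) (use VU in auto)
        have "(\<phi> \<circ> \<psi>') ` ?N \<subseteq> V"
        proof clarsimp
          fix v assume "v \<in> V" "\<psi> v \<in> U'"
          then show "\<phi> (\<psi>' (\<phi>' (\<psi> v))) \<in> V"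
            using inv'(1)[of "\<psi> v"] inv(2)[of v] V(2) by auto
        qed
        then have "smooth_on ?N (\<lambda>y. \<beta> ((\<phi> \<circ> \<psi>') y))"
          by (intro smooth_on_compose[OF \<beta> tr] oN V(1))
        then have "smooth_on ?N (\<lambda>y. ?f (\<psi>' y))"
          by (subst smooth_on_cong[OF oN]) (auto simp: inv')
        moreover have "y \<in> ?N"
          using True y inv'(2)[OF y] inv'(3)[OF y] by (metis Int_iff imageI)
        ultimately show ?thesis using oN by blast
      next
        case False
        let ?N = "\<phi>' ` (U' \<inter> - (\<psi> ` K))"
        have oN: "open ?N"
          using open_chart_image[OF c'] compact_imp_closed[OF K'] by blast
        have "smooth_on ?N (\<lambda>y. ?f (\<psi>' y))"
        proof (subst smooth_on_cong[OF oN])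
          show "?f (\<psi>' y) = 0" if "y \<in> ?N" for y
            by (rule z) (use that inv'(1) in auto)
        qed (rule smooth_on_const)
        moreover have "y \<in> ?N"
        proof -
          have "\<psi>' y \<notin> \<psi> ` K" using False K(2) by blast
          then show ?thesis using y inv'(2)[OF y] inv'(3)[OF y] by (metis Compl_iff Int_iff imageI)
        qed
        ultimately show ?thesis using oN by blast
      qed
    qed
  qed
qed

text \<open>Lets functions given only in a chart enter operators defined on global functions: near
  x, \<open>E b\<close> is b in coordinates. The same cut-off \<beta> serves every b, so products of
  several extensions carry a known power of \<beta>.\<close>

lemma chart_bump:
  assumes c: "(U, \<phi>, \<psi>) \<in> A" "x \<in> U" and V: "open V" "x \<in> V"
  obtains r \<beta> E where "0 < r" "ball (\<phi> x) r \<subseteq> \<phi> ` (U \<inter> V)"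
    "\<And>b. smooth_on (ball (\<phi> x) r) b \<Longrightarrow> test_fun A (E b)"
    "\<And>b z. z \<notin> \<psi> ` ball (\<phi> x) r \<Longrightarrow> E b z = 0"
    "\<And>b y. y \<in> ball (\<phi> x) r \<Longrightarrow> E b (\<psi> y) = \<beta> y * b y"
    "\<And>y. 0 \<le> \<beta> y" "\<And>y. y \<in> ball (\<phi> x) (r / 4) \<Longrightarrow> \<beta> y = 1"
proof -
  obtain r where r: "r > 0" "ball (\<phi> x) r \<subseteq> \<phi> ` (U \<inter> V)"
    using open_chart_image[OF c(1) V(1)] c(2) V(2) openE by blast
  then have rU: "ball (\<phi> x) r \<subseteq> \<phi> ` U" by blast
  \<comment> \<open>Radius r / 2 makes the closed support compact inside the open ball of radius r,
    and leaves the value 1 on the ball of radius r / 4.\<close>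
  have r2: "0 < r / 2" using r(1) by simp
  obtain \<beta> :: "'e \<Rightarrow> real" where \<beta>: "smooth_on UNIV \<beta>" "\<And>y. 0 \<le> \<beta> y"
    "\<And>y. y \<notin> cball (\<phi> x) (r / 2) \<Longrightarrow> \<beta> y = 0" "\<And>y. y \<in> ball (\<phi> x) (r / 2 / 2) \<Longrightarrow> \<beta> y = 1"
    by (rule smooth_on_bump[OF r2, where ?y0.0 = "\<phi> x"]) (rule that; assumption)
  show thesis
  proof (rule that[OF r, of "\<lambda>b z. if z \<in> \<psi> ` ball (\<phi> x) r then \<beta> (\<phi> z) * b (\<phi> z) else 0" \<beta>])
    show "test_fun A (\<lambda>z. if z \<in> \<psi> ` ball (\<phi> x) r then \<beta> (\<phi> z) * b (\<phi> z) else 0)"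
      if b: "smooth_on (ball (\<phi> x) r) b" for b
      using r(1) rU \<beta>(3) smooth_on_subset[OF \<beta>(1) subset_UNIV]
      by (intro test_fun_chart_extension[OF c(1), where K="cball (\<phi> x) (r / 2)" and \<beta>="\<lambda>y. \<beta> y * b y"]
          smooth_on_mult b) auto
    show "(if \<psi> y \<in> \<psi> ` ball (\<phi> x) r then \<beta> (\<phi> (\<psi> y)) * b (\<phi> (\<psi> y)) else 0) = \<beta> y * b y"
      if "y \<in> ball (\<phi> x) r" for b y
      using that chart_inverse(2)[OF c(1), of y] rU by auto
  qed (use \<beta>(2,4) in auto)
qed

lemma bump_at:
  assumes V: "open V" "x \<in> V"
  obtains \<theta> N where "test_fun A \<theta>" "\<And>y. 0 \<le> \<theta> y" "\<And>y. y \<notin> V \<Longrightarrow> \<theta> y = 0"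
    "open N" "x \<in> N" "\<And>y. y \<in> N \<Longrightarrow> \<theta> y = 1"
proof -
  obtain U \<phi> \<psi> where c: "(U, \<phi>, \<psi>) \<in> A" "x \<in> U" by (rule chart_at)
  obtain r \<beta> E where r: "0 < r" "ball (\<phi> x) r \<subseteq> \<phi> ` (U \<inter> V)"
    and E: "\<And>b. smooth_on (ball (\<phi> x) r) b \<Longrightarrow> test_fun A (E b)"
      "\<And>b z. z \<notin> \<psi> ` ball (\<phi> x) r \<Longrightarrow> E b z = 0"
      "\<And>b y. y \<in> ball (\<phi> x) r \<Longrightarrow> E b (\<psi> y) = \<beta> y * b y"
    and \<beta>: "\<And>y. 0 \<le> \<beta> y" "\<And>y. y \<in> ball (\<phi> x) (r / 4) \<Longrightarrow> \<beta> y = 1"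
    by (rule chart_bump[OF c V]) (rule that; assumption)
  have sub: "ball (\<phi> x) (r / 4) \<subseteq> ball (\<phi> x) r" using r(1) by auto
  show thesis
  proof (rule that)
    show "test_fun A (E (\<lambda>_. 1))" by (intro E smooth_on_const)
    show "0 \<le> E (\<lambda>_. 1) y" for y
      using E(2)[of y] E(3) \<beta>(1) by (cases "y \<in> \<psi> ` ball (\<phi> x) r") auto
    show "E (\<lambda>_. 1) y = 0" if y: "y \<notin> V" for y
    proof (rule E(2))
      show "y \<notin> \<psi> ` ball (\<phi> x) r" using r(2) y chart_inverse(1)[OF c(1)] by fastforce
    qed
    show "open (\<psi> ` ball (\<phi> x) (r / 4))"
      using sub r(2) by (intro open_chart_inverse_image[OF c(1)]) auto
    show "x \<in> \<psi> ` ball (\<phi> x) (r / 4)"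
      using r(1) chart_inverse(1)[OF c] by (intro image_eqI[of _ _ "\<phi> x"]) auto
    show "E (\<lambda>_. 1) y = 1" if "y \<in> \<psi> ` ball (\<phi> x) (r / 4)" for y
      using that sub E(3) \<beta>(2) by auto
  qed
qed

lemma cutoff_compact:
  assumes "compact K"
  obtains \<theta> W where "test_fun A \<theta>" "open W" "K \<subseteq> W" "\<And>y. y \<in> W \<Longrightarrow> \<theta> y = 1"
proof -
  have "\<exists>\<theta> N. test_fun A \<theta> \<and> open N \<and> x \<in> N \<and> (\<forall>y\<in>N. \<theta> y = 1)" for x
    using bump_at[OF open_UNIV, of x] by (metis UNIV_I)
  then obtain \<theta> N where N: "\<And>x. test_fun A (\<theta> x)" "\<And>x. open (N x)" "\<And>x. x \<in> N x"
    "\<And>x y. y \<in> N x \<Longrightarrow> \<theta> x y = 1"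
    by metis
  have "K \<subseteq> (\<Union>x\<in>UNIV. N x)" using N(3) by auto
  then obtain I where I: "finite I" "K \<subseteq> (\<Union>x\<in>I. N x)"
    by (rule compactE_image[OF assms, of UNIV N, rotated]) (use N(2) in auto)
  have "\<exists>\<theta>. test_fun A \<theta> \<and> (\<forall>y\<in>(\<Union>x\<in>I. N x). \<theta> y = 1)"
    using I(1)
  proof induction
    case empty
    show ?case by (rule exI[of _ "\<lambda>_. 0"]) (auto intro: test_funI[where K="{}"] smooth_fun_const)
  next
    case (insert x I)
    then obtain \<eta> where \<eta>: "test_fun A \<eta>" "\<And>y. y \<in> (\<Union>x\<in>I. N x) \<Longrightarrow> \<eta> y = 1" by blast
    \<comment> \<open>This is 1 - (1 - \<eta>) (1 - \<theta>), which is 1 as soon as one of the two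
      cut-offs is; no normalisation is required.\<close>
    have "test_fun A (\<lambda>y. \<eta> y + \<theta> x y * (1 - \<eta> y))"
      by (intro test_fun_add \<eta> test_fun_mult N smooth_fun_diff smooth_fun_const test_fun_smooth)
    moreover have "\<eta> y + \<theta> x y * (1 - \<eta> y) = 1" if "y \<in> (\<Union>x\<in>insert x I. N x)" for y
      using \<eta>(2)[of y] N(4)[of y x] that by (cases "y \<in> N x") auto
    ultimately show ?case by blast
  qed
  then show thesis
    using that[of _ "\<Union>x\<in>I. N x"] I(2) N(2) by blast
qed

end

section \<open>The smooth measure and integrals against test functions\<close>

locale measured_manifold = smooth_manifold A
  for A :: "('a::{t2_space,second_countable_topology}, 'e::euclidean_space) chart set" +
  fixes \<mu> :: "'a measure"
  assumes smooth_measure: "smooth_measure A \<mu>"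
begin

lemma sets_\<mu> [measurable_cong, simp]: "sets \<mu> = sets borel"
  using smooth_measure by (simp add: smooth_measure_def)

lemma space_\<mu> [simp]: "space \<mu> = UNIV"
  using sets_eq_imp_space_eq[OF sets_\<mu>] by simp

lemma chart_density:
  assumes "(U, \<phi>, \<psi>) \<in> A"
  obtains w where "smooth_on (\<phi> ` U) w" "\<And>y. y \<in> \<phi> ` U \<Longrightarrow> 0 < w y"
    "\<And>B. B \<in> sets borel \<Longrightarrow> B \<subseteq> U \<Longrightarrow>
      emeasure \<mu> B = (\<integral>\<^sup>+ y. ennreal (w y) * indicator (\<phi> ` B) y \<partial>lborel)"
  using smooth_measure assms unfolding smooth_measure_def by fastforce

lemma emeasure_compact_finite:
  assumes "compact K" shows "emeasure \<mu> K < \<infinity>"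
proof -
  have "\<exists>N. open N \<and> x \<in> N \<and> emeasure \<mu> N < \<infinity>" for x
  proof -
    obtain U \<phi> \<psi> where c: "(U, \<phi>, \<psi>) \<in> A" "x \<in> U" by (rule chart_at)
    note inv = chart_inverse[OF c(1)]
    obtain w where w: "smooth_on (\<phi> ` U) w" "\<And>y. y \<in> \<phi> ` U \<Longrightarrow> 0 < w y"
      "\<And>B. B \<in> sets borel \<Longrightarrow> B \<subseteq> U \<Longrightarrow>
        emeasure \<mu> B = (\<integral>\<^sup>+ y. ennreal (w y) * indicator (\<phi> ` B) y \<partial>lborel)"
      using chart_density[OF c(1)] by blast
    obtain r where r: "r > 0" "cball (\<phi> x) r \<subseteq> \<phi> ` U"
      using open_contains_cball chart_homeomorphism(2)[OF c(1)] c(2) by blast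
    let ?b = "ball (\<phi> x) r"
    have b: "?b \<subseteq> \<phi> ` U" using r(2) by (auto simp: subset_iff)
    have "continuous_on (cball (\<phi> x) r) w"
      using continuous_on_subset[OF smooth_on_imp_continuous_on[OF w(1)] r(2)] .
    then obtain M where M: "\<And>y. y \<in> cball (\<phi> x) r \<Longrightarrow> norm (w y) \<le> M"
      using compact_imp_bounded[OF compact_continuous_image[OF _ compact_cball]] by (fastforce simp: bounded_iff)
    have o: "open (\<psi> ` ?b)" using open_chart_inverse_image[OF c(1) open_ball b] .
    have im: "\<phi> ` \<psi> ` ?b = ?b"
      using b inv(2) by (intro image_image[THEN trans] trans[OF image_cong image_ident]) auto
    have "\<psi> ` ?b \<subseteq> U" using b inv(3) by blast
    then have "emeasure \<mu> (\<psi> ` ?b) = (\<integral>\<^sup>+ y. ennreal (w y) * indicator ?b y \<partial>lborel)"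
      using w(3)[of "\<psi> ` ?b"] o im by simp
    also have "\<dots> \<le> (\<integral>\<^sup>+ y. ennreal M * indicator ?b y \<partial>lborel)"
      using M by (intro nn_integral_mono) (auto split: split_indicator intro!: ennreal_leI simp: abs_le_iff)
    also have "\<dots> = ennreal M * emeasure lborel ?b"
      by (rule nn_integral_cmult_indicator) auto
    also have "\<dots> < \<infinity>"
      using emeasure_lborel_ball_finite[of "\<phi> x" r] by (simp add: ennreal_mult_less_top)
    finally show ?thesis
      using o r(1) inv(1)[OF c(2)] by (intro exI[of _ "\<psi> ` ?b"]) (auto intro!: image_eqI[of _ _ "\<phi> x"])
  qed
  then obtain N where N: "\<And>x. open (N x)" "\<And>x. x \<in> N x" "\<And>x. emeasure \<mu> (N x) < \<infinity>" by metis
  have "K \<subseteq> (\<Union>x\<in>UNIV. N x)" using N(2) by auto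
  then obtain I where I: "finite I" "K \<subseteq> (\<Union>x\<in>I. N x)"
    by (rule compactE_image[OF assms, of UNIV N, rotated]) (use N(1) in auto)
  have "emeasure \<mu> K \<le> emeasure \<mu> (\<Union>x\<in>I. N x)"
    using I(2) N(1) by (intro emeasure_mono) (auto intro!: borel_open open_UN)
  also have "\<dots> \<le> (\<Sum>x\<in>I. emeasure \<mu> (N x))"
    using N(1) by (intro emeasure_subadditive_finite I(1)) auto
  also have "\<dots> < \<infinity>" using N(3) I(1) by (simp add: ennreal_sum_less_top)
  finally show ?thesis .
qed

lemma emeasure_open_pos:
  assumes "open N" "x \<in> N" shows "emeasure \<mu> N \<noteq> 0"
proof
  assume 0: "emeasure \<mu> N = 0"
  obtain U \<phi> \<psi> where c: "(U, \<phi>, \<psi>) \<in> A" "x \<in> U" by (rule chart_at)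
  note inv = chart_inverse[OF c(1)]
  obtain w where w: "smooth_on (\<phi> ` U) w" "\<And>y. y \<in> \<phi> ` U \<Longrightarrow> 0 < w y"
    "\<And>B. B \<in> sets borel \<Longrightarrow> B \<subseteq> U \<Longrightarrow>
      emeasure \<mu> B = (\<integral>\<^sup>+ y. ennreal (w y) * indicator (\<phi> ` B) y \<partial>lborel)"
    using chart_density[OF c(1)] by blast
  let ?b = "\<phi> ` (U \<inter> N)"
  have o: "open (U \<inter> N)" using chart_homeomorphism(1)[OF c(1)] assms(1) by auto
  have ob: "open ?b" using open_chart_image[OF c(1) assms(1)] .
  have "emeasure \<mu> (U \<inter> N) \<le> emeasure \<mu> N"
    using assms(1) by (intro emeasure_mono) auto
  then have "(\<integral>\<^sup>+ y. ennreal (w y) * indicator ?b y \<partial>lborel) = 0"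
    using w(3)[of "U \<inter> N"] o 0 by simp
  moreover have "(\<lambda>y. ennreal (w y) * indicator ?b y) \<in> borel_measurable lborel"
  proof -
    have "continuous_on ?b w"
      by (rule continuous_on_subset[OF smooth_on_imp_continuous_on[OF w(1)]]) (rule image_mono, simp)
    then have "(\<lambda>y. indicator ?b y *\<^sub>R w y) \<in> borel_measurable borel"
      using ob by (intro borel_measurable_continuous_on_indicator) auto
    then have "(\<lambda>y. ennreal (indicator ?b y *\<^sub>R w y)) \<in> borel_measurable lborel" by simp
    moreover have "(\<lambda>y. ennreal (indicator ?b y *\<^sub>R w y)) = (\<lambda>y. ennreal (w y) * indicator ?b y)"
      by (auto split: split_indicator)
    ultimately show ?thesis by simp
  qed
  ultimately have "AE y in lborel. ennreal (w y) * indicator ?b y = 0"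
    by (simp add: nn_integral_0_iff_AE)
  then have "AE y in lborel. y \<notin> ?b"
  proof eventually_elim
    case (elim y)
    then show ?case using w(2)[of y] by (auto simp: ennreal_eq_0_iff split: split_indicator_asm)
  qed
  then have "emeasure lborel ?b = 0"
    using ob by (subst (asm) AE_iff_measurable[OF _ refl]) auto
  moreover have "\<phi> x \<in> ?b" using c(2) assms(2) by auto
  ultimately show False
    using ob open_not_negligible[of ?b] by (auto simp: negligible_iff_null_sets null_sets_def null_sets_completionI)
qed

text \<open>A nonempty open set has positive measure. This is the bridge from almost-everywhere
  statements on continuous functions to pointwise ones.\<close>

lemma AE_open_imp_all:
  assumes "AE x in \<mu>. P x" "open {x. \<not> P x}"
  shows "P x"
proof (rule ccontr)
  assume "\<not> P x"
  moreover have "emeasure \<mu> {x. \<not> P x} = 0"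
    using assms by (subst (asm) AE_iff_measurable[OF _ refl]) auto
  ultimately show False using emeasure_open_pos[OF assms(2)] by simp
qed

lemma integrable_compact_support:
  assumes "continuous_on UNIV f" "compact K" "\<And>x. x \<notin> K \<Longrightarrow> f x = 0"
  shows "integrable \<mu> (f :: 'a \<Rightarrow> real)" "(LINT x|\<mu>. f x) = (LINT x:K|\<mu>. f x)"
proof -
  have eq: "(\<lambda>x. indicator K x *\<^sub>R f x) = f"
    using assms(3) by (auto split: split_indicator)
  show "integrable \<mu> f"
    using set_integrable_continuous_compact[OF sets_\<mu> assms(2) emeasure_compact_finite[OF assms(2)]
        continuous_on_subset[OF assms(1) subset_UNIV]]
    unfolding set_integrable_def eq .
  show "(LINT x|\<mu>. f x) = (LINT x:K|\<mu>. f x)"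
    by (simp add: set_lebesgue_integral_def eq del: real_scaleR_def)
qed

lemma integrable_test_fun:
  assumes "test_fun A f" shows "integrable \<mu> f"
  using integrable_compact_support(1)[OF smooth_fun_continuous[OF test_fun_smooth[OF assms]], of "fun_supp f"]
    assms not_in_fun_supp by (auto simp: test_fun_def)

lemma borel_measurable_smooth: assumes "smooth_fun A f" shows "f \<in> borel_measurable \<mu>"
  using borel_measurable_continuous_onI[OF smooth_fun_continuous[OF assms]] by (simp cong: measurable_cong_sets)

lemma test_fun_L2: "test_fun A f \<Longrightarrow> f \<in> L2_fun \<mu>"
  using integrable_test_fun[OF test_fun_mult[of f f]] borel_measurable_smooth
  by (auto simp: L2_fun_def power2_eq_square test_fun_smooth)

lemma test_fun_bounded:
  assumes "test_fun A f" obtains M where "0 < M" "\<And>x. \<bar>f x\<bar> \<le> M"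
proof -
  have "bounded (f ` fun_supp f)"
    using assms continuous_on_subset[OF smooth_fun_continuous[OF test_fun_smooth[OF assms]]]
    by (intro compact_imp_bounded compact_continuous_image) (auto simp: test_fun_def)
  then obtain M where "0 < M" "\<And>x. x \<in> fun_supp f \<Longrightarrow> \<bar>f x\<bar> \<le> M"
    by (force simp: bounded_pos)
  then show thesis using that[of M] not_in_fun_supp[of _ f] by (metis abs_zero less_imp_le)
qed

text \<open>The fundamental lemma of the calculus of variations: where g < f, a bump supported in
  that open set would see a positive integral. The roles of f and g are then exchanged.\<close>

lemma eq_of_test_integrals:
  assumes fg: "continuous_on UNIV f" "continuous_on UNIV g"
    and eq: "\<And>k. test_fun A k \<Longrightarrow> (LINT x|\<mu>. k x * f x) = (LINT x|\<mu>. k x * g x)"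
  shows "f x = (g x :: real)"
proof -
  have le: "f x \<le> g x" if fg: "continuous_on UNIV f" "continuous_on UNIV g"
    and eq: "\<And>k. test_fun A k \<Longrightarrow> (LINT x|\<mu>. k x * f x) = (LINT x|\<mu>. k x * g x)" for f g :: "'a \<Rightarrow> real"
  proof (rule ccontr)
    assume "\<not> f x \<le> g x"
    then have V: "open {x. g x < f x}" "x \<in> {x. g x < f x}"
      using fg by (auto intro: open_Collect_less)
    obtain \<theta> N where \<theta>: "test_fun A \<theta>" "\<And>y. 0 \<le> \<theta> y" "\<And>y. y \<notin> {x. g x < f x} \<Longrightarrow> \<theta> y = 0"
      "open N" "x \<in> N" "\<And>y. y \<in> N \<Longrightarrow> \<theta> y = 1"
      by (rule bump_at[OF V]) (rule that; assumption)
    have cont: "continuous_on UNIV \<theta>" using \<theta>(1) by (intro smooth_fun_continuous test_fun_smooth)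
    have int: "integrable \<mu> (\<lambda>x. \<theta> x * k x)" if "continuous_on UNIV k" for k :: "'a \<Rightarrow> real"
      using \<theta>(1) not_in_fun_supp[of _ \<theta>]
      by (intro integrable_compact_support(1)[of _ "fun_supp \<theta>"] continuous_intros cont that)
        (auto simp: test_fun_def)
    have nn: "0 \<le> \<theta> x * (f x - g x)" for x
      using \<theta>(2,3)[of x] by (cases "g x < f x") auto
    have "(LINT x|\<mu>. \<theta> x * (f x - g x)) = 0"
      using eq[OF \<theta>(1)] int[OF fg(1)] int[OF fg(2)] by (simp add: right_diff_distrib)
    then have ae: "AE x in \<mu>. \<theta> x * (f x - g x) = 0"
      using integral_nonneg_eq_0_iff_AE[OF int[OF continuous_on_diff[OF fg]]] nn by auto
    have "open {x. \<not> \<theta> x * (f x - g x) = 0}"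
      by (intro open_Collect_neq continuous_intros cont fg)
    from AE_open_imp_all[OF ae this, of x] \<theta>(5,6) V(2) show False by auto
  qed
  show ?thesis using le[OF fg eq] le[OF fg(2,1) eq[symmetric]] by simp
qed

end

section \<open>Differential operators in charts\<close>

lemma pderiv_dir2_mult:
  fixes f g :: "'e::euclidean_space \<Rightarrow> real"
  assumes f: "smooth_on S f" and g: "smooth_on S g" and S: "open S" "y \<in> S"
  shows "pderiv_dir i (pderiv_dir j (\<lambda>y. f y * g y)) y =
    f y * pderiv_dir i (pderiv_dir j g) y + g y * pderiv_dir i (pderiv_dir j f) y
    + pderiv_dir i f y * pderiv_dir j g y + pderiv_dir j f y * pderiv_dir i g y"
proof -
  note d = smooth_on_imp_differentiable
  have d1: "f differentiable (at y)" "g differentiable (at y)"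
    "pderiv_dir j f differentiable (at y)" "pderiv_dir j g differentiable (at y)"
    using d[OF f S(2)] d[OF g S(2)] d[OF smooth_on_pderiv[OF f S(1)] S(2)]
      d[OF smooth_on_pderiv[OF g S(1)] S(2)] by auto
  have "pderiv_dir i (pderiv_dir j (\<lambda>y. f y * g y)) y
      = pderiv_dir i (\<lambda>y. f y * pderiv_dir j g y + pderiv_dir j f y * g y) y"
    by (rule pderiv_dir_cong[OF S]) (intro pderiv_dir_mult d[OF f] d[OF g])
  also have "\<dots> = pderiv_dir i (\<lambda>y. f y * pderiv_dir j g y) y + pderiv_dir i (\<lambda>y. pderiv_dir j f y * g y) y"
    by (intro pderiv_dir_add differentiable_mult d1)
  also have "\<dots> = f y * pderiv_dir i (pderiv_dir j g) y + pderiv_dir i f y * pderiv_dir j g y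
      + (pderiv_dir j f y * pderiv_dir i g y + pderiv_dir i (pderiv_dir j f) y * g y)"
    by (simp only: pderiv_dir_mult[OF d1(1,4)] pderiv_dir_mult[OF d1(3,2)])
  finally show ?thesis by (simp add: algebra_simps)
qed

lemma pderiv_dir2_compose_real:
  fixes f :: "'e::euclidean_space \<Rightarrow> real"
  assumes f: "smooth_on S f" and S: "open S" "y \<in> S"
    and g: "\<And>s. (g has_real_derivative g' s) (at s)" "\<And>s. (g' has_real_derivative g'' s) (at s)"
  shows "pderiv_dir i (pderiv_dir j (\<lambda>y. g (f y))) y =
    g' (f y) * pderiv_dir i (pderiv_dir j f) y + g'' (f y) * (pderiv_dir i f y * pderiv_dir j f y)"
proof -
  note d = smooth_on_imp_differentiable
  have d1: "f differentiable (at y)" "pderiv_dir j f differentiable (at y)"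
    using d[OF f S(2)] d[OF smooth_on_pderiv[OF f S(1)] S(2)] by auto
  have "(\<lambda>y. g' (f y)) differentiable (at y)"
    using differentiable_chain_at[OF d1(1), of g'] g(2)[of "f y"]
    by (auto simp: o_def differentiable_def has_field_derivative_def)
  note dm = pderiv_dir_mult[OF this d1(2)]
  have "pderiv_dir i (pderiv_dir j (\<lambda>y. g (f y))) y = pderiv_dir i (\<lambda>y. g' (f y) * pderiv_dir j f y) y"
    by (rule pderiv_dir_cong[OF S]) (intro pderiv_dir_compose_real d[OF f] g(1))
  also have "\<dots> = g' (f y) * pderiv_dir i (pderiv_dir j f) y + g'' (f y) * pderiv_dir i f y * pderiv_dir j f y"
    by (simp only: dm pderiv_dir_compose_real[OF d1(1) g(2)])
  finally show ?thesis by (simp add: mult.assoc)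
qed

text \<open>Common source of the Cauchy-Schwarz inequalities for \<open>Gam\<close> and for the L2
  product; no definiteness is assumed, so c = 0 needs its own argument.\<close>

lemma quadratic_form_discriminant:
  fixes a b c :: real
  assumes "\<And>r s. 0 \<le> r\<^sup>2 * a + 2 * r * s * b + s\<^sup>2 * c"
  shows "b\<^sup>2 \<le> a * c"
proof (cases "c = 0")
  case True
  have "b = 0"
  proof (rule ccontr)
    assume ne: "b \<noteq> 0"
    \<comment> \<open>For c = 0 the form is affine in s when r = 1; this s gives it the value -
      1.\<close>
    show False
      using assms[of 1 "- (a + 1) / (2 * b)"] True ne by (simp add: field_simps)
  qed
  then show ?thesis using True by simp
next
  case False
  then have p: "0 < c" using assms[of 0 1] by simp
  have "0 \<le> c * (a * c - b\<^sup>2)"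
    using assms[of c "- b"] by (simp add: power2_eq_square algebra_simps)
  then show ?thesis using p by (simp add: zero_le_mult_iff)
qed

abbreviation chart_op where
  "chart_op a b \<phi> \<psi> f x \<equiv>
    (\<Sum>i\<in>Basis. \<Sum>j\<in>Basis. a i j (\<phi> x) * pderiv_dir i (pderiv_dir j (f \<circ> \<psi>)) (\<phi> x))
      + (\<Sum>i\<in>Basis. b i (\<phi> x) * pderiv_dir i (f \<circ> \<psi>) (\<phi> x) :: real)"

abbreviation chart_form where
  "chart_form a \<phi> \<psi> f g x \<equiv> (\<Sum>i\<in>Basis. \<Sum>j\<in>Basis.
    a i j (\<phi> x) * pderiv_dir i (f \<circ> \<psi>) (\<phi> x) * pderiv_dir j (g \<circ> \<psi>) (\<phi> x) :: real)"

section \<open>The diffusion operator, its carre du champ and integration by parts\<close>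

locale diffusion = measured_manifold A \<mu>
  for A :: "('a::{t2_space,second_countable_topology}, 'e::euclidean_space) chart set" and \<mu> +
  fixes L :: "('a \<Rightarrow> real) \<Rightarrow> 'a \<Rightarrow> real"
  assumes diffusion: "diffusion_operator A L" and L_one: "L (\<lambda>_. 1) = (\<lambda>_. 0)"
    and L_symmetric: "symmetric_nonpositive A \<mu> L"
begin

lemma L_chart:
  assumes c: "(U, \<phi>, \<psi>) \<in> A"
  obtains a b where "\<And>i j. i \<in> Basis \<Longrightarrow> j \<in> Basis \<Longrightarrow> smooth_on (\<phi> ` U) (a i j)"
    "\<And>i. i \<in> Basis \<Longrightarrow> smooth_on (\<phi> ` U) (b i)"
    "\<And>i j y. i \<in> Basis \<Longrightarrow> j \<in> Basis \<Longrightarrow> y \<in> \<phi> ` U \<Longrightarrow> a i j y = a j i y"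
    "\<And>\<xi> y. y \<in> \<phi> ` U \<Longrightarrow> 0 \<le> (\<Sum>i\<in>Basis. \<Sum>j\<in>Basis. a i j y * (\<xi> \<bullet> i) * (\<xi> \<bullet> j))"
    "\<And>f x. smooth_fun A f \<Longrightarrow> x \<in> U \<Longrightarrow>
      L f x = chart_op a b \<phi> \<psi> f x"
proof -
  obtain a b k where a: "\<forall>i\<in>Basis. \<forall>j\<in>Basis. smooth_on (\<phi> ` U) (a i j)"
    and b: "\<forall>i\<in>Basis. smooth_on (\<phi> ` U) (b i)"
    and s: "\<forall>y\<in>\<phi> ` U. (\<forall>i\<in>Basis. \<forall>j\<in>Basis. a i j y = a j i y) \<and>
            (\<forall>\<xi>. 0 \<le> (\<Sum>i\<in>Basis. \<Sum>j\<in>Basis. a i j y * (\<xi> \<bullet> i) * (\<xi> \<bullet> j)))"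
    and L: "\<forall>f. smooth_fun A f \<longrightarrow> (\<forall>x\<in>U.
      L f x = chart_op a b \<phi> \<psi> f x + k (\<phi> x) * f x)"
    using bspec[OF diffusion[unfolded diffusion_operator_def] c, unfolded prod.case]
    by (elim exE conjE) (rule that; assumption)
  have "k (\<phi> x) = 0" if "x \<in> U" for x
    using L[rule_format, OF smooth_fun_const that, of 1] L_one by (simp add: o_def)
  then show thesis
    using a b s L by (intro that[of a b]) auto
qed

lemma smooth_fun_L: assumes f: "smooth_fun A f" shows "smooth_fun A (L f)"
proof (rule smooth_funI)
  fix U \<phi> \<psi> assume c: "(U, \<phi>, \<psi>) \<in> A"
  note [intro] = chart_homeomorphism(2)[OF c]
  obtain a b where a: "\<And>i j. i \<in> Basis \<Longrightarrow> j \<in> Basis \<Longrightarrow> smooth_on (\<phi> ` U) (a i j)"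
    and b: "\<And>i. i \<in> Basis \<Longrightarrow> smooth_on (\<phi> ` U) (b i)"
    and L: "\<And>f x. smooth_fun A f \<Longrightarrow> x \<in> U \<Longrightarrow>
      L f x = chart_op a b \<phi> \<psi> f x"
    by (rule L_chart[OF c]) (rule that; assumption)
  show "smooth_on (\<phi> ` U) (\<lambda>y. L f (\<psi> y))"
  proof (subst smooth_on_cong)
    show "L f (\<psi> y) = (\<Sum>i\<in>Basis. \<Sum>j\<in>Basis. a i j y * pderiv_dir i (pderiv_dir j (f \<circ> \<psi>)) y)
        + (\<Sum>i\<in>Basis. b i y * pderiv_dir i (f \<circ> \<psi>) y)" if "y \<in> \<phi> ` U" for y
      using L[OF f, of "\<psi> y"] that chart_inverse[OF c] by simp
    show "smooth_on (\<phi> ` U) (\<lambda>y. (\<Sum>i\<in>Basis. \<Sum>j\<in>Basis. a i j y * pderiv_dir i (pderiv_dir j (f \<circ> \<psi>)) y)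
        + (\<Sum>i\<in>Basis. b i y * pderiv_dir i (f \<circ> \<psi>) y))"
      by (intro smooth_intros a b smooth_fun_chart[OF c f] chart_homeomorphism(2)[OF c])
  qed auto
qed

lemma L_local:
  assumes "smooth_fun A f" "smooth_fun A g" "open N" "x \<in> N" "\<And>y. y \<in> N \<Longrightarrow> f y = g y"
  shows "L f x = L g x"
proof -
  obtain U \<phi> \<psi> where c: "(U, \<phi>, \<psi>) \<in> A" "x \<in> U" by (rule chart_at)
  note inv = chart_inverse[OF c(1)]
  let ?N = "\<phi> ` (U \<inter> N)"
  have N: "open ?N" "\<phi> x \<in> ?N" using open_chart_image[OF c(1) assms(3)] assms(4) c(2) by auto
  have eq: "(f \<circ> \<psi>) y = (g \<circ> \<psi>) y" if "y \<in> ?N" for y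
    using that assms(5) inv by auto
  note e1 = pderiv_dir_cong[OF N(1) _ eq]
  note e2 = pderiv_dir_cong[OF N(1,2) e1]
  show ?thesis
    by (rule L_chart[OF c(1)]) (simp only: assms(1,2) c(2) e1[OF N(2)] e2)
qed

lemma L_linear:
  assumes f: "smooth_fun A f" and g: "smooth_fun A g"
  shows "L (\<lambda>y. r * f y + s * g y) x = r * L f x + s * L g x"
proof -
  obtain U \<phi> \<psi> where c: "(U, \<phi>, \<psi>) \<in> A" "x \<in> U" by (rule chart_at)
  note U = chart_homeomorphism(2)[OF c(1)]
  note F = smooth_fun_chart[OF c(1) f] and G = smooth_fun_chart[OF c(1) g]
  have lin: "pderiv_dir i (\<lambda>y. r * F y + s * G y) y = r * pderiv_dir i F y + s * pderiv_dir i G y"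
    if "smooth_on (\<phi> ` U) F" "smooth_on (\<phi> ` U) G" "y \<in> \<phi> ` U" for F G i and y :: 'e
  proof -
    note d = smooth_on_imp_differentiable[OF that(1,3)] smooth_on_imp_differentiable[OF that(2,3)]
    show ?thesis
      using d by (intro pderiv_dir_eq has_derivative_add has_derivative_mult_right)
        (simp_all add: frechet_derivative_works)
  qed
  have x: "\<phi> x \<in> \<phi> ` U" using c(2) by auto
  have o: "(\<lambda>y. r * f y + s * g y) \<circ> \<psi> = (\<lambda>y. r * (f \<circ> \<psi>) y + s * (g \<circ> \<psi>) y)" by (simp add: o_def)
  have l2: "pderiv_dir i (pderiv_dir j (\<lambda>y. r * (f \<circ> \<psi>) y + s * (g \<circ> \<psi>) y)) (\<phi> x)
      = r * pderiv_dir i (pderiv_dir j (f \<circ> \<psi>)) (\<phi> x) + s * pderiv_dir i (pderiv_dir j (g \<circ> \<psi>)) (\<phi> x)" for i j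
    using pderiv_dir_cong[OF U x lin[OF F G]] lin[OF smooth_on_pderiv[OF F U] smooth_on_pderiv[OF G U] x]
    by simp
  have fg: "smooth_fun A (\<lambda>y. r * f y + s * g y)"
    by (intro smooth_fun_add smooth_fun_mult smooth_fun_const f g)
  obtain a b where L: "\<And>f x. smooth_fun A f \<Longrightarrow> x \<in> U \<Longrightarrow>
      L f x = chart_op a b \<phi> \<psi> f x"
    by (rule L_chart[OF c(1)]) (rule that; assumption)
  show ?thesis
    unfolding L[OF fg c(2)] L[OF f c(2)] L[OF g c(2)] o lin[OF F G x] l2
    by (simp add: sum.distrib sum_distrib_left algebra_simps)
qed

lemma L_cmult: "smooth_fun A f \<Longrightarrow> L (\<lambda>y. r * f y) x = r * L f x"
  using L_linear[of f f r 0] by simp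

lemma L_add: "smooth_fun A f \<Longrightarrow> smooth_fun A g \<Longrightarrow> L (\<lambda>y. f y + g y) x = L f x + L g x"
  using L_linear[of f g 1 1] by simp

lemma L_const: "L (\<lambda>_. k) x = 0"
  using L_cmult[OF smooth_fun_const[of 1], of k x] L_one by simp

lemma test_fun_L: assumes "test_fun A f" shows "test_fun A (L f)"
proof (rule test_funI)
  show "smooth_fun A (L f)" using smooth_fun_L assms by (simp add: test_fun_def)
  show "compact (fun_supp f)" using assms by (simp add: test_fun_def)
  show "L f x = 0" if "x \<notin> fun_supp f" for x
    using L_local[of f "\<lambda>_. 0" "- fun_supp f" x] assms that fun_supp_closed[of f] not_in_fun_supp[of _ f]
    by (auto simp: test_fun_smooth smooth_fun_const L_const)
qed

text \<open>In the second-order product rule the terms with an underived factor cancel in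
  \<open>Gam\<close>, and the symmetry of a merges the two mixed terms. The chain rule is stated
  here as well because its extra term involves the same matrix a, which is available only
  existentially.\<close>

lemma Gam_chart:
  assumes c: "(U, \<phi>, \<psi>) \<in> A"
  obtains a where "\<And>\<xi> y. y \<in> \<phi> ` U \<Longrightarrow> 0 \<le> (\<Sum>i\<in>Basis. \<Sum>j\<in>Basis. a i j y * (\<xi> \<bullet> i) * (\<xi> \<bullet> j))"
    "\<And>f g x. smooth_fun A f \<Longrightarrow> smooth_fun A g \<Longrightarrow> x \<in> U \<Longrightarrow>
      Gam L f g x = chart_form a \<phi> \<psi> f g x"
    "\<And>\<Phi> \<Phi>' \<Phi>'' f x. smooth_on UNIV \<Phi> \<Longrightarrow> (\<And>s. (\<Phi> has_real_derivative \<Phi>' s) (at s)) \<Longrightarrow>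
      (\<And>s. (\<Phi>' has_real_derivative \<Phi>'' s) (at s)) \<Longrightarrow> smooth_fun A f \<Longrightarrow> x \<in> U \<Longrightarrow>
      L (\<lambda>y. \<Phi> (f y)) x = \<Phi>' (f x) * L f x + \<Phi>'' (f x) *
        chart_form a \<phi> \<psi> f f x"
proof -
  note U = chart_homeomorphism(2)[OF c]
  obtain a b where sym: "\<And>i j y. i \<in> Basis \<Longrightarrow> j \<in> Basis \<Longrightarrow> y \<in> \<phi> ` U \<Longrightarrow> a i j y = a j i y"
    and psd: "\<And>\<xi> y. y \<in> \<phi> ` U \<Longrightarrow> 0 \<le> (\<Sum>i\<in>Basis. \<Sum>j\<in>Basis. a i j y * (\<xi> \<bullet> i) * (\<xi> \<bullet> j))"
    and L: "\<And>f x. smooth_fun A f \<Longrightarrow> x \<in> U \<Longrightarrow>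
      L f x = chart_op a b \<phi> \<psi> f x"
    by (rule L_chart[OF c]) (rule that; assumption)
  show thesis
  proof (rule that[OF psd])
    fix f g x assume f: "smooth_fun A f" and g: "smooth_fun A g" and x: "x \<in> U"
    let ?f = "f \<circ> \<psi>" and ?g = "g \<circ> \<psi>" and ?x = "\<phi> x"
    have x': "?x \<in> \<phi> ` U" using x by auto
    note F = smooth_fun_chart[OF c f] and G = smooth_fun_chart[OF c g]
    have fx: "?f ?x = f x" "?g ?x = g x" using chart_inverse[OF c] x by auto
    have o: "(\<lambda>y. f y * g y) \<circ> \<psi> = (\<lambda>y. ?f y * ?g y)" by (simp add: o_def)
    have 1: "(\<Sum>i\<in>Basis. \<Sum>j\<in>Basis. a i j ?x * (pderiv_dir j ?f ?x * pderiv_dir i ?g ?x))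
        = (\<Sum>i\<in>Basis. \<Sum>j\<in>Basis. a i j ?x * (pderiv_dir i ?f ?x * pderiv_dir j ?g ?x))"
      by (subst sum.swap, intro sum.cong refl) (simp add: sym[OF _ _ x'])
    have 2: "L (\<lambda>y. f y * g y) x = (\<Sum>i\<in>Basis. \<Sum>j\<in>Basis. a i j ?x *
          (f x * pderiv_dir i (pderiv_dir j ?g) ?x + g x * pderiv_dir i (pderiv_dir j ?f) ?x
           + pderiv_dir i ?f ?x * pderiv_dir j ?g ?x + pderiv_dir j ?f ?x * pderiv_dir i ?g ?x))
        + (\<Sum>i\<in>Basis. b i ?x * (f x * pderiv_dir i ?g ?x + pderiv_dir i ?f ?x * g x))"
      unfolding L[OF smooth_fun_mult[OF f g] x] o pderiv_dir2_mult[OF F G U x'] fx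
        pderiv_dir_mult[OF differentiable_chart[OF c f x] differentiable_chart[OF c g x]] ..
    show "Gam L f g x = (\<Sum>i\<in>Basis. \<Sum>j\<in>Basis. a i j ?x * pderiv_dir i ?f ?x * pderiv_dir j ?g ?x)"
      unfolding Gam_def 2 L[OF f x] L[OF g x] using 1
      by (simp add: distrib_left sum.distrib sum_distrib_left algebra_simps)
  next
    fix \<Phi> \<Phi>' \<Phi>'' :: "real \<Rightarrow> real" and f x
    assume \<Phi>: "smooth_on UNIV \<Phi>" "\<And>s. (\<Phi> has_real_derivative \<Phi>' s) (at s)"
      "\<And>s. (\<Phi>' has_real_derivative \<Phi>'' s) (at s)" and f: "smooth_fun A f" and x: "x \<in> U"
    let ?f = "f \<circ> \<psi>" and ?x = "\<phi> x"
    have x': "?x \<in> \<phi> ` U" using x by auto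
    note F = smooth_fun_chart[OF c f]
    have fx: "?f ?x = f x" using chart_inverse[OF c] x by auto
    have o: "(\<lambda>y. \<Phi> (f y)) \<circ> \<psi> = (\<lambda>y. \<Phi> (?f y))" by (simp add: o_def)
    show "L (\<lambda>y. \<Phi> (f y)) x = \<Phi>' (f x) * L f x + \<Phi>'' (f x) *
        (\<Sum>i\<in>Basis. \<Sum>j\<in>Basis. a i j ?x * pderiv_dir i ?f ?x * pderiv_dir j ?f ?x)"
      unfolding L[OF smooth_fun_compose[OF \<Phi>(1) f] x] o pderiv_dir2_compose_real[OF F U x' \<Phi>(2,3)]
        pderiv_dir_compose_real[OF differentiable_chart[OF c f x] \<Phi>(2)] L[OF f x] fx
      by (simp add: distrib_left sum.distrib sum_distrib_left algebra_simps)
  qed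
qed

lemma Gam_nonneg: assumes "smooth_fun A f" shows "0 \<le> Gam L f f x"
proof -
  obtain U \<phi> \<psi> where c: "(U, \<phi>, \<psi>) \<in> A" "x \<in> U" by (rule chart_at)
  obtain a where a: "\<And>\<xi> y. y \<in> \<phi> ` U \<Longrightarrow> 0 \<le> (\<Sum>i\<in>Basis. \<Sum>j\<in>Basis. a i j y * (\<xi> \<bullet> i) * (\<xi> \<bullet> j))"
    "\<And>f g x. smooth_fun A f \<Longrightarrow> smooth_fun A g \<Longrightarrow> x \<in> U \<Longrightarrow>
      Gam L f g x = chart_form a \<phi> \<psi> f g x"
    by (rule Gam_chart[OF c(1)]) (rule that; assumption)
  \<comment> \<open>The partial derivatives assembled into a vector, since positivity of the
    principal part is stated for vectors.\<close>
  define \<xi> where "\<xi> = (\<Sum>i\<in>Basis. pderiv_dir i (f \<circ> \<psi>) (\<phi> x) *\<^sub>R i)"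
  have "\<xi> \<bullet> i = pderiv_dir i (f \<circ> \<psi>) (\<phi> x)" if "i \<in> Basis" for i
    using that by (simp add: \<xi>_def)
  then have "Gam L f f x = (\<Sum>i\<in>Basis. \<Sum>j\<in>Basis. a i j (\<phi> x) * (\<xi> \<bullet> i) * (\<xi> \<bullet> j))"
    unfolding a(2)[OF assms assms c(2)] by (intro sum.cong refl) simp
  then show ?thesis using a(1)[of "\<phi> x" \<xi>] c(2) by simp
qed

lemma Gam_sym: "Gam L f g = Gam L g f"
  by (rule ext) (simp add: Gam_def mult.commute diff_diff_eq add.commute)

lemma smooth_fun_Gam: "smooth_fun A f \<Longrightarrow> smooth_fun A g \<Longrightarrow> smooth_fun A (Gam L f g)"
  unfolding Gam_def by (intro smooth_fun_mult smooth_fun_diff smooth_fun_const smooth_fun_L)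

lemma Gam_linear:
  assumes f: "smooth_fun A f" and g: "smooth_fun A g" and h: "smooth_fun A h"
  shows "Gam L (\<lambda>y. r * f y + s * g y) h x = r * Gam L f h x + s * Gam L g h x"
proof -
  have "(\<lambda>y. (r * f y + s * g y) * h y) = (\<lambda>y. r * (f y * h y) + s * (g y * h y))"
    by (simp add: algebra_simps)
  then show ?thesis
    unfolding Gam_def
    by (simp add: L_linear smooth_fun_mult f g h algebra_simps)
qed

lemma Gam_cmult: "smooth_fun A f \<Longrightarrow> Gam L (\<lambda>y. r * f y) (\<lambda>y. r * f y) x = r\<^sup>2 * Gam L f f x"
  using Gam_linear[of f f "\<lambda>y. r * f y" r 0 x] Gam_linear[of f f f r 0 x] Gam_sym[of f "\<lambda>y. r * f y"]
  by (simp add: smooth_fun_mult smooth_fun_const power2_eq_square)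

lemma Gam_Cauchy_Schwarz:
  assumes f: "smooth_fun A f" and g: "smooth_fun A g"
  shows "(Gam L f g x)\<^sup>2 \<le> Gam L f f x * Gam L g g x"
proof -
  have 1: "0 \<le> r\<^sup>2 * Gam L f f x + 2 * r * s * Gam L f g x + s\<^sup>2 * Gam L g g x" for r s
  proof -
    let ?k = "\<lambda>y. r * f y + s * g y"
    have k: "smooth_fun A ?k" by (intro smooth_fun_add smooth_fun_mult smooth_fun_const f g)
    have "Gam L ?k ?k x = r * Gam L f ?k x + s * Gam L g ?k x"
      by (rule Gam_linear[OF f g k])
    also have "Gam L f ?k x = r * Gam L f f x + s * Gam L f g x"
      using Gam_linear[OF f g f] Gam_sym by metis
    also have "Gam L g ?k x = r * Gam L f g x + s * Gam L g g x"
      using Gam_linear[OF f g g] Gam_sym by metis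
    finally show ?thesis using Gam_nonneg[OF k, of x] by (simp add: power2_eq_square algebra_simps)
  qed
  then show ?thesis by (rule quadratic_form_discriminant)
qed

lemma L_compose:
  assumes "smooth_on UNIV \<Phi>" "\<And>s. (\<Phi> has_real_derivative \<Phi>' s) (at s)"
    "\<And>s. (\<Phi>' has_real_derivative \<Phi>'' s) (at s)" and f: "smooth_fun A f"
  shows "L (\<lambda>y. \<Phi> (f y)) x = \<Phi>' (f x) * L f x + \<Phi>'' (f x) * Gam L f f x"
proof -
  obtain U \<phi> \<psi> where c: "(U, \<phi>, \<psi>) \<in> A" "x \<in> U" by (rule chart_at)
  show ?thesis
    by (rule Gam_chart[OF c(1)]) (simp only: assms f c(2))
qed

lemma Gam_compose:
  assumes "smooth_on UNIV \<Phi>" "\<And>s. (\<Phi> has_real_derivative \<Phi>' s) (at s)"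
    and f: "smooth_fun A f" and g: "smooth_fun A g"
  shows "Gam L g (\<lambda>y. \<Phi> (f y)) x = \<Phi>' (f x) * Gam L g f x"
proof -
  obtain U \<phi> \<psi> where c: "(U, \<phi>, \<psi>) \<in> A" "x \<in> U" by (rule chart_at)
  obtain a where a: "\<And>f g x. smooth_fun A f \<Longrightarrow> smooth_fun A g \<Longrightarrow> x \<in> U \<Longrightarrow>
      Gam L f g x = chart_form a \<phi> \<psi> f g x"
    by (rule Gam_chart[OF c(1)]) (rule that; assumption)
  have o: "(\<lambda>y. \<Phi> (f y)) \<circ> \<psi> = (\<lambda>y. \<Phi> ((f \<circ> \<psi>) y))" by (simp add: o_def)
  have fx: "(f \<circ> \<psi>) (\<phi> x) = f x" using chart_inverse[OF c(1)] c(2) by auto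
  show ?thesis
    unfolding a[OF g smooth_fun_compose[OF assms(1) f] c(2)] a[OF g f c(2)] o
      pderiv_dir_compose_real[OF differentiable_chart[OF c(1) f c(2)] assms(2)] fx
    by (simp add: sum_distrib_left algebra_simps)
qed

text \<open>Symmetry is assumed for two test functions. Multiplying u by a cut-off that is 1 near
  the support of g changes neither integrand, because \<open>L\<close> is local.\<close>

lemma L_by_parts:
  assumes g: "test_fun A g" and u: "smooth_fun A u"
  shows "(LINT x|\<mu>. u x * L g x) = (LINT x|\<mu>. g x * L u x)"
proof -
  have K: "compact (fun_supp g)" using g by (simp add: test_fun_def)
  obtain \<theta> W where \<theta>: "test_fun A \<theta>" "open W" "fun_supp g \<subseteq> W" "\<And>y. y \<in> W \<Longrightarrow> \<theta> y = 1"
    by (rule cutoff_compact[OF K]) (rule that; assumption)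
  let ?u = "\<lambda>y. \<theta> y * u y"
  have tu: "test_fun A ?u" by (intro test_fun_mult \<theta> u)
  have 1: "?u x * L g x = u x * L g x" for x
  proof (cases "x \<in> W")
    case False
    then have "L g x = L (\<lambda>_. 0) x"
      using g \<theta>(3) fun_supp_closed[of g] not_in_fun_supp[of _ g]
      by (intro L_local[where N="- fun_supp g"]) (auto simp: test_fun_smooth smooth_fun_const)
    then show ?thesis by (simp add: L_const)
  qed (simp add: \<theta>(4))
  have 2: "g x * L ?u x = g x * L u x" for x
  proof (cases "x \<in> W")
    case True
    then have "L ?u x = L u x"
      using \<theta>(2,4) tu u by (intro L_local[where N=W]) (auto simp: test_fun_smooth)
    then show ?thesis by simp
  next
    case False
    then show ?thesis using not_in_fun_supp[of x g] \<theta>(3) by auto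
  qed
  have "(LINT x|\<mu>. ?u x * L g x) = (LINT x|\<mu>. g x * L ?u x)"
    using L_symmetric tu g unfolding symmetric_nonpositive_def by blast
  then show ?thesis by (simp only: 1 2)
qed

lemma integral_L_test_fun: "test_fun A g \<Longrightarrow> (LINT x|\<mu>. L g x) = 0"
  using L_by_parts[OF _ smooth_fun_const[of 1]] by (simp add: L_const)

text \<open>In the integrated definition of \<open>Gam\<close>, the term \<open>L\<close> of the
  product contributes 0 and the two remaining terms have equal integrals.\<close>

lemma integral_L_eq_Gam:
  assumes g: "test_fun A g" and u: "smooth_fun A u"
  shows "(LINT x|\<mu>. g x * L u x) = - (LINT x|\<mu>. Gam L g u x)"
proof -
  note gs = test_fun_smooth[OF g]
  have i: "integrable \<mu> (L (\<lambda>y. g y * u y))" "integrable \<mu> (\<lambda>x. g x * L u x)" "integrable \<mu> (\<lambda>x. u x * L g x)"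
    by (intro integrable_test_fun test_fun_L test_fun_mult test_fun_mult_right g u smooth_fun_L)+
  have "(LINT x|\<mu>. Gam L g u x) = 1/2 * ((LINT x|\<mu>. L (\<lambda>y. g y * u y) x) - (LINT x|\<mu>. g x * L u x) - (LINT x|\<mu>. u x * L g x))"
    unfolding Gam_def using i by simp
  then show ?thesis
    using integral_L_test_fun[OF test_fun_mult[OF g u]] L_by_parts[OF g u] by simp
qed

end

section \<open>Derivations in charts\<close>

context smooth_manifold
begin

context
  fixes GZ :: "('a \<Rightarrow> real) \<Rightarrow> ('a \<Rightarrow> real) \<Rightarrow> 'a \<Rightarrow> real"
  assumes form: "first_order_form A GZ"
begin

lemma GZ_smooth: "smooth_fun A f \<Longrightarrow> smooth_fun A g \<Longrightarrow> smooth_fun A (GZ f g)"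
  using form by (simp add: first_order_form_def)

lemma GZ_sym: "smooth_fun A f \<Longrightarrow> smooth_fun A g \<Longrightarrow> GZ f g = GZ g f"
  using form by (simp add: first_order_form_def)

lemma GZ_linear: "smooth_fun A f \<Longrightarrow> smooth_fun A g \<Longrightarrow> smooth_fun A h \<Longrightarrow>
    GZ (\<lambda>y. r * f y + s * g y) h x = r * GZ f h x + s * GZ g h x"
  using form by (simp add: first_order_form_def)

lemma GZ_product: "smooth_fun A f \<Longrightarrow> smooth_fun A g \<Longrightarrow> smooth_fun A h \<Longrightarrow>
    GZ (\<lambda>y. f y * g y) h x = f x * GZ g h x + g x * GZ f h x"
  using form by (simp add: first_order_form_def)

lemma GZ_cmult: "smooth_fun A f \<Longrightarrow> smooth_fun A h \<Longrightarrow> GZ (\<lambda>y. r * f y) h x = r * GZ f h x"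
  using GZ_linear[of f f h r 0 x] by simp

lemma GZ_add: "smooth_fun A f \<Longrightarrow> smooth_fun A g \<Longrightarrow> smooth_fun A h \<Longrightarrow>
    GZ (\<lambda>y. f y + g y) h x = GZ f h x + GZ g h x"
  using GZ_linear[of f g h 1 1 x] by simp

lemma GZ_sum:
  assumes "finite I" "\<And>i. i \<in> I \<Longrightarrow> smooth_fun A (f i)" "smooth_fun A h"
  shows "GZ (\<lambda>y. \<Sum>i\<in>I. f i y) h x = (\<Sum>i\<in>I. GZ (f i) h x)"
  using assms(1,2)
proof induction
  case empty
  show ?case using GZ_cmult[OF smooth_fun_const assms(3), of 0 1 x] by simp
next
  case (insert i I)
  then show ?case by (simp add: GZ_add assms(3) smooth_fun_sum)
qed

text \<open>By Hadamard's expansion f is, near x, a constant plus a sum of coordinates that vanish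
  at x times smooth coefficients; the product rule leaves only the form applied to the coordinates.
  Multiplying by a cut-off makes the expansion a global identity, so the locality of the form is a
  consequence and not a premise.\<close>

lemma GZ_at_point:
  assumes c: "(U, \<phi>, \<psi>) \<in> A" "x \<in> U"
  obtains \<eta> where "\<And>f h. smooth_fun A f \<Longrightarrow> smooth_fun A h \<Longrightarrow>
    GZ f h x = (\<Sum>i\<in>Basis. pderiv_dir i (f \<circ> \<psi>) (\<phi> x) * GZ (\<eta> i) h x)"
proof -
  note inv = chart_inverse[OF c(1)]
  define y0 where "y0 = \<phi> x"
  obtain r \<beta> E where r: "0 < r" "ball y0 r \<subseteq> \<phi> ` (U \<inter> UNIV)"
    and E': "\<And>b. smooth_on (ball y0 r) b \<Longrightarrow> test_fun A (E b)"
      "\<And>b z. z \<notin> \<psi> ` ball y0 r \<Longrightarrow> E b z = 0" "\<And>b y. y \<in> ball y0 r \<Longrightarrow> E b (\<psi> y) = \<beta> y * b y"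
    and \<beta>: "\<And>y. y \<in> ball y0 (r / 4) \<Longrightarrow> \<beta> y = 1"
    by (rule chart_bump[OF c open_UNIV UNIV_I, folded y0_def]) (rule that; assumption)
  let ?V = "ball y0 r"
  have rU: "?V \<subseteq> \<phi> ` U" using r(2) by simp
  note E = test_fun_smooth[OF E'(1)]
  have Ex: "E b x = b y0" for b
    using E'(3)[of y0 b] \<beta>[of y0] r(1) inv(1)[OF c(2)] by (simp add: y0_def)
  define \<theta> where "\<theta> = E (\<lambda>_. 1)"
  \<comment> \<open>The square of the cut-off, because each product of \<open>\<eta> i\<close> and
    \<open>\<gamma> i\<close> carries it twice.\<close>
  define e where "e z = \<theta> z * \<theta> z" for z
  define \<eta> where "\<eta> i = E (\<lambda>y. (y - y0) \<bullet> i)" for i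
  have e: "smooth_fun A e" unfolding e_def \<theta>_def by (intro smooth_fun_mult E smooth_intros)
  have \<eta>: "smooth_fun A (\<eta> i)" for i unfolding \<eta>_def by (intro E smooth_intros) auto
  show thesis
  proof (rule that[of \<eta>])
    fix f h assume f: "smooth_fun A f" and h: "smooth_fun A h"
    have "smooth_on ?V (f \<circ> \<psi>)" by (rule smooth_on_subset[OF smooth_fun_chart[OF c(1) f] rU])
    then obtain g where g: "\<And>i. smooth_on ?V (g i)" "\<And>i. g i y0 = pderiv_dir i (f \<circ> \<psi>) y0"
      "\<And>y. y \<in> ?V \<Longrightarrow> (f \<circ> \<psi>) y = (f \<circ> \<psi>) y0 + (\<Sum>i\<in>Basis. ((y - y0) \<bullet> i) * g i y)"
      by (rule Hadamard) (rule that; assumption)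
    define \<gamma> where "\<gamma> i = E (g i)" for i
    have \<gamma>: "smooth_fun A (\<gamma> i)" for i unfolding \<gamma>_def by (intro E g)
    have decomp: "e z * f z = f x * e z + 1 * (\<Sum>i\<in>Basis. \<eta> i z * \<gamma> i z)" for z
    proof (cases "z \<in> \<psi> ` ?V")
      case True
      then obtain y where y: "y \<in> ?V" "z = \<psi> y" by blast
      have "f z = f x + (\<Sum>i\<in>Basis. ((y - y0) \<bullet> i) * g i y)"
        using g(3)[OF y(1)] y(2) inv(1)[OF c(2)] by (simp add: y0_def)
      then show ?thesis
        by (simp add: e_def \<theta>_def \<eta>_def \<gamma>_def y(2) E'(3)[OF y(1)] sum_distrib_left distrib_left mult_ac)
    qed (simp add: e_def \<theta>_def \<eta>_def E'(2))
    have "GZ (\<lambda>z. e z * f z) h x = e x * GZ f h x + f x * GZ e h x"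
      by (rule GZ_product[OF e f h])
    moreover have "GZ (\<lambda>z. e z * f z) h x = f x * GZ e h x + 1 * GZ (\<lambda>z. \<Sum>i\<in>Basis. \<eta> i z * \<gamma> i z) h x"
      unfolding decomp by (intro GZ_linear e h smooth_fun_sum smooth_fun_mult \<eta> \<gamma>)
    moreover have "GZ (\<lambda>z. \<Sum>i\<in>Basis. \<eta> i z * \<gamma> i z) h x = (\<Sum>i\<in>Basis. GZ (\<lambda>z. \<eta> i z * \<gamma> i z) h x)"
      by (intro GZ_sum finite_Basis h smooth_fun_mult \<eta> \<gamma>)
    moreover have "GZ (\<lambda>z. \<eta> i z * \<gamma> i z) h x = pderiv_dir i (f \<circ> \<psi>) y0 * GZ (\<eta> i) h x" for i
      unfolding GZ_product[OF \<eta> \<gamma> h] by (simp add: \<eta>_def \<gamma>_def Ex g(2))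
    moreover have "e x = 1" by (simp add: e_def \<theta>_def Ex)
    ultimately show "GZ f h x = (\<Sum>i\<in>Basis. pderiv_dir i (f \<circ> \<psi>) (\<phi> x) * GZ (\<eta> i) h x)"
      by (simp add: y0_def)
  qed
qed

text \<open>The coordinates of the pointwise formula change with the point, which says nothing about
  regularity of the coefficients. They are replaced by fixed cut-off coordinates \<xi>, whose
  derivatives are constant on N; the coefficients become the form applied to them, which is globally
  smooth.\<close>

lemma GZ_chart:
  assumes c: "(U, \<phi>, \<psi>) \<in> A" "x0 \<in> U"
  obtains N G where "open N" "x0 \<in> N" "N \<subseteq> U" "\<And>i j. smooth_fun A (G i j)"
    "\<And>f g x. smooth_fun A f \<Longrightarrow> smooth_fun A g \<Longrightarrow> x \<in> N \<Longrightarrow>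
      GZ f g x = (\<Sum>i\<in>Basis. \<Sum>j\<in>Basis. pderiv_dir i (f \<circ> \<psi>) (\<phi> x) * pderiv_dir j (g \<circ> \<psi>) (\<phi> x) * G i j x)"
proof -
  note inv = chart_inverse[OF c(1)]
  define y0 where "y0 = \<phi> x0"
  obtain r \<beta> E where r: "0 < r" "ball y0 r \<subseteq> \<phi> ` (U \<inter> UNIV)"
    and E: "\<And>b. smooth_on (ball y0 r) b \<Longrightarrow> test_fun A (E b)"
      "\<And>b y. y \<in> ball y0 r \<Longrightarrow> E b (\<psi> y) = \<beta> y * b y"
    and \<beta>: "\<And>y. y \<in> ball y0 (r / 4) \<Longrightarrow> \<beta> y = 1"
    by (rule chart_bump[OF c open_UNIV UNIV_I, folded y0_def]) (rule that; assumption)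
  let ?V = "ball y0 r" and ?B = "ball y0 (r / 4)"
  have BV: "?B \<subseteq> ?V" using r(1) by auto
  then have BU: "?B \<subseteq> \<phi> ` U" using r(2) by blast
  define \<xi> where "\<xi> i = E (\<lambda>y. y \<bullet> i)" for i
  have \<xi>: "smooth_fun A (\<xi> i)" for i
    unfolding \<xi>_def by (intro test_fun_smooth E(1) smooth_intros) auto
  define N where "N = \<psi> ` ?B"
  have N: "open N" "x0 \<in> N" "N \<subseteq> U"
  proof -
    show "open N" unfolding N_def by (rule open_chart_inverse_image[OF c(1) open_ball BU])
    show "x0 \<in> N" unfolding N_def
      using r(1) inv(1)[OF c(2)] by (intro image_eqI[of _ _ y0]) (auto simp: y0_def)
    show "N \<subseteq> U" unfolding N_def using BU inv(3) by blast
  qed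
  have d\<xi>: "pderiv_dir j (\<xi> i \<circ> \<psi>) (\<phi> x) = (if i = j then 1 else 0)" if x: "x \<in> N" and ij: "i \<in> Basis" "j \<in> Basis" for x i j
  proof -
    have x': "\<phi> x \<in> ?B" using x BU inv(2) by (auto simp: N_def)
    have "(\<xi> i \<circ> \<psi>) y = y \<bullet> i" if "y \<in> ?B" for y
      using that BV E(2) \<beta> by (auto simp: \<xi>_def)
    from pderiv_dir_cong[OF open_ball x' this]
    have "pderiv_dir j (\<xi> i \<circ> \<psi>) (\<phi> x) = pderiv_dir j (\<lambda>y. y \<bullet> i) (\<phi> x)" .
    also have "\<dots> = j \<bullet> i"
      by (rule pderiv_dir_eq) (auto intro!: derivative_eq_intros)
    finally show ?thesis using ij by (auto simp: inner_Basis)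
  qed
  have first: "GZ f h x = (\<Sum>i\<in>Basis. pderiv_dir i (f \<circ> \<psi>) (\<phi> x) * GZ (\<xi> i) h x)"
    if f: "smooth_fun A f" and h: "smooth_fun A h" and x: "x \<in> N" for f h x
  proof -
    have xU: "x \<in> U" using x N(3) by blast
    obtain \<eta> where \<eta>: "\<And>f h. smooth_fun A f \<Longrightarrow> smooth_fun A h \<Longrightarrow>
        GZ f h x = (\<Sum>i\<in>Basis. pderiv_dir i (f \<circ> \<psi>) (\<phi> x) * GZ (\<eta> i) h x)"
      by (rule GZ_at_point[OF c(1) xU]) (rule that; assumption)
    have "GZ (\<xi> i) h x = GZ (\<eta> i) h x" if i: "i \<in> Basis" for i
    proof -
      have "GZ (\<xi> i) h x = (\<Sum>j\<in>Basis. (if i = j then 1 else 0) * GZ (\<eta> j) h x)"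
        unfolding \<eta>[OF \<xi> h] by (intro sum.cong refl) (simp add: d\<xi>[OF x i])
      also have "\<dots> = (\<Sum>j\<in>Basis. if i = j then GZ (\<eta> j) h x else 0)"
        by (intro sum.cong) auto
      finally show ?thesis using i by simp
    qed
    then show ?thesis unfolding \<eta>[OF f h] by (intro sum.cong refl) simp
  qed
  show thesis
  proof (rule that[OF N, of "\<lambda>i j. GZ (\<xi> j) (\<xi> i)"])
    show "smooth_fun A (GZ (\<xi> j) (\<xi> i))" for i j by (intro GZ_smooth \<xi>)
    fix f g x assume f: "smooth_fun A f" and g: "smooth_fun A g" and x: "x \<in> N"
    have "GZ f g x = (\<Sum>i\<in>Basis. pderiv_dir i (f \<circ> \<psi>) (\<phi> x) * GZ g (\<xi> i) x)"
      unfolding first[OF f g x] by (simp only: GZ_sym[OF \<xi> g])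
    also have "\<dots> = (\<Sum>i\<in>Basis. \<Sum>j\<in>Basis. pderiv_dir i (f \<circ> \<psi>) (\<phi> x) * pderiv_dir j (g \<circ> \<psi>) (\<phi> x) * GZ (\<xi> j) (\<xi> i) x)"
      by (simp only: first[OF g \<xi> x] sum_distrib_left mult.assoc)
    finally show "GZ f g x = (\<Sum>i\<in>Basis. \<Sum>j\<in>Basis. pderiv_dir i (f \<circ> \<psi>) (\<phi> x) * pderiv_dir j (g \<circ> \<psi>) (\<phi> x) * GZ (\<xi> j) (\<xi> i) x)" .
  qed
qed

end

section \<open>Functions smooth in time and space\<close>

abbreviation time_chart :: "('e \<Rightarrow> 'a) \<Rightarrow> (real \<Rightarrow> 'a \<Rightarrow> real) \<Rightarrow> real \<times> 'e \<Rightarrow> real" where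
  "time_chart \<psi> v \<equiv> (\<lambda>p. v (fst p) (\<psi> (snd p)))"

text \<open>Only positive times are covered: derivatives are two-sided, and the behaviour at time 0
  is known for the semigroup only as an L2 limit.\<close>

definition time_smooth :: "(real \<Rightarrow> 'a \<Rightarrow> real) \<Rightarrow> bool" where
  "time_smooth v \<longleftrightarrow>
     (\<forall>(U, \<phi>, \<psi>)\<in>A. smooth_on ({0<..} \<times> \<phi> ` U) (time_chart \<psi> v))"

definition dt :: "(real \<Rightarrow> 'a \<Rightarrow> real) \<Rightarrow> real \<Rightarrow> 'a \<Rightarrow> real" where
  "dt v t x = deriv (\<lambda>s. v s x) t"

lemma time_smoothI:
  assumes "\<And>U \<phi> \<psi>. (U, \<phi>, \<psi>) \<in> A \<Longrightarrow> open ({0<..} \<times> \<phi> ` U :: (real \<times> 'e) set) \<Longrightarrow>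
    smooth_on ({0<..} \<times> \<phi> ` U) (time_chart \<psi> v)"
  shows "time_smooth v"
  using assms chart_homeomorphism(2) unfolding time_smooth_def by (fastforce intro: open_Times)

context
  fixes U \<phi> \<psi> assumes c: "(U, \<phi>, \<psi>) \<in> A"
begin

lemma open_time_chart: "open ({0<..} \<times> \<phi> ` U :: (real \<times> 'e) set)"
  using chart_homeomorphism(2)[OF c] by (intro open_Times) auto

lemma time_smooth_chart: "time_smooth v \<Longrightarrow> smooth_on ({0<..} \<times> \<phi> ` U) (time_chart \<psi> v)"
  using c by (auto simp: time_smooth_def)

lemma time_smooth_differentiable:
  "time_smooth v \<Longrightarrow> 0 < t \<Longrightarrow> y \<in> \<phi> ` U \<Longrightarrow> (time_chart \<psi> v) differentiable (at (t, y))"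
  using smooth_on_imp_differentiable[OF time_smooth_chart, of v "(t, y)"] by auto

lemma smooth_on_time_const: "smooth_on (\<phi> ` U) f \<Longrightarrow> smooth_on ({0<..} \<times> \<phi> ` U) (\<lambda>p::real \<times> 'e. f (snd p))"
  by (rule smooth_on_compose[where T="\<phi> ` U"])
    (auto intro!: smooth_intros open_time_chart chart_homeomorphism(2)[OF c])

lemma time_smooth_has_derivative_chart:
  assumes "time_smooth v" "0 < t" "y \<in> \<phi> ` U"
  shows "((\<lambda>s. v s (\<psi> y)) has_real_derivative pderiv_dir (1, 0) (time_chart \<psi> v) (t, y)) (at t)"
  using slice_fst[OF time_smooth_differentiable[OF assms]] by simp

lemma dt_chart:
  "time_smooth v \<Longrightarrow> 0 < t \<Longrightarrow> y \<in> \<phi> ` U \<Longrightarrow>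
    dt v t (\<psi> y) = pderiv_dir (1, 0) (time_chart \<psi> v) (t, y)"
  unfolding dt_def by (rule DERIV_imp_deriv[OF time_smooth_has_derivative_chart])

lemma pderiv_slice_chart:
  assumes "time_smooth v" "0 < t" "y \<in> \<phi> ` U"
  shows "pderiv_dir i (v t \<circ> \<psi>) y = pderiv_dir (0, i) (time_chart \<psi> v) (t, y)"
  using slice_snd(2)[OF time_smooth_differentiable[OF assms]] by (simp add: o_def)

lemma pderiv_slice_chart2:
  assumes "time_smooth v" "0 < t" "y \<in> \<phi> ` U"
  shows "pderiv_dir i (pderiv_dir j (v t \<circ> \<psi>)) y
    = pderiv_dir (0, i) (pderiv_dir (0, j) (time_chart \<psi> v)) (t, y)"
proof -
  let ?V = "time_chart \<psi> v"
  have "pderiv_dir i (pderiv_dir j (v t \<circ> \<psi>)) y = pderiv_dir i (\<lambda>y. pderiv_dir (0, j) ?V (t, y)) y"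
    by (rule pderiv_dir_cong[OF chart_homeomorphism(2)[OF c] assms(3)]) (rule pderiv_slice_chart[OF assms(1,2)])
  also have "\<dots> = pderiv_dir (0, i) (pderiv_dir (0, j) ?V) (t, y)"
    using assms by (intro slice_snd(2) smooth_on_imp_differentiable[OF smooth_on_pderiv[OF time_smooth_chart open_time_chart]]) auto
  finally show ?thesis .
qed

end

lemma time_smooth_const: "smooth_fun A f \<Longrightarrow> time_smooth (\<lambda>_. f)"
  using smooth_on_time_const[OF _ smooth_fun_chart] by (intro time_smoothI) (simp add: o_def)

lemma time_smooth_time: "smooth_on UNIV k \<Longrightarrow> time_smooth (\<lambda>t _. k t)"
  by (rule time_smoothI, rule smooth_on_compose[where g=k and T=UNIV]) (auto intro!: smooth_intros)

lemma time_smooth_add: "time_smooth v \<Longrightarrow> time_smooth w \<Longrightarrow> time_smooth (\<lambda>t x. v t x + w t x)"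
  by (rule time_smoothI, rule smooth_on_add) (auto intro: time_smooth_chart)

lemma time_smooth_diff: "time_smooth v \<Longrightarrow> time_smooth w \<Longrightarrow> time_smooth (\<lambda>t x. v t x - w t x)"
  by (rule time_smoothI, rule smooth_on_diff) (auto intro: time_smooth_chart)

lemma time_smooth_mult: "time_smooth v \<Longrightarrow> time_smooth w \<Longrightarrow> time_smooth (\<lambda>t x. v t x * w t x)"
  by (rule time_smoothI, rule smooth_on_mult) (auto intro: time_smooth_chart)

lemma time_smooth_compose: "smooth_on UNIV \<Phi> \<Longrightarrow> time_smooth v \<Longrightarrow> time_smooth (\<lambda>t x. \<Phi> (v t x))"
  by (rule time_smoothI, rule smooth_on_compose[where g=\<Phi> and T=UNIV]) (auto intro: time_smooth_chart)

lemma time_smooth_slice: assumes "time_smooth v" "0 < t" shows "smooth_fun A (v t)"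
proof (rule smooth_funI)
  fix U \<phi> \<psi> assume c: "(U, \<phi>, \<psi>) \<in> A"
  show "smooth_on (\<phi> ` U) (\<lambda>y. v t (\<psi> y))"
    using smooth_on_compose[OF time_smooth_chart[OF c assms(1)], of "\<phi> ` U" "\<lambda>y. (t, y)"]
      smooth_on_Pair[OF smooth_on_const[of _ t] smooth_on_ident chart_homeomorphism(2)[OF c]]
      open_time_chart[OF c] chart_homeomorphism(2)[OF c] assms(2)
    by auto
qed

lemma time_smooth_has_derivative:
  assumes "time_smooth v" "0 < t" shows "((\<lambda>s. v s x) has_real_derivative dt v t x) (at t)"
proof -
  obtain U \<phi> \<psi> where c: "(U, \<phi>, \<psi>) \<in> A" "x \<in> U" by (rule chart_at)
  then show ?thesis
    using time_smooth_has_derivative_chart[OF c(1) assms, of "\<phi> x"] dt_chart[OF c(1) assms, of "\<phi> x"]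
      chart_inverse[OF c(1)] by simp
qed

lemma time_smooth_dt: assumes "time_smooth v" shows "time_smooth (dt v)"
proof (rule time_smoothI)
  fix U \<phi> \<psi> assume c: "(U, \<phi>, \<psi>) \<in> A" and o: "open ({0<..} \<times> \<phi> ` U :: (real \<times> 'e) set)"
  show "smooth_on ({0<..} \<times> \<phi> ` U) (time_chart \<psi> (dt v))"
  proof (subst smooth_on_cong[OF o])
    show "smooth_on ({0<..} \<times> \<phi> ` U) (pderiv_dir (1, 0) (time_chart \<psi> v))"
      by (intro smooth_on_pderiv time_smooth_chart[OF c assms] o)
  qed (use dt_chart[OF c assms] in auto)
qed

text \<open>Here the point of the manifold is the parameter and time the variable, as needed to
  differentiate integrals over compact sets in time.\<close>

lemma Ck_param_time_smooth:
  assumes "time_smooth v" shows "Ck_param k K {0<..} (\<lambda>x t. v t x)"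
proof (rule Ck_paramI)
  fix x
  obtain U \<phi> \<psi> where c: "(U, \<phi>, \<psi>) \<in> A" "x \<in> U" by (rule chart_at)
  let ?W = "\<phi> ` U \<times> {0<..} :: ('e \<times> real) set"
  have W: "open ?W" using chart_homeomorphism(2)[OF c(1)] by (intro open_Times) auto
  have "smooth_on ?W (\<lambda>q. v (fst (snd q, fst q)) (\<psi> (snd (snd q, fst q))))"
    by (rule smooth_on_compose[OF time_smooth_chart[OF c(1) assms], of ?W "\<lambda>q. (snd q, fst q)"])
      (auto intro!: smooth_intros W open_time_chart[OF c(1)])
  then show "\<exists>N (\<phi> :: 'a \<Rightarrow> 'e) H W. open N \<and> x \<in> N \<and> continuous_on (K \<inter> N) \<phi> \<and> open W \<and> smooth_on W H \<and>
      (\<forall>x'\<in>K \<inter> N. \<forall>t\<in>{0<..}. (\<phi> x', t) \<in> W \<and> v t x' = H (\<phi> x', t))"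
    using c(2) W chart_homeomorphism(1)[OF c(1)] chart_continuous(1)[OF c(1)] chart_inverse[OF c(1)]
    by (intro exI[of _ U] exI[of _ \<phi>] exI[of _ "\<lambda>q. v (snd q) (\<psi> (fst q))"] exI[of _ ?W])
      (auto intro: continuous_on_subset)
qed simp

text \<open>In a chart the form is bilinear in spatial derivatives with coefficients that do not
  depend on time. The symmetry of second derivatives moves the time derivative inside them.\<close>

lemma
  assumes form: "first_order_form A GZ" and v: "time_smooth v" and w: "time_smooth w"
  shows time_smooth_GZ: "time_smooth (\<lambda>t. GZ (v t) (w t))"
    and has_derivative_GZ: "0 < t \<Longrightarrow> ((\<lambda>s. GZ (v s) (w s) x) has_real_derivative
      GZ (dt v t) (w t) x + GZ (v t) (dt w t) x) (at t)"
proof -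
  show "time_smooth (\<lambda>t. GZ (v t) (w t))"
  proof (rule time_smoothI, rule smooth_on_local)
    fix U \<phi> \<psi> and p :: "real \<times> 'e" assume c: "(U, \<phi>, \<psi>) \<in> A" and p: "p \<in> {0<..} \<times> \<phi> ` U"
    note inv = chart_inverse[OF c]
    have x: "\<psi> (snd p) \<in> U" using p inv(3) by auto
    obtain N G where N: "open N" "\<psi> (snd p) \<in> N" "N \<subseteq> U" "\<And>i j. smooth_fun A (G i j)"
      "\<And>f g x. smooth_fun A f \<Longrightarrow> smooth_fun A g \<Longrightarrow> x \<in> N \<Longrightarrow>
      GZ f g x = (\<Sum>i\<in>Basis. \<Sum>j\<in>Basis. pderiv_dir i (f \<circ> \<psi>) (\<phi> x) * pderiv_dir j (g \<circ> \<psi>) (\<phi> x) * G i j x)"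
      by (rule GZ_chart[OF form c x]) (rule that; assumption)
    let ?M = "{0<..} \<times> \<phi> ` (U \<inter> N) :: (real \<times> 'e) set"
    have M: "open ?M" by (intro open_Times open_chart_image[OF c N(1)]) auto
    have MU: "?M \<subseteq> {0<..} \<times> \<phi> ` U" by auto
    have "smooth_on ?M (\<lambda>p. GZ (v (fst p)) (w (fst p)) (\<psi> (snd p)))"
    proof (subst smooth_on_cong[OF M])
      fix q assume q: "q \<in> ?M"
      then have q': "0 < fst q" "snd q \<in> \<phi> ` U" "\<psi> (snd q) \<in> N" "\<phi> (\<psi> (snd q)) = snd q"
        using inv by auto
      show "GZ (v (fst q)) (w (fst q)) (\<psi> (snd q)) = (\<Sum>i\<in>Basis. \<Sum>j\<in>Basis.
          pderiv_dir (0, i) (time_chart \<psi> v) q * pderiv_dir (0, j) (time_chart \<psi> w) q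
          * G i j (\<psi> (snd q)))"
        unfolding N(5)[OF time_smooth_slice[OF v q'(1)] time_smooth_slice[OF w q'(1)] q'(3)] q'(4)
          pderiv_slice_chart[OF c v q'(1,2)] pderiv_slice_chart[OF c w q'(1,2)] by simp
    next
      have "smooth_on ({0<..} \<times> \<phi> ` U) (\<lambda>q. \<Sum>i\<in>Basis. \<Sum>j\<in>Basis.
          pderiv_dir (0, i) (time_chart \<psi> v) q * pderiv_dir (0, j) (time_chart \<psi> w) q
          * G i j (\<psi> (snd q)))"
        by (intro smooth_on_sum smooth_on_mult smooth_on_pderiv time_smooth_chart[OF c v]
            time_smooth_chart[OF c w] open_time_chart[OF c]
            smooth_on_time_const[OF c smooth_fun_chart[OF c N(4)], unfolded o_def])
      then show "smooth_on ?M (\<lambda>q. \<Sum>i\<in>Basis. \<Sum>j\<in>Basis.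
          pderiv_dir (0, i) (time_chart \<psi> v) q * pderiv_dir (0, j) (time_chart \<psi> w) q
          * G i j (\<psi> (snd q)))"
        using MU by (rule smooth_on_subset)
    qed
    moreover have "p \<in> ?M"
    proof -
      have "\<phi> (\<psi> (snd p)) = snd p" using p inv(2)[of "snd p"] by auto
      then have "snd p \<in> \<phi> ` (U \<inter> N)" using N(2) x by (intro image_eqI[of _ _ "\<psi> (snd p)"]) auto
      then show ?thesis using p by (simp add: mem_Times_iff)
    qed
    ultimately show "\<exists>N. open N \<and> p \<in> N \<and> smooth_on N (\<lambda>p. GZ (v (fst p)) (w (fst p)) (\<psi> (snd p)))"
      using M by blast
  qed
  assume t: "0 < t"
  obtain U \<phi> \<psi> where c: "(U, \<phi>, \<psi>) \<in> A" "x \<in> U" by (rule chart_at)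
  note o = open_time_chart[OF c(1)]
  obtain N G where N: "open N" "x \<in> N"
    "\<And>f g x. smooth_fun A f \<Longrightarrow> smooth_fun A g \<Longrightarrow> x \<in> N \<Longrightarrow>
      GZ f g x = (\<Sum>i\<in>Basis. \<Sum>j\<in>Basis. pderiv_dir i (f \<circ> \<psi>) (\<phi> x) * pderiv_dir j (g \<circ> \<psi>) (\<phi> x) * G i j x)"
    by (rule GZ_chart[OF form c]) (rule that; assumption)
  have x': "\<phi> x \<in> \<phi> ` U" using c(2) by auto
  define D where "D v i s = pderiv_dir i (v s \<circ> \<psi>) (\<phi> x)" for v :: "real \<Rightarrow> 'a \<Rightarrow> real" and i s
  have D: "(D v i has_real_derivative D (dt v) i t) (at t)" if v: "time_smooth v" for v i
  proof -
    let ?V = "time_chart \<psi> v"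
    have tx: "(t, \<phi> x) \<in> {0<..} \<times> \<phi> ` U" using t x' by auto
    have "((\<lambda>s. pderiv_dir (0, i) ?V (s, \<phi> x)) has_real_derivative
        pderiv_dir (1, 0) (pderiv_dir (0, i) ?V) (t, \<phi> x)) (at t)"
      by (rule slice_fst[OF smooth_on_imp_differentiable[OF smooth_on_pderiv[OF time_smooth_chart[OF c(1) v] o] tx]])
    moreover have "pderiv_dir (1, 0) (pderiv_dir (0, i) ?V) (t, \<phi> x) = pderiv_dir (0, i) (pderiv_dir (1, 0) ?V) (t, \<phi> x)"
      by (rule pderiv_dir_commute[OF time_smooth_chart[OF c(1) v] o tx])
    moreover have "pderiv_dir (0, i) (pderiv_dir (1, 0) ?V) (t, \<phi> x) = pderiv_dir (0, i) (time_chart \<psi> (dt v)) (t, \<phi> x)"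
      by (rule pderiv_dir_cong[OF o tx]) (use dt_chart[OF c(1) v] in auto)
    ultimately have "((\<lambda>s. pderiv_dir (0, i) ?V (s, \<phi> x)) has_real_derivative D (dt v) i t) (at t)"
      unfolding D_def pderiv_slice_chart[OF c(1) time_smooth_dt[OF v] t x'] by simp
    then show ?thesis
      by (rule has_field_derivative_transform_within_open[of _ _ _ "{0<..}"])
        (use t pderiv_slice_chart[OF c(1) v _ x'] in \<open>auto simp: D_def\<close>)
  qed
  have eq: "GZ (v s) (w s) x = (\<Sum>i\<in>Basis. \<Sum>j\<in>Basis. D v i s * D w j s * G i j x)" if "0 < s" for s
    unfolding D_def by (rule N(3)[OF time_smooth_slice[OF v that] time_smooth_slice[OF w that] N(2)])
  have "((\<lambda>s. \<Sum>i\<in>Basis. \<Sum>j\<in>Basis. D v i s * D w j s * G i j x) has_real_derivative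
      (\<Sum>i\<in>Basis. \<Sum>j\<in>Basis. (D v i t * D (dt w) j t + D (dt v) i t * D w j t) * G i j x)) (at t)"
    by (intro DERIV_sum DERIV_cmult_right DERIV_mult' D v w)
  moreover have "(\<Sum>i\<in>Basis. \<Sum>j\<in>Basis. (D v i t * D (dt w) j t + D (dt v) i t * D w j t) * G i j x)
      = GZ (dt v t) (w t) x + GZ (v t) (dt w t) x"
    unfolding N(3)[OF time_smooth_slice[OF time_smooth_dt[OF v] t] time_smooth_slice[OF w t] N(2)]
      N(3)[OF time_smooth_slice[OF v t] time_smooth_slice[OF time_smooth_dt[OF w] t] N(2)]
    by (simp add: D_def sum.distrib algebra_simps)
  ultimately have "((\<lambda>s. \<Sum>i\<in>Basis. \<Sum>j\<in>Basis. D v i s * D w j s * G i j x) has_real_derivative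
      GZ (dt v t) (w t) x + GZ (v t) (dt w t) x) (at t)" by simp
  then show "((\<lambda>s. GZ (v s) (w s) x) has_real_derivative GZ (dt v t) (w t) x + GZ (v t) (dt w t) x) (at t)"
    by (rule has_field_derivative_transform_within_open[of _ _ _ "{0<..}"]) (use t eq in auto)
qed

end

section \<open>Time derivatives of the diffusion operator and of its form\<close>

context diffusion
begin

text \<open>The coefficients of \<open>L\<close> are constant in time, so it suffices to commute the
  time derivative with one and with two spatial derivatives.\<close>

lemma
  assumes v: "time_smooth v"
  shows time_smooth_L: "time_smooth (\<lambda>t. L (v t))"
    and has_derivative_L: "0 < t \<Longrightarrow> ((\<lambda>s. L (v s) x) has_real_derivative L (dt v t) x) (at t)"
proof -
  show "time_smooth (\<lambda>t. L (v t))"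
  proof (rule time_smoothI)
    fix U \<phi> \<psi> assume c: "(U, \<phi>, \<psi>) \<in> A" and o: "open ({0<..} \<times> \<phi> ` U :: (real \<times> 'e) set)"
    note inv = chart_inverse[OF c]
    obtain a b where a: "\<And>i j. i \<in> Basis \<Longrightarrow> j \<in> Basis \<Longrightarrow> smooth_on (\<phi> ` U) (a i j)"
      and b: "\<And>i. i \<in> Basis \<Longrightarrow> smooth_on (\<phi> ` U) (b i)"
      and L: "\<And>f x. smooth_fun A f \<Longrightarrow> x \<in> U \<Longrightarrow>
        L f x = chart_op a b \<phi> \<psi> f x"
      by (rule L_chart[OF c]) (rule that; assumption)
    let ?V = "time_chart \<psi> v"
    show "smooth_on ({0<..} \<times> \<phi> ` U) (\<lambda>p. L (v (fst p)) (\<psi> (snd p)))"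
    proof (subst smooth_on_cong[OF o])
      fix q :: "real \<times> 'e" assume q: "q \<in> {0<..} \<times> \<phi> ` U"
      then have q': "0 < fst q" "snd q \<in> \<phi> ` U" "\<psi> (snd q) \<in> U" "\<phi> (\<psi> (snd q)) = snd q"
        using inv by auto
      show "L (v (fst q)) (\<psi> (snd q))
          = (\<Sum>i\<in>Basis. \<Sum>j\<in>Basis. a i j (snd q) * pderiv_dir (0, i) (pderiv_dir (0, j) ?V) q)
          + (\<Sum>i\<in>Basis. b i (snd q) * pderiv_dir (0, i) ?V q)"
        unfolding L[OF time_smooth_slice[OF v q'(1)] q'(3)] q'(4)
          pderiv_slice_chart[OF c v q'(1,2)] pderiv_slice_chart2[OF c v q'(1,2)] by simp
    next
      show "smooth_on ({0<..} \<times> \<phi> ` U) (\<lambda>q.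
          (\<Sum>i\<in>Basis. \<Sum>j\<in>Basis. a i j (snd q) * pderiv_dir (0, i) (pderiv_dir (0, j) ?V) q)
          + (\<Sum>i\<in>Basis. b i (snd q) * pderiv_dir (0, i) ?V q))"
        by (intro smooth_on_add smooth_on_sum smooth_on_mult smooth_on_pderiv smooth_on_time_const[OF c]
            a b time_smooth_chart[OF c] v o)
    qed
  qed
  assume t: "0 < t"
  obtain U \<phi> \<psi> where c: "(U, \<phi>, \<psi>) \<in> A" "x \<in> U" by (rule chart_at)
  note o = open_time_chart[OF c(1)]
  obtain a b where L: "\<And>f x. smooth_fun A f \<Longrightarrow> x \<in> U \<Longrightarrow>
      L f x = chart_op a b \<phi> \<psi> f x"
    by (rule L_chart[OF c(1)]) (rule that; assumption)
  have x': "\<phi> x \<in> \<phi> ` U" using c(2) by auto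
  have tx: "(t, \<phi> x) \<in> {0<..} \<times> \<phi> ` U" using t x' by auto
  let ?V = "time_chart \<psi> v" and ?W = "time_chart \<psi> (dt v)"
  note V = time_smooth_chart[OF c(1) v]
  have W: "pderiv_dir (1, 0) ?V q = ?W q" if "q \<in> {0<..} \<times> \<phi> ` U" for q
    using dt_chart[OF c(1) v] that by auto
  have c1: "pderiv_dir (1, 0) (pderiv_dir (0, i) ?V) q = pderiv_dir (0, i) ?W q"
    if q: "q \<in> {0<..} \<times> \<phi> ` U" for i q
    by (rule trans[OF pderiv_dir_commute[OF V o q] pderiv_dir_cong[OF o q W]])
  have c2: "pderiv_dir (1, 0) (pderiv_dir (0, i) (pderiv_dir (0, j) ?V)) q = pderiv_dir (0, i) (pderiv_dir (0, j) ?W) q"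
    if q: "q \<in> {0<..} \<times> \<phi> ` U" for i j q
    by (rule trans[OF pderiv_dir_commute[OF smooth_on_pderiv[OF V o] o q] pderiv_dir_cong[OF o q c1]])
  have d: "((\<lambda>s. H (s, \<phi> x)) has_real_derivative pderiv_dir (1, 0) H (t, \<phi> x)) (at t)"
    if "smooth_on ({0<..} \<times> \<phi> ` U) H" for H
    by (rule slice_fst[OF smooth_on_imp_differentiable[OF that tx]])
  have "((\<lambda>s. (\<Sum>i\<in>Basis. \<Sum>j\<in>Basis. a i j (\<phi> x) * pderiv_dir (0, i) (pderiv_dir (0, j) ?V) (s, \<phi> x))
        + (\<Sum>i\<in>Basis. b i (\<phi> x) * pderiv_dir (0, i) ?V (s, \<phi> x))) has_real_derivative
      (\<Sum>i\<in>Basis. \<Sum>j\<in>Basis. a i j (\<phi> x) * pderiv_dir (1, 0) (pderiv_dir (0, i) (pderiv_dir (0, j) ?V)) (t, \<phi> x))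
        + (\<Sum>i\<in>Basis. b i (\<phi> x) * pderiv_dir (1, 0) (pderiv_dir (0, i) ?V) (t, \<phi> x))) (at t)"
    by (intro DERIV_add DERIV_sum DERIV_cmult d smooth_on_pderiv V o)
  moreover have "(\<Sum>i\<in>Basis. \<Sum>j\<in>Basis. a i j (\<phi> x) * pderiv_dir (1, 0) (pderiv_dir (0, i) (pderiv_dir (0, j) ?V)) (t, \<phi> x))
        + (\<Sum>i\<in>Basis. b i (\<phi> x) * pderiv_dir (1, 0) (pderiv_dir (0, i) ?V) (t, \<phi> x)) = L (dt v t) x"
    unfolding L[OF time_smooth_slice[OF time_smooth_dt[OF v] t] c(2)] c1[OF tx] c2[OF tx]
      pderiv_slice_chart[OF c(1) time_smooth_dt[OF v] t x'] pderiv_slice_chart2[OF c(1) time_smooth_dt[OF v] t x'] ..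
  ultimately have "((\<lambda>s. (\<Sum>i\<in>Basis. \<Sum>j\<in>Basis. a i j (\<phi> x) * pderiv_dir (0, i) (pderiv_dir (0, j) ?V) (s, \<phi> x))
        + (\<Sum>i\<in>Basis. b i (\<phi> x) * pderiv_dir (0, i) ?V (s, \<phi> x))) has_real_derivative L (dt v t) x) (at t)"
    by simp
  then show "((\<lambda>s. L (v s) x) has_real_derivative L (dt v t) x) (at t)"
  proof (rule has_field_derivative_transform_within_open[of _ _ _ "{0<..}"])
    fix s :: real assume s: "s \<in> {0<..}"
    then have s': "0 < s" by simp
    show "(\<Sum>i\<in>Basis. \<Sum>j\<in>Basis. a i j (\<phi> x) * pderiv_dir (0, i) (pderiv_dir (0, j) ?V) (s, \<phi> x))
        + (\<Sum>i\<in>Basis. b i (\<phi> x) * pderiv_dir (0, i) ?V (s, \<phi> x)) = L (v s) x"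
      unfolding L[OF time_smooth_slice[OF v s'] c(2)]
        pderiv_slice_chart[OF c(1) v s' x'] pderiv_slice_chart2[OF c(1) v s' x'] ..
  qed (use t in auto)
qed

lemma time_smooth_Gam:
  assumes "time_smooth v" "time_smooth w"
  shows "time_smooth (\<lambda>t. Gam L (v t) (w t))"
  unfolding Gam_def
  by (intro time_smooth_mult time_smooth_diff time_smooth_const[OF smooth_fun_const] time_smooth_L assms)

text \<open>On the diagonal, \<open>Gam\<close> is a combination of \<open>L\<close> applied to the
  square and of v times \<open>L\<close> v, so differentiating \<open>L\<close> along smooth
  families is enough.\<close>

lemma has_derivative_Gam:
  assumes v: "time_smooth v" and t: "0 < t"
  shows "((\<lambda>s. Gam L (v s) (v s) x) has_real_derivative 2 * Gam L (v t) (dt v t) x) (at t)"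
proof -
  note V = time_smooth_has_derivative[OF v t]
  note s = time_smooth_slice[OF v t] time_smooth_slice[OF time_smooth_dt[OF v] t]
  have vv: "time_smooth (\<lambda>t x. v t x * v t x)" by (intro time_smooth_mult v)
  have "dt (\<lambda>t x. v t x * v t x) t = (\<lambda>x. 2 * (v t x * dt v t x))"
    unfolding dt_def[of "\<lambda>t x. v t x * v t x"]
    using DERIV_imp_deriv[OF DERIV_mult'[OF V V]] by (auto simp: algebra_simps)
  then have "((\<lambda>s. L (\<lambda>x. v s x * v s x) x) has_real_derivative 2 * L (\<lambda>x. v t x * dt v t x) x) (at t)"
    using has_derivative_L[OF vv t, of x] L_cmult[OF smooth_fun_mult[OF s], of 2 x] by simp
  note D = this DERIV_mult'[OF V has_derivative_L[OF v t]]
  have "((\<lambda>s. 1/2 * (L (\<lambda>x. v s x * v s x) x - v s x * L (v s) x - v s x * L (v s) x)) has_real_derivative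
      1/2 * (2 * L (\<lambda>x. v t x * dt v t x) x - (v t x * L (dt v t) x + dt v t x * L (v t) x)
        - (v t x * L (dt v t) x + dt v t x * L (v t) x))) (at t)"
    by (intro DERIV_cmult DERIV_diff D)
  then show ?thesis
    unfolding Gam_def by (rule DERIV_cong) (simp add: algebra_simps)
qed

end

section \<open>Square integrable functions\<close>

lemma L2_fun_linear:
  assumes "f \<in> L2_fun \<mu>" "g \<in> L2_fun \<mu>"
  shows "(\<lambda>x. r * f x + s * g x) \<in> L2_fun \<mu>"
proof -
  have [measurable]: "f \<in> borel_measurable \<mu>" "g \<in> borel_measurable \<mu>"
    and i: "integrable \<mu> (\<lambda>x. 2 * r\<^sup>2 * (f x)\<^sup>2 + 2 * s\<^sup>2 * (g x)\<^sup>2)"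
    using assms by (auto simp: L2_fun_def)
  have "(r * f x + s * g x)\<^sup>2 \<le> 2 * r\<^sup>2 * (f x)\<^sup>2 + 2 * s\<^sup>2 * (g x)\<^sup>2" for x
    using zero_le_power2[of "r * f x - s * g x"] by (simp add: power2_eq_square algebra_simps)
  then have "integrable \<mu> (\<lambda>x. (r * f x + s * g x)\<^sup>2)"
    by (intro Bochner_Integration.integrable_bound[OF i]) (auto intro!: AE_I2 order_trans[OF _ abs_ge_self])
  then show ?thesis by (simp add: L2_fun_def)
qed

lemma L2_fun_diff: "f \<in> L2_fun \<mu> \<Longrightarrow> g \<in> L2_fun \<mu> \<Longrightarrow> (\<lambda>x. f x - g x) \<in> L2_fun \<mu>"
  using L2_fun_linear[of f \<mu> g 1 "-1"] by simp

lemma L2_fun_integrable_mult: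
  assumes "f \<in> L2_fun \<mu>" "g \<in> L2_fun \<mu>"
  shows "integrable \<mu> (\<lambda>x. f x * g x)"
proof -
  have [measurable]: "f \<in> borel_measurable \<mu>" "g \<in> borel_measurable \<mu>"
    and i: "integrable \<mu> (\<lambda>x. (f x)\<^sup>2 + (g x)\<^sup>2)"
    using assms by (auto simp: L2_fun_def)
  have "\<bar>f x * g x\<bar> \<le> (f x)\<^sup>2 + (g x)\<^sup>2" for x
  proof -
    have "2 * (\<bar>f x\<bar> * \<bar>g x\<bar>) \<le> (f x)\<^sup>2 + (g x)\<^sup>2"
      using sum_squares_bound[of "\<bar>f x\<bar>" "\<bar>g x\<bar>"] by (simp add: mult.assoc)
    moreover have "0 \<le> \<bar>f x\<bar> * \<bar>g x\<bar>" by simp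
    ultimately show ?thesis unfolding abs_mult by linarith
  qed
  then show ?thesis
    by (intro Bochner_Integration.integrable_bound[OF i]) (auto intro!: AE_I2)
qed

lemma L2_Cauchy_Schwarz:
  assumes f: "f \<in> L2_fun \<mu>" and g: "g \<in> L2_fun \<mu>"
  shows "\<bar>LINT x|\<mu>. f x * g x\<bar> \<le> L2_dist \<mu> f (\<lambda>_. 0) * L2_dist \<mu> g (\<lambda>_. 0)"
proof -
  have i: "integrable \<mu> (\<lambda>x. f x * g x)" "integrable \<mu> (\<lambda>x. (f x)\<^sup>2)" "integrable \<mu> (\<lambda>x. (g x)\<^sup>2)"
    using L2_fun_integrable_mult[OF f g] f g by (auto simp: L2_fun_def)
  have "(LINT x|\<mu>. f x * g x)\<^sup>2 \<le> (LINT x|\<mu>. (f x)\<^sup>2) * (LINT x|\<mu>. (g x)\<^sup>2)"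
  proof (rule quadratic_form_discriminant)
    fix r s :: real
    have "0 \<le> (LINT x|\<mu>. (r * f x + s * g x)\<^sup>2)" by (intro integral_nonneg_AE) auto
    also have "(\<lambda>x. (r * f x + s * g x)\<^sup>2) = (\<lambda>x. r\<^sup>2 * (f x)\<^sup>2 + 2 * r * s * (f x * g x) + s\<^sup>2 * (g x)\<^sup>2)"
      by (simp add: power2_eq_square algebra_simps)
    also have "(LINT x|\<mu>. \<dots> x) = r\<^sup>2 * (LINT x|\<mu>. (f x)\<^sup>2) + 2 * r * s * (LINT x|\<mu>. f x * g x) + s\<^sup>2 * (LINT x|\<mu>. (g x)\<^sup>2)"
      using i by simp
    finally show "0 \<le> \<dots>" .
  qed
  then have "sqrt ((LINT x|\<mu>. f x * g x)\<^sup>2) \<le> sqrt ((LINT x|\<mu>. (f x)\<^sup>2) * (LINT x|\<mu>. (g x)\<^sup>2))"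
    by (rule real_sqrt_le_mono)
  then show ?thesis by (simp add: L2_dist_def real_sqrt_mult)
qed

text \<open>Strong convergence implies weak convergence. A general filter F covers both the
  sequences that define the closure of an operator and the limits at time 0.\<close>

lemma L2_tendsto_integral:
  assumes k: "k \<in> L2_fun \<mu>" and u: "u \<in> L2_fun \<mu>" and f: "\<forall>\<^sub>F n in F. f n \<in> L2_fun \<mu>"
    and lim: "((\<lambda>n. L2_dist \<mu> (f n) u) \<longlongrightarrow> 0) F"
  shows "((\<lambda>n. LINT x|\<mu>. k x * f n x) \<longlongrightarrow> (LINT x|\<mu>. k x * u x)) F"
proof (rule LIM_zero_cancel, rule Lim_null_comparison)
  show "((\<lambda>n. L2_dist \<mu> k (\<lambda>_. 0) * L2_dist \<mu> (f n) u) \<longlongrightarrow> 0) F"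
    using tendsto_mult_right_zero[OF lim] by simp
  show "\<forall>\<^sub>F n in F. norm ((LINT x|\<mu>. k x * f n x) - (LINT x|\<mu>. k x * u x)) \<le> L2_dist \<mu> k (\<lambda>_. 0) * L2_dist \<mu> (f n) u"
    using f
  proof eventually_elim
    case (elim n)
    have "(LINT x|\<mu>. k x * f n x) - (LINT x|\<mu>. k x * u x) = (LINT x|\<mu>. k x * (f n x - u x))"
      using L2_fun_integrable_mult[OF k elim] L2_fun_integrable_mult[OF k u] by (simp add: right_diff_distrib)
    then show ?case
      using L2_Cauchy_Schwarz[OF k L2_fun_diff[OF elim u]] by (simp add: L2_dist_def)
  qed
qed

section \<open>The heat semigroup\<close>

context measured_manifold
begin

lemma has_derivative_time_integral:
  assumes v: "time_smooth v" and K: "compact K" and t: "0 < t"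
  shows "((\<lambda>s. LINT x:K|\<mu>. v s x) has_real_derivative (LINT x:K|\<mu>. dt v t x)) (at t)"
proof -
  have "((\<lambda>s. LINT x:K|\<mu>. v s x) has_derivative
      (\<lambda>w. \<Sum>b\<in>Basis. (w \<bullet> b) * (LINT x:K|\<mu>. pderiv_dir b (\<lambda>s. v s x) t))) (at t)"
    using has_derivative_Ck_param_integral[OF sets_\<mu> emeasure_compact_finite[OF K] K open_greaterThan
        Ck_param_time_smooth[OF v], of t] t by simp
  moreover have "pderiv_dir 1 (\<lambda>s. v s x) t = dt v t x" for x
    using pderiv_dir_eq[OF time_smooth_has_derivative[OF v t, unfolded has_field_derivative_def], where v=1] by simp
  ultimately show ?thesis
    by (intro has_derivative_imp_has_field_derivative) auto
qed

end

locale heat_diffusion = diffusion A \<mu> L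
  for A :: "('a::{t2_space,second_countable_topology}, 'e::euclidean_space) chart set" and \<mu> L +
  fixes p :: "'a \<Rightarrow> 'a \<Rightarrow> real \<Rightarrow> real"
  assumes kernel: "heat_kernel A \<mu> L p"
    and conservative: "\<And>t. 0 \<le> t \<Longrightarrow> heat_op \<mu> p t (\<lambda>_. 1) = (\<lambda>_. 1)"
begin

abbreviation P :: "real \<Rightarrow> ('a \<Rightarrow> real) \<Rightarrow> 'a \<Rightarrow> real" where
  "P \<equiv> heat_op \<mu> p"

lemma P_pos: "0 < t \<Longrightarrow> P t f x = (LINT y|\<mu>. p x y t * f y)"
  by (simp add: heat_op_def)

lemma kernel_positive: "0 < t \<Longrightarrow> 0 < p x y t"
  using kernel by (simp add: heat_kernel_def)

lemma integral_kernel: "0 < t \<Longrightarrow> (LINT y|\<mu>. p x y t) = 1"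
  using fun_cong[OF conservative[of t], of x] by (simp add: P_pos)

text \<open>A function that is not integrable has integral 0 by convention, which the value 1
  excludes.\<close>

lemma integrable_kernel: "0 < t \<Longrightarrow> integrable \<mu> (\<lambda>y. p x y t)"
  using integral_kernel[of t x] not_integrable_integral_eq[of \<mu> "\<lambda>y. p x y t"] by fastforce

lemma integrable_kernel_mult:
  assumes "0 < t" "f \<in> borel_measurable \<mu>" "\<And>x. \<bar>f x\<bar> \<le> M"
  shows "integrable \<mu> (\<lambda>y. p x y t * f y)"
proof (rule Bochner_Integration.integrable_bound)
  show "integrable \<mu> (\<lambda>y. p x y t * M)" using integrable_kernel[OF assms(1)] by simp
  show "(\<lambda>y. p x y t * f y) \<in> borel_measurable \<mu>"
    using integrable_kernel[OF assms(1)] assms(2) by (intro borel_measurable_times) auto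
  show "AE y in \<mu>. norm (p x y t * f y) \<le> norm (p x y t * M)"
    using assms(3) kernel_positive[OF assms(1), of x, THEN less_imp_le]
    by (intro AE_I2) (auto simp: abs_mult intro!: mult_left_mono order_trans[OF _ abs_ge_self])
qed

lemma P_bounded:
  assumes "0 < t" "f \<in> borel_measurable \<mu>" "\<And>x. \<bar>f x\<bar> \<le> M"
  shows "\<bar>P t f x\<bar> \<le> M"
proof -
  note i = integrable_kernel_mult[OF assms]
  have "\<bar>p x y t * f y\<bar> \<le> p x y t * M" for y
    using assms(3)[of y] kernel_positive[OF assms(1), of x y] by (simp add: abs_mult)
  then have "\<bar>LINT y|\<mu>. p x y t * f y\<bar> \<le> (LINT y|\<mu>. p x y t * M)"
    using integrable_kernel[OF assms(1)]
    by (intro order_trans[OF integral_abs_bound integral_mono] integrable_abs i) auto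
  then show ?thesis
    using integral_kernel[OF assms(1), of x] by (simp add: P_pos[OF assms(1)])
qed

lemma generator: "generates \<mu> (op_closure \<mu> (test_graph A L)) P"
  using kernel by (simp add: heat_kernel_def)

lemma P_L2: "0 \<le> t \<Longrightarrow> f \<in> L2_fun \<mu> \<Longrightarrow> P t f \<in> L2_fun \<mu>"
  and P_contraction: "0 \<le> t \<Longrightarrow> f \<in> L2_fun \<mu> \<Longrightarrow> L2_dist \<mu> (P t f) (\<lambda>_. 0) \<le> L2_dist \<mu> f (\<lambda>_. 0)"
  and P_linear: "0 \<le> t \<Longrightarrow> f \<in> L2_fun \<mu> \<Longrightarrow> g \<in> L2_fun \<mu> \<Longrightarrow>
    AE x in \<mu>. P t (\<lambda>y. r * f y + s * g y) x = r * P t f x + s * P t g x"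
  and P_semigroup: "0 \<le> s \<Longrightarrow> 0 \<le> t \<Longrightarrow> f \<in> L2_fun \<mu> \<Longrightarrow> AE x in \<mu>. P (s + t) f x = P s (P t f) x"
  and P_continuous: "f \<in> L2_fun \<mu> \<Longrightarrow> ((\<lambda>t. L2_dist \<mu> (P t f) f) \<longlongrightarrow> 0) (at_right 0)"
  and P_generator: "op_closure \<mu> (test_graph A L) = {(u, v). u \<in> L2_fun \<mu> \<and> v \<in> L2_fun \<mu> \<and>
    ((\<lambda>t. L2_dist \<mu> (\<lambda>x. (P t u x - u x) / t) v) \<longlongrightarrow> 0) (at_right 0)}"
  using generator unfolding generates_def by blast+

text \<open>The kernel integral runs over the compact support of g only, and the kernel is smooth
  jointly in its arguments; the integration variable is treated as the parameter.\<close>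

lemma time_smooth_P:
  assumes g: "test_fun A g" shows "time_smooth (\<lambda>t. P t g)"
proof (rule time_smoothI)
  fix U \<phi> \<psi> assume c: "(U, \<phi>, \<psi>) \<in> A" and o: "open ({0<..} \<times> \<phi> ` U :: (real \<times> 'e) set)"
  let ?K = "fun_supp g"
  have K: "compact ?K" using g by (simp add: test_fun_def)
  define F where "F x q = p (\<psi> (snd q)) x (fst q) * g x" for x q
  have F: "Ck_param k ?K ({0<..} \<times> \<phi> ` U) F" for k
  proof (rule Ck_paramI[OF o])
    fix x
    obtain U' \<phi>' \<psi>' where c': "(U', \<phi>', \<psi>') \<in> A" "x \<in> U'" by (rule chart_at)
    let ?W = "\<phi>' ` U' \<times> ({0<..} \<times> \<phi> ` U) :: ('e \<times> (real \<times> 'e)) set"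
    let ?D = "\<phi> ` U \<times> (\<phi>' ` U' \<times> {0<..}) :: ('e \<times> ('e \<times> real)) set"
    have W: "open ?W" "open ?D"
      using o chart_homeomorphism(2)[OF c] chart_homeomorphism(2)[OF c'(1)] by (auto intro!: open_Times)
    have H: "smooth_on ?D (\<lambda>(y, y', t). p (\<psi> y) (\<psi>' y') t)"
      using bspec[OF bspec[OF conjunct1[OF kernel[unfolded heat_kernel_def]] c, unfolded prod.case] c'(1), unfolded prod.case] .
    have "smooth_on ?W (\<lambda>w. (\<lambda>(y, y', t). p (\<psi> y) (\<psi>' y') t) (snd (snd w), fst w, fst (snd w)))"
      by (rule smooth_on_compose[OF H, of ?W "\<lambda>w. (snd (snd w), fst w, fst (snd w))"])
        (auto intro!: smooth_on_Pair smooth_on_fst smooth_on_snd smooth_on_ident W simp del: open_Times)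
    moreover have "smooth_on ?W (\<lambda>w. (g \<circ> \<psi>') (fst w))"
      by (rule smooth_on_compose[OF smooth_fun_chart[OF c'(1) test_fun_smooth[OF g]], of ?W fst])
        (auto intro!: smooth_on_fst smooth_on_ident W chart_homeomorphism(2)[OF c'(1)])
    ultimately have HW: "smooth_on ?W (\<lambda>w. p (\<psi> (snd (snd w))) (\<psi>' (fst w)) (fst (snd w)) * g (\<psi>' (fst w)))"
      using smooth_on_mult[OF _ _ W(1)] by (simp add: o_def)
    show "\<exists>N (\<eta> :: 'a \<Rightarrow> 'e) H W. open N \<and> x \<in> N \<and> continuous_on (?K \<inter> N) \<eta> \<and> open W \<and> smooth_on W H \<and>
        (\<forall>x'\<in>?K \<inter> N. \<forall>z\<in>{0<..} \<times> \<phi> ` U. (\<eta> x', z) \<in> W \<and> F x' z = H (\<eta> x', z))"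
    proof (intro exI conjI)
      show "smooth_on ?W (\<lambda>w. p (\<psi> (snd (snd w))) (\<psi>' (fst w)) (fst (snd w)) * g (\<psi>' (fst w)))" by fact
      show "continuous_on (?K \<inter> U') \<phi>'"
        using chart_continuous(1)[OF c'(1)] by (rule continuous_on_subset) simp
    qed (use c' W chart_homeomorphism(1)[OF c'(1)] chart_inverse[OF c'(1)] in \<open>auto simp: F_def\<close>)
  qed
  show "smooth_on ({0<..} \<times> \<phi> ` U) (\<lambda>q. P (fst q) g (\<psi> (snd q)))"
  proof (subst smooth_on_cong[OF o])
    show "smooth_on ({0<..} \<times> \<phi> ` U) (\<lambda>q. LINT x:?K|\<mu>. F x q)"
      unfolding smooth_on_def
      by (intro allI Ck_on_Ck_param_integral[OF sets_\<mu> emeasure_compact_finite[OF K] K o] F)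
    fix q :: "real \<times> 'e" assume "q \<in> {0<..} \<times> \<phi> ` U"
    then have "0 < fst q" by auto
    then show "P (fst q) g (\<psi> (snd q)) = (LINT x:?K|\<mu>. F x q)"
      unfolding P_pos[OF \<open>0 < fst q\<close>] set_lebesgue_integral_def F_def
      by (intro Bochner_Integration.integral_cong refl) (auto simp: not_in_fun_supp split: split_indicator)
  qed
qed

lemma smooth_fun_P: "test_fun A g \<Longrightarrow> 0 < t \<Longrightarrow> smooth_fun A (P t g)"
  using time_smooth_slice[OF time_smooth_P] .

text \<open>\<open>P t\<close> commutes with \<open>P h\<close>, so the error of the quotient at
  \<open>P t g\<close> is \<open>P t\<close> applied to the error at g, and \<open>P t\<close> is a
  contraction. The relations hold almost everywhere, which is why the distances are compared through
  integrals.\<close>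

lemma P_difference_quotient:
  assumes g: "test_fun A g" and t: "0 \<le> t" and h: "0 < h"
  shows "L2_dist \<mu> (\<lambda>x. (P h (P t g) x - P t g x) / h) (P t (L g)) \<le> L2_dist \<mu> (\<lambda>x. (P h g x - g x) / h) (L g)"
proof -
  have g2: "g \<in> L2_fun \<mu>" "L g \<in> L2_fun \<mu>" using g by (auto intro: test_fun_L2 test_fun_L)
  have hg: "P h g \<in> L2_fun \<mu>" using P_L2[OF _ g2(1)] h by simp
  define q where "q x = (1 / h) * P h g x + (- 1 / h) * g x" for x
  define q' where "q' x = 1 * q x + (- 1) * L g x" for x
  have q: "q \<in> L2_fun \<mu>" unfolding q_def by (rule L2_fun_linear[OF hg g2(1)])
  have q': "q' \<in> L2_fun \<mu>" unfolding q'_def by (rule L2_fun_linear[OF q g2(2)])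
  have lin: "AE x in \<mu>. P t q x = (1 / h) * P t (P h g) x + (- 1 / h) * P t g x"
    unfolding q_def[abs_def] by (rule P_linear[OF t hg g2(1)])
  have lin': "AE x in \<mu>. P t q' x = 1 * P t q x + (- 1) * P t (L g) x"
    unfolding q'_def[abs_def] by (rule P_linear[OF t q g2(2)])
  have ae: "AE x in \<mu>. (P h (P t g) x - P t g x) / h - P t (L g) x = P t q' x"
    using P_semigroup[OF less_imp_le[OF h] t g2(1)] P_semigroup[OF t less_imp_le[OF h] g2(1)] lin lin'
  proof eventually_elim
    case (elim x)
    have "P h (P t g) x = P t (P h g) x" using elim(1,2) by (simp add: add.commute)
    moreover have "P t q x = (P t (P h g) x - P t g x) / h" using elim(3) by (simp add: diff_divide_distrib)
    ultimately show ?case using elim(4) by simp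
  qed
  have [measurable]: "P t q' \<in> borel_measurable \<mu>" "P h (P t g) \<in> borel_measurable \<mu>"
    "P t g \<in> borel_measurable \<mu>" "P t (L g) \<in> borel_measurable \<mu>"
    using P_L2 t h q' g2 by (auto simp: L2_fun_def)
  have "(LINT x|\<mu>. ((P h (P t g) x - P t g x) / h - P t (L g) x)\<^sup>2) = (LINT x|\<mu>. (P t q' x)\<^sup>2)"
    by (rule integral_cong_AE) (use ae in auto)
  then have "L2_dist \<mu> (\<lambda>x. (P h (P t g) x - P t g x) / h) (P t (L g)) = L2_dist \<mu> (P t q') (\<lambda>_. 0)"
    by (simp add: L2_dist_def)
  also have "\<dots> \<le> L2_dist \<mu> q' (\<lambda>_. 0)" by (rule P_contraction[OF t q'])
  also have "q' = (\<lambda>x. (P h g x - g x) / h - L g x)"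
    by (rule ext) (simp add: q'_def q_def diff_divide_distrib)
  also have "L2_dist \<mu> \<dots> (\<lambda>_. 0) = L2_dist \<mu> (\<lambda>x. (P h g x - g x) / h) (L g)"
    by (simp add: L2_dist_def)
  finally show ?thesis .
qed

lemma P_difference_quotient_tendsto:
  assumes g: "test_fun A g" and t: "0 \<le> t"
  shows "((\<lambda>h. L2_dist \<mu> (\<lambda>x. (P h (P t g) x - P t g x) / h) (P t (L g))) \<longlongrightarrow> 0) (at_right 0)"
proof (rule Lim_null_comparison)
  \<comment> \<open>Constant sequences show that the closure contains the graph over test
    functions.\<close>
  have "(g, L g) \<in> op_closure \<mu> (test_graph A L)"
    unfolding op_closure_def test_graph_def using g test_fun_L2[OF g] test_fun_L2[OF test_fun_L[OF g]]
    by (intro CollectI case_prodI conjI exI[of _ "\<lambda>_. g"] exI[of _ "\<lambda>_. L g"]) (auto simp: L2_dist_def)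
  then show "((\<lambda>h. L2_dist \<mu> (\<lambda>x. (P h g x - g x) / h) (L g)) \<longlongrightarrow> 0) (at_right 0)"
    unfolding P_generator by simp
  have "norm (L2_dist \<mu> (\<lambda>x. (P h (P t g) x - P t g x) / h) (P t (L g))) \<le> L2_dist \<mu> (\<lambda>x. (P h g x - g x) / h) (L g)"
    if "0 < h" for h
    using P_difference_quotient[OF g t that] by (simp add: L2_dist_def)
  then show "\<forall>\<^sub>F h in at_right 0. norm (L2_dist \<mu> (\<lambda>x. (P h (P t g) x - P t g x) / h) (P t (L g)))
      \<le> L2_dist \<mu> (\<lambda>x. (P h g x - g x) / h) (L g)"
    by (auto simp: eventually_at_filter)
qed

text \<open>The closure of \<open>L\<close> at \<open>P t g\<close> is a limit along test functions.
  Before the limit, integration by parts moves \<open>L\<close> on to k; after it, \<open>L\<close>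
  returns to \<open>P t g\<close>, which is smooth.\<close>

lemma integral_test_P_L:
  assumes g: "test_fun A g" and k: "test_fun A k" and t: "0 < t"
  shows "(LINT x|\<mu>. k x * P t (L g) x) = (LINT x|\<mu>. k x * L (P t g) x)"
proof -
  have L2: "P t g \<in> L2_fun \<mu>" "P t (L g) \<in> L2_fun \<mu>"
    using P_L2 t test_fun_L2 g test_fun_L by auto
  have "(P t g, P t (L g)) \<in> op_closure \<mu> (test_graph A L)"
    unfolding P_generator using P_difference_quotient_tendsto[OF g] t L2 by simp
  then obtain f f' where f: "\<And>n::nat. (f n, f' n) \<in> test_graph A L"
    "(\<lambda>n. L2_dist \<mu> (f n) (P t g)) \<longlonglongrightarrow> 0" "(\<lambda>n. L2_dist \<mu> (f' n) (P t (L g))) \<longlonglongrightarrow> 0"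
    unfolding op_closure_def by blast
  have ft: "test_fun A (f n)" "f' n = L (f n)" for n using f(1)[of n] by (auto simp: test_graph_def)
  have "(\<lambda>n. LINT x|\<mu>. k x * f' n x) \<longlonglongrightarrow> (LINT x|\<mu>. k x * P t (L g) x)"
    using ft by (intro L2_tendsto_integral[OF _ L2(2) _ f(3)] test_fun_L2 k always_eventually allI)
      (simp add: test_fun_L2 test_fun_L)
  moreover have "(\<lambda>n. LINT x|\<mu>. L k x * f n x) \<longlonglongrightarrow> (LINT x|\<mu>. L k x * P t g x)"
    using ft by (intro L2_tendsto_integral[OF _ L2(1) _ f(2)] test_fun_L2 test_fun_L k always_eventually allI)
      (simp add: test_fun_L2)
  moreover have "(LINT x|\<mu>. L k x * f n x) = (LINT x|\<mu>. k x * f' n x)" for n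
    using L_by_parts[OF k test_fun_smooth[OF ft(1)[of n]]] by (simp add: ft(2) mult.commute)
  ultimately have "(LINT x|\<mu>. k x * P t (L g) x) = (LINT x|\<mu>. L k x * P t g x)"
    by (auto intro: LIMSEQ_unique)
  also have "\<dots> = (LINT x|\<mu>. k x * L (P t g) x)"
    using L_by_parts[OF k smooth_fun_P[OF g t]] by (simp add: mult.commute)
  finally show ?thesis .
qed

text \<open>Both sides are continuous, so testing against every k suffices. The tested time
  derivative is identified with the L2 derivative of the semigroup, that is
  \<open>P t (L g)\<close>, and the weak identity for \<open>P t (L g)\<close> finishes.\<close>

lemma heat_equation:
  assumes g: "test_fun A g" and t: "0 < t"
  shows "dt (\<lambda>t. P t g) t x = L (P t g) x"
proof (rule eq_of_test_integrals)
  let ?u = "\<lambda>t. P t g"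
  have u: "time_smooth ?u" by (rule time_smooth_P[OF g])
  show "continuous_on UNIV (dt ?u t)" "continuous_on UNIV (L (P t g))"
    by (intro smooth_fun_continuous time_smooth_slice[OF time_smooth_dt[OF u] t] smooth_fun_L smooth_fun_P g t)+
  fix k assume k: "test_fun A k"
  let ?K = "fun_supp k"
  have K: "compact ?K" using k by (simp add: test_fun_def)
  have ku: "time_smooth (\<lambda>s x. k x * ?u s x)"
    by (intro time_smooth_mult time_smooth_const test_fun_smooth k u)
  have dku: "dt (\<lambda>s x. k x * ?u s x) t x = k x * dt ?u t x" for x
    unfolding dt_def[of "\<lambda>s x. k x * ?u s x"]
    by (intro DERIV_imp_deriv DERIV_cmult time_smooth_has_derivative[OF u t])
  have supp: "(LINT x|\<mu>. k x * w x) = (LINT x:?K|\<mu>. k x * w x)" for w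
    unfolding set_lebesgue_integral_def
    by (intro Bochner_Integration.integral_cong refl) (auto simp: not_in_fun_supp split: split_indicator)
  have "((\<lambda>s. LINT x|\<mu>. k x * ?u s x) has_real_derivative (LINT x|\<mu>. k x * dt ?u t x)) (at t)"
    using has_derivative_time_integral[OF ku K t] unfolding supp dku .
  \<comment> \<open>The generator is a one-sided derivative, so only the limit from the right is
    kept for comparison.\<close>
  then have 1: "((\<lambda>h. ((LINT x|\<mu>. k x * ?u (t + h) x) - (LINT x|\<mu>. k x * ?u t x)) / h)
      \<longlongrightarrow> (LINT x|\<mu>. k x * dt ?u t x)) (at_right 0)"
    unfolding DERIV_def by (rule tendsto_mono[OF at_le, rotated]) simp
  have gL2: "g \<in> L2_fun \<mu>" "k \<in> L2_fun \<mu>" using g k by (auto intro: test_fun_L2)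
  have tL2: "P t g \<in> L2_fun \<mu>" using P_L2[OF _ gL2(1)] t by simp
  have "((\<lambda>h. LINT x|\<mu>. k x * ((P h (P t g) x - P t g x) / h)) \<longlongrightarrow> (LINT x|\<mu>. k x * P t (L g) x)) (at_right 0)"
  proof (rule L2_tendsto_integral[OF gL2(2)])
    show "P t (L g) \<in> L2_fun \<mu>" using P_L2 t test_fun_L2 test_fun_L g by simp
    have "(\<lambda>x. (P h (P t g) x - P t g x) / h) \<in> L2_fun \<mu>" if "0 < h" for h
      using L2_fun_linear[OF P_L2[OF less_imp_le[OF that] tL2] tL2, of "1/h" "-1/h"] by (simp add: diff_divide_distrib)
    then show "\<forall>\<^sub>F h in at_right 0. (\<lambda>x. (P h (P t g) x - P t g x) / h) \<in> L2_fun \<mu>"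
      by (auto simp: eventually_at_filter)
    show "((\<lambda>h. L2_dist \<mu> (\<lambda>x. (P h (P t g) x - P t g x) / h) (P t (L g))) \<longlongrightarrow> 0) (at_right 0)"
      using P_difference_quotient_tendsto[OF g] t by simp
  qed
  moreover have "\<forall>\<^sub>F h in at_right 0. (LINT x|\<mu>. k x * ((P h (P t g) x - P t g x) / h))
      = ((LINT x|\<mu>. k x * ?u (t + h) x) - (LINT x|\<mu>. k x * ?u t x)) / h"
    unfolding eventually_at_filter
  proof (intro always_eventually allI impI)
    fix h :: real assume "h \<in> {0<..}"
    then have h: "0 < h" by simp
    have L2: "P h (P t g) \<in> L2_fun \<mu>" "P (t + h) g \<in> L2_fun \<mu>"
      using P_L2[OF less_imp_le[OF h] tL2] P_L2[OF _ gL2(1), of "t + h"] t h by auto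
    have [measurable]: "P h (P t g) \<in> borel_measurable \<mu>" "P (t + h) g \<in> borel_measurable \<mu>" "k \<in> borel_measurable \<mu>"
      using L2 gL2 by (auto simp: L2_fun_def)
    have "(LINT x|\<mu>. k x * P h (P t g) x) = (LINT x|\<mu>. k x * ?u (t + h) x)"
    proof (rule integral_cong_AE)
      show "AE x in \<mu>. k x * P h (P t g) x = k x * P (t + h) g x"
        using P_semigroup[OF less_imp_le[OF h] less_imp_le[OF t] gL2(1)]
        by eventually_elim (simp add: add.commute)
    qed measurable
    then show "(LINT x|\<mu>. k x * ((P h (P t g) x - P t g x) / h))
        = ((LINT x|\<mu>. k x * ?u (t + h) x) - (LINT x|\<mu>. k x * ?u t x)) / h"
      using L2_fun_integrable_mult[OF gL2(2) L2(1)] L2_fun_integrable_mult[OF gL2(2) tL2]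
      by (simp add: right_diff_distrib)
  qed
  ultimately have "((\<lambda>h. ((LINT x|\<mu>. k x * ?u (t + h) x) - (LINT x|\<mu>. k x * ?u t x)) / h)
      \<longlongrightarrow> (LINT x|\<mu>. k x * P t (L g) x)) (at_right 0)"
    by (rule Lim_transform_eventually)
  then have "(LINT x|\<mu>. k x * dt ?u t x) = (LINT x|\<mu>. k x * P t (L g) x)"
    using 1 by (intro tendsto_unique[OF _ 1]) auto
  then show "(LINT x|\<mu>. k x * dt ?u t x) = (LINT x|\<mu>. k x * L (P t g) x)"
    using integral_test_P_L[OF g k t] by simp
qed

end

section \<open>A parabolic maximum principle\<close>

lemma flat_derivatives:
  "(flat 0 has_real_derivative flat 2 s) (at s)"
  "(flat 2 has_real_derivative (flat 4 s - 2 * flat 3 s)) (at s)"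
  using flat_has_derivative[of 0 s] flat_has_derivative[of 2 s] by (simp_all add: numeral_eq_Suc)

text \<open>With i = 1 / s both claims are polynomial: for s > 0 the first amounts to i \<ge> 4, the
  second to i \<ge> 2. They say that for \<Psi> = \<open>flat 0\<close> one has \<Psi>'^2 \<le> 2
  \<Psi> \<Psi>'' and \<Psi>'' \<ge> 0, the convexity needed to absorb a cross term. The bound 1 / 4
  on s originates here.\<close>

lemma flat_square_le:
  assumes "s \<le> 1 / 4"
  shows "(flat 2 s)\<^sup>2 \<le> 2 * flat 0 s * (flat 4 s - 2 * flat 3 s)" "0 \<le> flat 4 s - 2 * flat 3 s"
proof -
  have "(flat 2 s)\<^sup>2 \<le> 2 * flat 0 s * (flat 4 s - 2 * flat 3 s) \<and> 0 \<le> flat 4 s - 2 * flat 3 s"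
  proof (cases "0 < s")
    case True
    define i where "i = inverse s"
    define E where "E = exp (- i)"
    have i: "4 \<le> i" using True assms by (simp add: i_def field_simps)
    have f: "flat n s = i ^ n * E" for n using True by (simp add: flat_def i_def E_def)
    have "0 \<le> E\<^sup>2 * i ^ 3 * (i - 4)" using i by simp
    then have "(flat 2 s)\<^sup>2 \<le> 2 * flat 0 s * (flat 4 s - 2 * flat 3 s)"
      by (simp add: f power2_eq_square algebra_simps power_numeral_reduce)
    moreover have "0 \<le> E * i ^ 3 * (i - 2)" using i by (simp add: E_def)
    then have "0 \<le> flat 4 s - 2 * flat 3 s"
      by (simp add: f algebra_simps power_numeral_reduce)
    ultimately show ?thesis by simp
  qed (simp add: flat_def)
  then show "(flat 2 s)\<^sup>2 \<le> 2 * flat 0 s * (flat 4 s - 2 * flat 3 s)" "0 \<le> flat 4 s - 2 * flat 3 s"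
    by auto
qed

text \<open>With p = 2 F0 a and q = y^2 F2 b the square of the cross term is at most 4 p q, hence
  its modulus is at most p + q, and q cancels. In use, a and b are the squared gradients of the
  cut-off and of the subsolution; only the former survives.\<close>

lemma absorb_cross_term:
  fixes a b D y F0 F1 F2 :: real
  assumes "0 \<le> a" "0 \<le> b" "D\<^sup>2 \<le> a * b" "F1\<^sup>2 \<le> 2 * F0 * F2" "0 \<le> F0" "0 \<le> F2"
  shows "- (2 * y * F1 * D) - y\<^sup>2 * F2 * b \<le> 2 * F0 * a"
proof -
  let ?p = "2 * F0 * a" and ?q = "y\<^sup>2 * F2 * b"
  have nn: "0 \<le> ?p" "0 \<le> ?q" using assms by auto
  have "(F1 * D)\<^sup>2 \<le> (2 * F0 * F2) * (a * b)"
    unfolding power_mult_distrib using assms by (intro mult_mono) auto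
  then have "y\<^sup>2 * (F1 * D)\<^sup>2 \<le> y\<^sup>2 * ((2 * F0 * F2) * (a * b))"
    by (rule mult_left_mono) simp
  then have "(2 * y * F1 * D)\<^sup>2 \<le> 4 * (?p * ?q)"
    by (simp add: power_mult_distrib mult_ac)
  also have "\<dots> \<le> (?p + ?q)\<^sup>2"
    using zero_le_power2[of "?p - ?q"] by (simp add: power2_eq_square algebra_simps)
  finally have "\<bar>2 * y * F1 * D\<bar> \<le> ?p + ?q"
    using nn abs_le_square_iff[of "2 * y * F1 * D" "?p + ?q"] by simp
  then show ?thesis by linarith
qed

context diffusion
begin

text \<open>A Caccioppoli inequality. By the chain rule \<Psi>'(z) L z = L (\<Psi>(z)) - \<Psi>''(z)
  \<Gamma>(z). Integration by parts turns the first term into a cross term between k and z, which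
  the second one absorbs up to 2 \<Psi>(z) \<Gamma>(k). Since \<Psi> grows at most quadratically and
  vanishes for z \<le> 0, a square integrable majorant q of z bounds the rest.\<close>

lemma energy_estimate:
  assumes k: "test_fun A k" and z: "smooth_fun A z" and w: "smooth_fun A w"
    and wL: "\<And>x. w x \<le> L z x" and c: "0 < c" "\<And>x. c * z x \<le> 1 / 4"
    and q: "q \<in> L2_fun \<mu>" "\<And>x. z x \<le> q x"
    and e: "\<And>x. Gam L k k x \<le> e"
  shows "(LINT x|\<mu>. (k x * k x) * (c * flat 2 (c * z x) * w x)) \<le> e * (4 * c\<^sup>2 * (LINT x|\<mu>. (q x)\<^sup>2))"
proof -
  \<comment> \<open>The scaling by c keeps the argument of \<open>flat\<close> in the range where
    the convexity estimates hold.\<close>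
  let ?\<Psi> = "\<lambda>s. flat 0 (c * s)" and ?\<Psi>' = "\<lambda>s. c * flat 2 (c * s)"
    and ?\<Psi>'' = "\<lambda>s. c\<^sup>2 * (flat 4 (c * s) - 2 * flat 3 (c * s))"
  have cs: "((\<lambda>s. c * s) has_real_derivative c) (at s)" for s
    using DERIV_cmult_Id[of c s UNIV] by simp
  have lin: "smooth_on UNIV (\<lambda>s::real. c * s)" by (intro smooth_intros) auto
  have sm: "smooth_on UNIV (\<lambda>s. flat n (c * s))" for n
    by (rule smooth_on_compose[OF smooth_on_flat[of UNIV] lin]) auto
  have D1: "(?\<Psi> has_real_derivative ?\<Psi>' s) (at s)" for s
    using DERIV_chain2[OF flat_derivatives(1) cs, of s] by (simp add: mult.commute)
  have D2: "(?\<Psi>' has_real_derivative ?\<Psi>'' s) (at s)" for s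
    using DERIV_cmult[OF DERIV_chain2[OF flat_derivatives(2) cs, of s], of c]
    by (simp add: power2_eq_square mult_ac)
  have sq: "smooth_on UNIV (\<lambda>s::real. s * s)" "((\<lambda>s::real. s * s) has_real_derivative 2 * s) (at s)" for s
    by (auto intro!: smooth_intros derivative_eq_intros)
  have ks: "smooth_fun A k" using k by (rule test_fun_smooth)
  have zs: "smooth_fun A (\<lambda>x. flat n (c * z x))" for n using smooth_fun_compose[OF sm z] .
  have kk: "test_fun A (\<lambda>x. k x * k x)" by (intro test_fun_mult k ks)
  define I1 where "I1 x = (k x * k x) * L (\<lambda>x. ?\<Psi> (z x)) x" for x
  define I2 where "I2 x = (k x * k x) * (?\<Psi>'' (z x) * Gam L z z x)" for x
  define I3 where "I3 x = Gam L (\<lambda>x. k x * k x) (\<lambda>x. ?\<Psi> (z x)) x" for x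
  have t1: "test_fun A I1" unfolding I1_def by (intro test_fun_mult kk smooth_fun_L zs)
  have t2: "test_fun A I2" unfolding I2_def
    by (intro test_fun_mult kk smooth_fun_mult smooth_fun_diff smooth_fun_const zs smooth_fun_Gam z)
  have I3: "I3 x = k x * (2 * (?\<Psi>' (z x) * Gam L k z x))" for x
  proof -
    have "I3 x = Gam L (\<lambda>x. ?\<Psi> (z x)) (\<lambda>x. k x * k x) x"
      unfolding I3_def by (rule fun_cong[OF Gam_sym])
    also have "\<dots> = 2 * k x * Gam L (\<lambda>x. ?\<Psi> (z x)) k x"
      by (rule Gam_compose[OF sq ks zs])
    also have "Gam L (\<lambda>x. ?\<Psi> (z x)) k x = Gam L k (\<lambda>x. ?\<Psi> (z x)) x"
      by (rule fun_cong[OF Gam_sym])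
    also have "\<dots> = ?\<Psi>' (z x) * Gam L k z x"
      by (rule Gam_compose[OF sm D1 z ks])
    finally show ?thesis by simp
  qed
  have t3: "test_fun A I3"
  proof -
    have "I3 = (\<lambda>x. k x * (2 * (?\<Psi>' (z x) * Gam L k z x)))"
      using I3 by (rule ext)
    moreover have "test_fun A \<dots>"
      by (intro test_fun_mult k smooth_fun_mult smooth_fun_const zs smooth_fun_Gam ks z)
    ultimately show ?thesis by simp
  qed
  note int = integrable_test_fun[OF t1] integrable_test_fun[OF t2] integrable_test_fun[OF t3]
  have i0: "integrable \<mu> (\<lambda>x. (k x * k x) * (c * flat 2 (c * z x) * w x))"
    by (intro integrable_test_fun test_fun_mult kk smooth_fun_mult smooth_fun_const zs w)
  have "(LINT x|\<mu>. (k x * k x) * (c * flat 2 (c * z x) * w x)) \<le> (LINT x|\<mu>. I1 x - I2 x)"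
  proof (intro integral_mono i0 Bochner_Integration.integrable_diff int)
    fix x
    have "(k x * k x) * (c * flat 2 (c * z x) * w x) \<le> (k x * k x) * (c * flat 2 (c * z x) * L z x)"
      using c wL flat_nonneg by (intro mult_left_mono) auto
    also have "\<dots> = I1 x - I2 x"
      unfolding I1_def I2_def L_compose[OF sm D1 D2 z] by (simp add: algebra_simps)
    finally show "(k x * k x) * (c * flat 2 (c * z x) * w x) \<le> I1 x - I2 x" .
  qed
  also have "\<dots> = (LINT x|\<mu>. - I3 x - I2 x)"
    using int integral_L_eq_Gam[OF kk zs, of 0] unfolding I1_def I3_def by simp
  also have "\<dots> \<le> (LINT x|\<mu>. e * (4 * c\<^sup>2 * (q x)\<^sup>2))"
  proof (intro integral_mono)
    show "integrable \<mu> (\<lambda>x. - I3 x - I2 x)" using int by simp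
    show "integrable \<mu> (\<lambda>x. e * (4 * c\<^sup>2 * (q x)\<^sup>2))" using q by (simp add: L2_fun_def)
    fix x
    have "- I3 x - I2 x = - (2 * (k x * c) * flat 2 (c * z x) * Gam L k z x)
        - (k x * c)\<^sup>2 * (flat 4 (c * z x) - 2 * flat 3 (c * z x)) * Gam L z z x"
      by (simp add: I2_def I3 power2_eq_square algebra_simps)
    also have "\<dots> \<le> 2 * flat 0 (c * z x) * Gam L k k x"
      using c(2)[of x] flat_square_le[of "c * z x"]
      by (intro absorb_cross_term Gam_nonneg ks z Gam_Cauchy_Schwarz flat_nonneg) auto
    also have "\<dots> \<le> 2 * flat 0 (c * z x) * e"
      using e[of x] flat_nonneg[of 0 "c * z x"] by (intro mult_left_mono) auto
    also have "\<dots> \<le> 2 * (2 * c\<^sup>2 * (q x)\<^sup>2) * e"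
    proof (intro mult_right_mono mult_left_mono)
      show "0 \<le> e" using e[of x] Gam_nonneg[OF ks, of x] by simp
      show "flat 0 (c * z x) \<le> 2 * c\<^sup>2 * (q x)\<^sup>2"
      proof (cases "0 < z x")
        case True
        have "flat 0 (c * z x) \<le> 2 * (c * z x)\<^sup>2" using flat_le[of 0 "c * z x"] by simp
        also have "\<dots> \<le> 2 * c\<^sup>2 * (q x)\<^sup>2"
          using True q(2)[of x] c(1) by (simp add: power_mult_distrib power_mono)
        finally show ?thesis .
      next
        case False
        then have "flat 0 (c * z x) = 0" using c(1) by (simp add: flat_def zero_less_mult_iff)
        then show ?thesis by simp
      qed
    qed simp
    finally show "- I3 x - I2 x \<le> e * (4 * c\<^sup>2 * (q x)\<^sup>2)" by (simp add: mult_ac)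
  qed
  also have "\<dots> = e * (4 * c\<^sup>2 * (LINT x|\<mu>. (q x)\<^sup>2))" by simp
  finally show ?thesis .
qed

end

section \<open>Cut-offs with small gradient and comparison with the heat semigroup\<close>

locale complete_heat_diffusion = heat_diffusion A \<mu> L p
  for A :: "('a::{t2_space,second_countable_topology}, 'e::euclidean_space) chart set" and \<mu> L p +
  fixes h :: "nat \<Rightarrow> 'a \<Rightarrow> real"
  assumes h_test: "\<And>k. test_fun A (h k)"
    and h_incr: "\<And>x. incseq (\<lambda>k. h k x)"
    and h_lim: "\<And>x. (\<lambda>k. h k x) \<longlonglongrightarrow> 1"
    and h_grad: "(\<lambda>k. sup_norm (Gam L (h k) (h k))) \<longlonglongrightarrow> 0"
begin

lemma h_le_1: "h k x \<le> 1"
  using incseq_le[OF h_incr h_lim] .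

text \<open>The sequence increases from the bounded function \<open>h 0\<close> to the limit 1;
  signs of the cut-offs are not prescribed, hence the two-sided bound.\<close>

lemma h_bounded: obtains H where "1 \<le> H" "\<And>k x. \<bar>h k x\<bar> \<le> H"
proof -
  obtain M where M: "0 < M" "\<And>x. \<bar>h 0 x\<bar> \<le> M"
    by (rule test_fun_bounded[OF h_test[of 0]]) (rule that; assumption)
  have "\<bar>h k x\<bar> \<le> M + 1" for k x
    using M(2)[of x] M(1) h_le_1[of k x] incseqD[OF h_incr[of x], of 0 k] by simp
  then show thesis using that[of "M + 1"] M(1) by simp
qed

lemma eventually_Gam_h_le:
  assumes "0 < e" shows "\<forall>\<^sub>F k in sequentially. \<forall>x. Gam L (h k) (h k) x \<le> e"
proof -
  have "\<forall>\<^sub>F k in sequentially. sup_norm (Gam L (h k) (h k)) < ennreal e"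
    using order_tendstoD(2)[OF h_grad, of "ennreal e"] assms by simp
  then show ?thesis
  proof eventually_elim
    case (elim k)
    have "Gam L (h k) (h k) x \<le> e" for x
    proof -
      have "ennreal \<bar>Gam L (h k) (h k) x\<bar> \<le> sup_norm (Gam L (h k) (h k))"
        unfolding sup_norm_def by (rule SUP_upper) simp
      then have "ennreal \<bar>Gam L (h k) (h k) x\<bar> \<le> ennreal e" using elim by simp
      then show ?thesis using assms by simp
    qed
    then show ?case by simp
  qed
qed

lemma P_h_tendsto:
  assumes "0 < t" "f \<in> borel_measurable \<mu>" "\<And>x. \<bar>f x\<bar> \<le> M"
  shows "(\<lambda>k. P t (\<lambda>x. h k x * f x) x) \<longlonglongrightarrow> P t f x"
  unfolding P_pos[OF assms(1)]
proof -
  obtain H where H: "1 \<le> H" "\<And>k x. \<bar>h k x\<bar> \<le> H" by (rule h_bounded) (rule that; assumption)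
  note [measurable] = assms(2) borel_measurable_smooth[OF test_fun_smooth[OF h_test]]
  have [measurable]: "(\<lambda>y. p x y t) \<in> borel_measurable \<mu>" using integrable_kernel[OF assms(1)] by simp
  show "(\<lambda>k. LINT y|\<mu>. p x y t * (h k y * f y)) \<longlonglongrightarrow> (LINT y|\<mu>. p x y t * f y)"
  proof (rule integral_dominated_convergence[where w="\<lambda>y. p x y t * (H * M)"])
    show "integrable \<mu> (\<lambda>y. p x y t * (H * M))" using integrable_kernel[OF assms(1)] by simp
    show "AE y in \<mu>. (\<lambda>k. p x y t * (h k y * f y)) \<longlonglongrightarrow> p x y t * f y"
      using tendsto_mult_left[OF tendsto_mult_right[OF h_lim]] by (intro AE_I2) fastforce
    show "AE y in \<mu>. norm (p x y t * (h k y * f y)) \<le> p x y t * (H * M)" for k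
      using H assms(3) kernel_positive[OF assms(1), of x, THEN less_imp_le]
      by (intro AE_I2) (auto simp: abs_mult intro!: mult_mono mult_left_mono)
  qed measurable
qed

text \<open>Adding \<open>P t g\<close> makes the positive part of the subsolution square integrable, so that the
  energy of its truncation can be estimated with cut-offs of which only the gradients are controlled.\<close>

context
  fixes g :: "'a \<Rightarrow> real" and v :: "real \<Rightarrow> 'a \<Rightarrow> real" and T B c :: real
  assumes g: "test_fun A g" and v: "time_smooth v"
    and sub: "\<And>t x. 0 < t \<Longrightarrow> t < T \<Longrightarrow> dt v t x \<le> L (v t) x"
    and neg: "\<And>t x. 0 < t \<Longrightarrow> t < T \<Longrightarrow> v t x \<le> 0"
    and init: "\<And>t x. 0 < t \<Longrightarrow> t < T \<Longrightarrow> v t x \<le> B * t - g x"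
    and c: "0 < c" "\<And>x. \<bar>g x\<bar> \<le> 1 / (4 * c)"
begin

abbreviation z :: "real \<Rightarrow> 'a \<Rightarrow> real" where
  "z \<equiv> \<lambda>t x. v t x + P t g x"

text \<open>The cut-off enters squared so that integration by parts leaves one factor
  \<open>h k\<close> next to its gradient; its compact support allows differentiation in time under
  the integral.\<close>

definition energy :: "nat \<Rightarrow> real \<Rightarrow> real" where
  "energy k t = (LINT x|\<mu>. (h k x * h k x) * flat 0 (c * z t x))"

lemma time_smooth_z: "time_smooth z"
  by (intro time_smooth_add v time_smooth_P g)

lemma smooth_fun_z: "0 < t \<Longrightarrow> smooth_fun A (z t)"
  by (rule time_smooth_slice[OF time_smooth_z])

lemma z_subsolution:
  assumes "0 < t" "t < T" shows "dt z t x \<le> L (z t) x"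
proof -
  have "dt z t x = dt v t x + dt (\<lambda>t. P t g) t x"
    unfolding dt_def[of z]
    by (intro DERIV_imp_deriv DERIV_add time_smooth_has_derivative v time_smooth_P g assms)
  then show ?thesis
    using sub[OF assms, of x] heat_equation[OF g assms(1), of x]
      L_add[OF time_smooth_slice[OF v assms(1)] smooth_fun_P[OF g assms(1)]] by simp
qed

lemma z_le_P: "0 < t \<Longrightarrow> t < T \<Longrightarrow> z t x \<le> P t g x"
  using neg[of t x] by simp

text \<open>The kernel is positive with total mass 1, so \<open>P t g\<close> inherits the bound of
  g and \<open>c * z\<close> stays where the truncation is convex.\<close>

lemma c_z_le:
  assumes "0 < t" "t < T" shows "c * z t x \<le> 1 / 4"
proof -
  have "z t x \<le> 1 / (4 * c)"
    using z_le_P[OF assms, of x] P_bounded[OF assms(1) borel_measurable_smooth[OF test_fun_smooth[OF g]] c(2), of x]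
    by linarith
  then show ?thesis using c(1) by (simp add: field_simps)
qed

lemma smooth_on_flat_cmult: "smooth_on UNIV (\<lambda>s. flat n (c * s))"
  by (rule smooth_on_compose[OF smooth_on_flat[of UNIV]]) (auto intro!: smooth_intros)

lemma test_fun_h2: "test_fun A (\<lambda>x. h k x * h k x)"
  by (intro test_fun_mult h_test test_fun_smooth)

lemma energy_has_derivative:
  assumes t: "0 < t"
  shows "(energy k has_real_derivative (LINT x|\<mu>. (h k x * h k x) * (c * flat 2 (c * z t x) * dt z t x))) (at t)"
proof -
  let ?K = "fun_supp (h k)" and ?V = "\<lambda>s x. (h k x * h k x) * flat 0 (c * z s x)"
  have K: "compact ?K" using h_test[of k] by (simp add: test_fun_def)
  have supp: "(LINT x|\<mu>. (h k x * h k x) * w x) = (LINT x:?K|\<mu>. (h k x * h k x) * w x)" for w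
    unfolding set_lebesgue_integral_def
    by (intro Bochner_Integration.integral_cong refl) (auto simp: not_in_fun_supp split: split_indicator)
  have V: "time_smooth ?V"
    by (intro time_smooth_mult time_smooth_const test_fun_smooth h_test
        time_smooth_compose[OF smooth_on_flat_cmult time_smooth_z])
  have dV: "dt ?V t x = (h k x * h k x) * (c * flat 2 (c * z t x) * dt z t x)" for x
    unfolding dt_def[of ?V]
  proof (intro DERIV_imp_deriv DERIV_cmult)
    show "((\<lambda>s. flat 0 (c * z s x)) has_real_derivative c * flat 2 (c * z t x) * dt z t x) (at t)"
      using DERIV_chain2[OF flat_derivatives(1) DERIV_cmult[OF time_smooth_has_derivative[OF time_smooth_z t]]]
      by (simp add: mult_ac)
  qed
  show ?thesis
    using has_derivative_time_integral[OF V K t] unfolding energy_def[abs_def] supp dV .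
qed

lemma energy_derivative_le:
  assumes t: "0 < t" "t < T" and e: "0 < e" "\<And>x. Gam L (h k) (h k) x \<le> e"
  shows "(LINT x|\<mu>. (h k x * h k x) * (c * flat 2 (c * z t x) * dt z t x)) \<le> e * (4 * c\<^sup>2 * (LINT x|\<mu>. (g x)\<^sup>2))"
proof -
  have g2: "g \<in> L2_fun \<mu>" "P t g \<in> L2_fun \<mu>" using test_fun_L2[OF g] P_L2 t by auto
  have "(LINT x|\<mu>. (h k x * h k x) * (c * flat 2 (c * z t x) * dt z t x)) \<le> e * (4 * c\<^sup>2 * (LINT x|\<mu>. (P t g x)\<^sup>2))"
    by (rule energy_estimate[OF h_test smooth_fun_z[OF t(1)] time_smooth_slice[OF time_smooth_dt[OF time_smooth_z] t(1)]
          z_subsolution[OF t] c(1) c_z_le[OF t] g2(2) z_le_P[OF t] e(2)])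
  \<comment> \<open>Contractivity makes the bound independent of time.\<close>
  also have "(LINT x|\<mu>. (P t g x)\<^sup>2) \<le> (LINT x|\<mu>. (g x)\<^sup>2)"
    using P_contraction[OF less_imp_le[OF t(1)] g2(1)] by (simp add: L2_dist_def)
  finally show ?thesis using e(1) c by (simp add: mult_left_mono)
qed

text \<open>The initial condition bounds z by (\<open>P t g\<close> - g) + B t. The first summand is
  small in L2 and the second is small on the compact support of \<open>h k\<close>; together they
  replace continuity of z at time 0.\<close>

lemma energy_initial:
  assumes H: "1 \<le> H" "\<And>x. \<bar>h k x\<bar> \<le> H" and t: "0 < t" "t < T"
  shows "energy k t \<le> H\<^sup>2 * (4 * c\<^sup>2 * (L2_dist \<mu> (P t g) g)\<^sup>2 + 4 * c\<^sup>2 * B\<^sup>2 * t\<^sup>2 * measure \<mu> (fun_supp (h k)))"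
proof -
  let ?K = "fun_supp (h k)" and ?D = "\<lambda>x. P t g x - g x"
  let ?R = "\<lambda>x. 4 * c\<^sup>2 * (?D x)\<^sup>2 + 4 * c\<^sup>2 * B\<^sup>2 * t\<^sup>2 * indicator ?K x"
  have K: "compact ?K" using h_test[of k] by (simp add: test_fun_def)
  have i1: "integrable \<mu> (\<lambda>x. (?D x)\<^sup>2)"
    using L2_fun_diff[OF P_L2 test_fun_L2[OF g], of t g] test_fun_L2[OF g] t by (simp add: L2_fun_def)
  have i2: "integrable \<mu> (indicator ?K :: 'a \<Rightarrow> real)"
    using emeasure_compact_finite[OF K] by (simp add: fun_supp_closed)
  have "energy k t \<le> (LINT x|\<mu>. H\<^sup>2 * ?R x)"
    unfolding energy_def
  proof (intro integral_mono)
    show "integrable \<mu> (\<lambda>x. (h k x * h k x) * flat 0 (c * z t x))"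
      by (intro integrable_test_fun test_fun_mult[OF test_fun_h2]
          smooth_fun_compose[OF smooth_on_flat_cmult smooth_fun_z] t)
    show "integrable \<mu> (\<lambda>x. H\<^sup>2 * ?R x)" using i1 i2 by simp
    fix x
    have hH: "h k x * h k x \<le> H\<^sup>2"
      using H(2)[of x] H(1) by (metis abs_le_square_iff abs_of_nonneg order_trans power2_eq_square zero_le_one)
    show "(h k x * h k x) * flat 0 (c * z t x) \<le> H\<^sup>2 * ?R x"
    proof (cases "x \<in> ?K \<and> 0 < z t x")
      case True
      have "(z t x)\<^sup>2 \<le> (?D x + B * t)\<^sup>2"
        using True init[OF t, of x] by (intro power_mono) auto
      also have "\<dots> \<le> 2 * (?D x)\<^sup>2 + 2 * (B * t)\<^sup>2"
        using zero_le_power2[of "?D x - B * t"] by (simp add: power2_eq_square algebra_simps)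
      finally have "2 * c\<^sup>2 * (z t x)\<^sup>2 \<le> 2 * c\<^sup>2 * (2 * (?D x)\<^sup>2 + 2 * (B * t)\<^sup>2)"
        by (intro mult_left_mono) auto
      also have "\<dots> = ?R x" using True by (simp add: power_mult_distrib algebra_simps)
      finally have "flat 0 (c * z t x) \<le> ?R x"
        using flat_le[of 0 "c * z t x"] unfolding power_mult_distrib by simp
      then show ?thesis using hH flat_nonneg[of 0 "c * z t x"] by (intro mult_mono) auto
    next
      case False
      have "(h k x * h k x) * flat 0 (c * z t x) = 0"
      proof (cases "x \<in> ?K")
        case True
        then have "c * z t x \<le> 0" using False c by (simp add: mult_le_0_iff)
        then show ?thesis by (simp add: flat_def)
      qed (simp add: not_in_fun_supp)
      then show ?thesis by (auto intro!: mult_nonneg_nonneg add_nonneg_nonneg)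
    qed
  qed
  also have "\<dots> = H\<^sup>2 * (4 * c\<^sup>2 * (LINT x|\<mu>. (?D x)\<^sup>2) + 4 * c\<^sup>2 * B\<^sup>2 * t\<^sup>2 * measure \<mu> ?K)"
    using i1 i2 by simp
  finally show ?thesis
    by (simp add: L2_dist_def integral_nonneg_AE)
qed

text \<open>The derivative bound is integrated from s to t, and s then tends to 0 with k fixed. In
  this order the measure of the support of \<open>h k\<close>, which may grow with k, disappears
  before k is sent to infinity.\<close>

lemma energy_le:
  assumes t: "0 < t" "t < T" and e: "0 < e" "\<And>x. Gam L (h k) (h k) x \<le> e"
  shows "energy k t \<le> e * (4 * c\<^sup>2 * (LINT x|\<mu>. (g x)\<^sup>2)) * t"
proof -
  obtain H where H: "1 \<le> H" "\<And>k x. \<bar>h k x\<bar> \<le> H" by (rule h_bounded) (rule that; assumption)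
  define C where "C = e * (4 * c\<^sup>2 * (LINT x|\<mu>. (g x)\<^sup>2))"
  define R where "R s = H\<^sup>2 * (4 * c\<^sup>2 * (L2_dist \<mu> (P s g) g)\<^sup>2 + 4 * c\<^sup>2 * B\<^sup>2 * s\<^sup>2 * measure \<mu> (fun_supp (h k)))" for s
  have le: "energy k t \<le> C * (t - s) + R s" if s: "0 < s" "s < t" for s
  proof -
    have "C * s - energy k s \<le> C * t - energy k t"
    proof (rule DERIV_nonneg_imp_nondecreasing[of s t "\<lambda>r. C * r - energy k r"])
      fix r assume r: "s \<le> r" "r \<le> t"
      then have r': "0 < r" "r < T" using s t by auto
      show "\<exists>y. ((\<lambda>r. C * r - energy k r) has_real_derivative y) (at r) \<and> 0 \<le> y"
        using DERIV_diff[OF DERIV_cmult_Id energy_has_derivative[OF r'(1)], of C]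
          energy_derivative_le[OF r' e] unfolding C_def by fastforce
    qed (use s in simp)
    moreover have "energy k s \<le> R s"
      unfolding R_def using s t by (intro energy_initial H) auto
    ultimately show ?thesis by (simp add: algebra_simps)
  qed
  have "((\<lambda>s. C * (t - s) + R s) \<longlongrightarrow> C * (t - 0) + H\<^sup>2 * (4 * c\<^sup>2 * 0\<^sup>2 + 4 * c\<^sup>2 * B\<^sup>2 * 0\<^sup>2 * measure \<mu> (fun_supp (h k)))) (at_right 0)"
    unfolding R_def by (intro tendsto_intros P_continuous test_fun_L2 g)
  moreover have "\<forall>\<^sub>F s in at_right 0. energy k t \<le> C * (t - s) + R s"
    using eventually_at_right_real[OF t(1)] by eventually_elim (use le in auto)
  ultimately have "energy k t \<le> C * (t - 0) + H\<^sup>2 * (4 * c\<^sup>2 * 0\<^sup>2 + 4 * c\<^sup>2 * B\<^sup>2 * 0\<^sup>2 * measure \<mu> (fun_supp (h k)))"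
    by (rule tendsto_lowerbound) simp
  then show ?thesis by (simp add: C_def)
qed

lemma energy_nonneg: "0 \<le> energy k t"
  unfolding energy_def by (intro integral_nonneg_AE AE_I2) (simp add: flat_nonneg)

lemma energy_tendsto_0:
  assumes t: "0 < t" "t < T" shows "(\<lambda>k. energy k t) \<longlonglongrightarrow> 0"
proof (rule tendstoI)
  fix e :: real assume e: "0 < e"
  define C where "C = 4 * c\<^sup>2 * (LINT x|\<mu>. (g x)\<^sup>2)"
  have "0 \<le> C * t" using t unfolding C_def by (intro mult_nonneg_nonneg integral_nonneg_AE) auto
  then have Ct: "0 < C * t + 1" by simp
  define e' where "e' = e / (C * t + 1)"
  have e': "0 < e'" using e Ct by (simp add: e'_def)
  have lt: "e' * C * t < e"
    using e Ct by (simp add: e'_def field_simps)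
  show "\<forall>\<^sub>F k in sequentially. dist (energy k t) 0 < e"
    using eventually_Gam_h_le[OF e']
  proof eventually_elim
    case (elim k)
    have "energy k t \<le> e' * C * t"
      unfolding C_def by (rule energy_le[OF t e']) (use elim in blast)
    then show ?case using lt energy_nonneg[of k t] by (simp add: dist_real_def)
  qed
qed

text \<open>As \<open>h k\<close> tends to 1, vanishing of the limiting energy forces the integral
  of \<open>flat 0 (c * z)\<close> against a bump to vanish. Continuity makes this pointwise, and
  \<open>flat 0\<close> is positive at positive arguments.\<close>

lemma z_nonpos:
  assumes t: "0 < t" "t < T" shows "z t x \<le> 0"
proof -
  obtain H where H: "1 \<le> H" "\<And>k x. \<bar>h k x\<bar> \<le> H" by (rule h_bounded) (rule that; assumption)
  obtain \<theta> N where \<theta>: "test_fun A \<theta>" "\<And>y. 0 \<le> \<theta> y" "\<And>y. y \<notin> UNIV \<Longrightarrow> \<theta> y = 0"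
    "open N" "x \<in> N" "\<And>y. y \<in> N \<Longrightarrow> \<theta> y = 1"
    by (rule bump_at[OF open_UNIV UNIV_I, of x]) (rule that; assumption)
  obtain M where M: "0 < M" "\<And>x. \<bar>\<theta> x\<bar> \<le> M" by (rule test_fun_bounded[OF \<theta>(1)]) (rule that; assumption)
  let ?w = "\<lambda>x. flat 0 (c * z t x)" and ?h = "\<lambda>k x. h k x * h k x"
  have ws: "smooth_fun A ?w" using smooth_fun_compose[OF smooth_on_flat_cmult smooth_fun_z[OF t(1)]] .
  have tw: "test_fun A (\<lambda>x. \<theta> x * ?w x)" by (intro test_fun_mult \<theta> ws)
  note [measurable] = borel_measurable_smooth[OF test_fun_smooth[OF h_test]] borel_measurable_smooth[OF test_fun_smooth[OF tw]]
  have 1: "(\<lambda>k. LINT x|\<mu>. ?h k x * (\<theta> x * ?w x)) \<longlonglongrightarrow> (LINT x|\<mu>. \<theta> x * ?w x)"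
  proof (rule integral_dominated_convergence[where w="\<lambda>x. H\<^sup>2 * (\<theta> x * ?w x)"])
    show "integrable \<mu> (\<lambda>x. H\<^sup>2 * (\<theta> x * ?w x))" using integrable_test_fun[OF tw] by simp
    show "AE x in \<mu>. (\<lambda>k. ?h k x * (\<theta> x * ?w x)) \<longlonglongrightarrow> \<theta> x * ?w x"
      using tendsto_mult_right[OF tendsto_mult[OF h_lim h_lim]] by (intro AE_I2) fastforce
    show "AE x in \<mu>. norm (?h k x * (\<theta> x * ?w x)) \<le> H\<^sup>2 * (\<theta> x * ?w x)" for k
    proof (intro AE_I2)
      fix x
      have "\<bar>h k x\<bar> * \<bar>h k x\<bar> \<le> H * H" using H(2)[of k x] H(1) by (intro mult_mono) auto
      then show "norm (?h k x * (\<theta> x * ?w x)) \<le> H\<^sup>2 * (\<theta> x * ?w x)"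
        using \<theta>(2)[of x] flat_nonneg[of 0 "c * z t x"]
        by (simp add: abs_mult power2_eq_square mult_right_mono)
    qed
  qed measurable
  have 2: "(\<lambda>k. LINT x|\<mu>. ?h k x * (\<theta> x * ?w x)) \<longlonglongrightarrow> 0"
  proof (rule tendsto_sandwich[OF _ _ tendsto_const])
    show "(\<lambda>k. M * energy k t) \<longlonglongrightarrow> 0" using tendsto_mult_right_zero[OF energy_tendsto_0[OF t]] by simp
    show "\<forall>\<^sub>F k in sequentially. 0 \<le> (LINT x|\<mu>. ?h k x * (\<theta> x * ?w x))"
      using \<theta>(2) by (intro always_eventually allI integral_nonneg_AE AE_I2) (simp add: flat_nonneg)
    have "(LINT x|\<mu>. ?h k x * (\<theta> x * ?w x)) \<le> (LINT x|\<mu>. M * (?h k x * ?w x))" for k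
    proof (intro integral_mono)
      show "integrable \<mu> (\<lambda>x. ?h k x * (\<theta> x * ?w x))"
        by (intro integrable_test_fun test_fun_mult[OF test_fun_h2] test_fun_smooth tw)
      show "integrable \<mu> (\<lambda>x. M * (?h k x * ?w x))"
        by (intro integrable_mult_right integrable_test_fun test_fun_mult[OF test_fun_h2] ws)
      fix x
      have "\<theta> x * (?h k x * ?w x) \<le> M * (?h k x * ?w x)"
        using M(2)[of x] flat_nonneg[of 0 "c * z t x"] by (intro mult_right_mono) auto
      then show "?h k x * (\<theta> x * ?w x) \<le> M * (?h k x * ?w x)" by (simp add: mult_ac)
    qed
    then show "\<forall>\<^sub>F k in sequentially. (LINT x|\<mu>. ?h k x * (\<theta> x * ?w x)) \<le> M * energy k t"
      by (simp add: energy_def)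
  qed
  have "(LINT x|\<mu>. \<theta> x * ?w x) = 0" by (rule LIMSEQ_unique[OF 1 2])
  then have ae: "AE x in \<mu>. \<theta> x * ?w x = 0"
    using integral_nonneg_eq_0_iff_AE[OF integrable_test_fun[OF tw]] \<theta>(2) flat_nonneg by simp
  have op: "open {x. \<not> \<theta> x * ?w x = 0}"
    by (intro open_Collect_neq smooth_fun_continuous test_fun_smooth tw continuous_on_const)
  have "?w x = 0" using AE_open_imp_all[OF ae op, of x] \<theta>(5,6) by simp
  then have "\<not> 0 < c * z t x" using flat_pos[of "c * z t x" 0] by fastforce
  then show ?thesis using c by (simp add: zero_less_mult_iff)
qed

end

theorem maximum_principle:
  assumes g: "test_fun A g" and v: "time_smooth v"
    and sub: "\<And>t x. 0 < t \<Longrightarrow> t < T \<Longrightarrow> dt v t x \<le> L (v t) x"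
    and neg: "\<And>t x. 0 < t \<Longrightarrow> t < T \<Longrightarrow> v t x \<le> 0"
    and init: "\<And>t x. 0 < t \<Longrightarrow> t < T \<Longrightarrow> v t x \<le> B * t - g x"
    and t: "0 < t" "t < T"
  shows "v t x + P t g x \<le> 0"
proof -
  obtain N where N: "0 < N" "\<And>x. \<bar>g x\<bar> \<le> N" by (rule test_fun_bounded[OF g]) (rule that; assumption)
  \<comment> \<open>With c = 1 / (4 N) the bound 1 / (4 c) required of g is N.\<close>
  show ?thesis
    by (rule z_nonpos[OF g v sub neg init, where c="1 / (4 * N)"]) (use N t in auto)
qed

end

section \<open>Gradient bounds and the Liouville theorem\<close>

context complete_heat_diffusion
begin

text \<open>f - M is stationary and nonpositive, and it lies below - \<open>h k\<close> (M - f)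
  because \<open>h k\<close> \<le> 1. As k tends to infinity the comparison becomes f - M + P t (M -
  f) \<le> 0, and conservativeness cancels M.\<close>

lemma bounded_harmonic_le_P:
  assumes f: "smooth_fun A f" and harm: "\<And>x. L f x = 0" and M: "\<And>x. \<bar>f x\<bar> \<le> M" and t: "0 < t"
  shows "f x \<le> P t f x"
proof -
  have fm: "f \<in> borel_measurable \<mu>" by (rule borel_measurable_smooth[OF f])
  have Mf: "smooth_fun A (\<lambda>x. M - f x)" by (intro smooth_fun_diff smooth_fun_const f)
  have fM: "smooth_fun A (\<lambda>x. f x - M)" by (intro smooth_fun_diff smooth_fun_const f)
  have "f x - M + P t (\<lambda>x. h k x * (M - f x)) x \<le> 0" for k
  proof (rule maximum_principle[where v="\<lambda>_ x. f x - M" and T="t + 1" and B=0])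
    show "test_fun A (\<lambda>x. h k x * (M - f x))" by (intro test_fun_mult h_test Mf)
    show "time_smooth (\<lambda>_ x. f x - M)" by (rule time_smooth_const[OF fM])
    fix s x
    have "L (\<lambda>x. 1 * f x + (- M) * 1) x = 1 * L f x + (- M) * L (\<lambda>_. 1) x"
      by (rule L_linear[OF f smooth_fun_const])
    then show "dt (\<lambda>_ x. f x - M) s x \<le> L (\<lambda>x. f x - M) x"
      using harm L_one by (simp add: dt_def)
    show "f x - M \<le> 0" using M[of x] by simp
    have "0 \<le> (1 - h k x) * (M - f x)" using M[of x] h_le_1[of k x] by (intro mult_nonneg_nonneg) auto
    then show "f x - M \<le> 0 * s - h k x * (M - f x)" by (simp add: algebra_simps)
  qed (use t in auto)
  moreover have "(\<lambda>k. f x - M + P t (\<lambda>x. h k x * (M - f x)) x) \<longlonglongrightarrow> f x - M + P t (\<lambda>x. M - f x) x"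
  proof (intro tendsto_intros P_h_tendsto[OF t borel_measurable_smooth[OF Mf], where M="2 * M"])
    show "\<bar>M - f x\<bar> \<le> 2 * M" for x using M[of x] by simp
  qed
  ultimately have "f x - M + P t (\<lambda>x. M - f x) x \<le> 0"
    by (intro LIMSEQ_le_const2) auto
  moreover have "P t (\<lambda>x. M - f x) x = M - P t f x"
    using integrable_kernel[OF t, of x] integral_kernel[OF t, of x] integrable_kernel_mult[OF t fm M, of x]
    by (simp add: P_pos[OF t] right_diff_distrib)
  ultimately show ?thesis by simp
qed

lemma bounded_harmonic_P:
  assumes f: "smooth_fun A f" and harm: "\<And>x. L f x = 0" and M: "\<And>x. \<bar>f x\<bar> \<le> M" and t: "0 < t"
  shows "P t f x = f x"
proof (rule antisym)
  \<comment> \<open>The same bound for the harmonic function - f gives the reverse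
    inequality.\<close>
  have "- 1 * f x \<le> P t (\<lambda>x. - 1 * f x) x"
    using harm M by (intro bounded_harmonic_le_P[where M=M] smooth_fun_mult smooth_fun_const f t)
      (simp_all only: L_cmult[OF f], simp_all)
  then show "P t f x \<le> f x" by (simp add: P_pos[OF t])
qed (rule bounded_harmonic_le_P[OF assms])

end

section \<open>Gradient bounds from the curvature-dimension inequality\<close>

locale curvature_dimension = complete_heat_diffusion A \<mu> L p h
  for A :: "('a::{t2_space,second_countable_topology}, 'e::euclidean_space) chart set" and \<mu> L p h +
  fixes GZ :: "('a \<Rightarrow> real) \<Rightarrow> ('a \<Rightarrow> real) \<Rightarrow> 'a \<Rightarrow> real" and \<rho>1 \<rho>2 \<kappa> d :: real
  assumes GZ_form: "first_order_form A GZ"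
    and GZ_nonneg: "\<And>f x. smooth_fun A f \<Longrightarrow> 0 \<le> GZ f f x"
    and d_const: "0 \<le> \<rho>1" "0 < \<rho>2" "0 \<le> \<kappa>" "0 < d"
    and d_ineq: "\<And>f \<nu> x. smooth_fun A f \<Longrightarrow> 0 < \<nu> \<Longrightarrow>
      Gam2 L f x + \<nu> * Gam2Z L GZ f x
        \<ge> 1 / d * (L f x)\<^sup>2 + (\<rho>1 - \<kappa> / \<nu>) * Gam L f f x + \<rho>2 * GZ f f x"
begin

text \<open>The first summand pays for the time derivative of the weight t / \<rho>2, the second for
  \<kappa> / \<nu> at \<nu> = t \<rho>2 after multiplication by 2 t / \<rho>2.\<close>

definition K :: real where "K = 1 / \<rho>2 + 2 * \<kappa> / \<rho>2\<^sup>2"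

definition G :: "(real \<Rightarrow> 'a \<Rightarrow> real) \<Rightarrow> real \<Rightarrow> 'a \<Rightarrow> real" where
  "G u t x = t / \<rho>2 * Gam L (u t) (u t) x + t\<^sup>2 * GZ (u t) (u t) x + K / 2 * (u t x * u t x)"

lemma K_nonneg: "0 \<le> K" using d_const by (simp add: K_def)

lemma time_smooth_G: assumes "time_smooth u" shows "time_smooth (G u)"
proof -
  have "smooth_on UNIV (\<lambda>t. t / \<rho>2)" "smooth_on UNIV (\<lambda>t::real. t\<^sup>2)"
    using smooth_on_mult[OF smooth_on_const[of UNIV "1 / \<rho>2"] smooth_on_ident]
      smooth_on_mult[OF smooth_on_ident smooth_on_ident] by (simp_all add: power2_eq_square)
  then show ?thesis
    unfolding G_def[abs_def]
    by (intro time_smooth_add time_smooth_mult time_smooth_time time_smooth_Gam time_smooth_GZ[OF GZ_form]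
        time_smooth_const smooth_fun_const assms)
qed

text \<open>The choice \<open>\<nu> = t * \<rho>2\<close> makes the terms in \<open>GZ\<close> cancel, and \<open>K\<close> is the constant that
  absorbs those in \<open>Gam\<close>.\<close>

lemma G_subsolution:
  assumes u: "time_smooth u" and heat: "\<And>t. 0 < t \<Longrightarrow> dt u t = L (u t)" and t: "0 < t"
  shows "dt (G u) t x \<le> L (G u t) x"
proof -
  let ?u = "u t"
  have s: "smooth_fun A ?u" "smooth_fun A (L ?u)" using time_smooth_slice[OF u t] smooth_fun_L by auto
  note GG = smooth_fun_Gam[OF s(1,1)] and ZZ = GZ_smooth[OF GZ_form s(1,1)] and uu = smooth_fun_mult[OF s(1,1)]
  define a b where "a = Gam L ?u ?u x" and "b = GZ ?u ?u x"
  define a' b' where "a' = Gam L ?u (L ?u) x" and "b' = GZ ?u (L ?u) x"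
  define La Lb where "La = L (Gam L ?u ?u) x" and "Lb = L (GZ ?u ?u) x"
  have D1: "((\<lambda>t. Gam L (u t) (u t) x) has_real_derivative 2 * a') (at t)"
    using has_derivative_Gam[OF u t, of x] heat[OF t] by (simp add: a'_def)
  have D2: "((\<lambda>t. GZ (u t) (u t) x) has_real_derivative 2 * b') (at t)"
    using has_derivative_GZ[OF GZ_form u u t, of x] heat[OF t] GZ_sym[OF GZ_form s(2,1)] by (simp add: b'_def)
  have D3: "((\<lambda>t. u t x) has_real_derivative L ?u x) (at t)"
    using time_smooth_has_derivative[OF u t, of x] heat[OF t] by simp
  have D4: "((\<lambda>t. t / \<rho>2) has_real_derivative 1 / \<rho>2) (at t)" "((\<lambda>t. t\<^sup>2) has_real_derivative 2 * t) (at t)"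
    by (rule DERIV_cdivide[OF DERIV_ident]) (auto intro!: derivative_eq_intros)
  have "((\<lambda>t. G u t x) has_real_derivative
      (1 / \<rho>2 * a + t / \<rho>2 * (2 * a')) + (2 * t * b + t\<^sup>2 * (2 * b')) + K / 2 * (2 * ?u x * L ?u x)) (at t)"
    unfolding G_def
    by (rule DERIV_cong[OF DERIV_add[OF DERIV_add[OF DERIV_mult'[OF D4(1) D1] DERIV_mult'[OF D4(2) D2]]
          DERIV_cmult[OF DERIV_mult'[OF D3 D3]]]]) (simp add: a_def b_def algebra_simps)
  then have dG: "dt (G u) t x =
      (1 / \<rho>2 * a + t / \<rho>2 * (2 * a')) + (2 * t * b + t\<^sup>2 * (2 * b')) + K / 2 * (2 * ?u x * L ?u x)"
    unfolding dt_def by (rule DERIV_imp_deriv)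
  have "L (G u t) x = L (\<lambda>x. t / \<rho>2 * Gam L ?u ?u x + 1 * (t\<^sup>2 * GZ ?u ?u x + K / 2 * (?u x * ?u x))) x"
    by (rule arg_cong[where f="\<lambda>f. L f x"]) (simp add: G_def fun_eq_iff)
  also have "\<dots> = t / \<rho>2 * La + 1 * L (\<lambda>x. t\<^sup>2 * GZ ?u ?u x + K / 2 * (?u x * ?u x)) x"
    unfolding La_def by (intro L_linear GG smooth_fun_add smooth_fun_mult smooth_fun_const ZZ uu s)
  also have "L (\<lambda>x. t\<^sup>2 * GZ ?u ?u x + K / 2 * (?u x * ?u x)) x = t\<^sup>2 * Lb + K / 2 * L (\<lambda>x. ?u x * ?u x) x"
    unfolding Lb_def by (intro L_linear ZZ uu)
  \<comment> \<open>The definition of \<open>Gam\<close> solved for \<open>L\<close> of the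
    square.\<close>
  also have "L (\<lambda>x. ?u x * ?u x) x = 2 * ?u x * L ?u x + 2 * a"
    unfolding a_def Gam_def by (simp add: field_simps)
  finally have LG: "L (G u t) x = t / \<rho>2 * La + 1 * (t\<^sup>2 * Lb + K / 2 * (2 * ?u x * L ?u x + 2 * a))" .
  have a0: "0 \<le> a" unfolding a_def by (rule Gam_nonneg[OF s(1)])
  have "(\<rho>1 - \<kappa> / (t * \<rho>2)) * a + \<rho>2 * b + 1 / d * (L ?u x)\<^sup>2
      \<le> 1/2 * (La - 2 * a') + t * \<rho>2 * (1/2 * (Lb - 2 * b'))"
    using d_ineq[OF s(1), of "t * \<rho>2" x] t d_const
    by (simp add: Gam2_def Gam2Z_def a_def b_def a'_def b'_def La_def Lb_def)
  moreover have "0 \<le> \<rho>1 * a" "0 \<le> 1 / d * (L ?u x)\<^sup>2" using a0 d_const by auto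
  ultimately have "- (\<kappa> / (t * \<rho>2)) * a + \<rho>2 * b \<le> 1/2 * (La - 2 * a') + t * \<rho>2 * (1/2 * (Lb - 2 * b'))"
    by (simp add: left_diff_distrib)
  \<comment> \<open>This factor turns the combination of \<open>Gam2\<close> and \<nu>
    \<open>Gam2Z\<close> with \<nu> = t \<rho>2 into the contribution of the two gradient terms of
    \<open>G\<close> to L G - dt G, apart from the derivatives of their weights.\<close>
  then have "2 * t / \<rho>2 * (- (\<kappa> / (t * \<rho>2)) * a + \<rho>2 * b)
      \<le> 2 * t / \<rho>2 * (1/2 * (La - 2 * a') + t * \<rho>2 * (1/2 * (Lb - 2 * b')))"
    using t d_const by (intro mult_left_mono) auto
  moreover have "2 * t / \<rho>2 * (- (\<kappa> / (t * \<rho>2)) * a + \<rho>2 * b) = - (2 * \<kappa> / \<rho>2\<^sup>2) * a + 2 * t * b"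
    using t d_const by (simp add: field_simps power2_eq_square)
  moreover have "2 * t / \<rho>2 * (1/2 * (La - 2 * a') + t * \<rho>2 * (1/2 * (Lb - 2 * b')))
      = t / \<rho>2 * (La - 2 * a') + t\<^sup>2 * (Lb - 2 * b')"
    using t d_const by (simp add: field_simps power2_eq_square)
  ultimately have "- (2 * \<kappa> / \<rho>2\<^sup>2) * a + 2 * t * b \<le> t / \<rho>2 * (La - 2 * a') + t\<^sup>2 * (Lb - 2 * b')"
    by simp
  moreover have "K * a = 1 / \<rho>2 * a + 2 * \<kappa> / \<rho>2\<^sup>2 * a" by (simp add: K_def distrib_right)
  ultimately show ?thesis
    unfolding dG LG by (simp add: algebra_simps)
qed

text \<open>The a priori gradient bounds may depend on g and T, and they only show that
  \<open>G\<close> is bounded on a time interval and starts from at most K / 2 M^2, with a linear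
  error in time. The maximum principle then removes them: the excess B' is cancelled by P t (h k B')
  in the limit, by conservativeness, and the final bound depends on M alone.\<close>

lemma reverse_Poincare:
  assumes g: "test_fun A g" and M: "\<And>x. \<bar>g x\<bar> \<le> M"
    and bound: "\<And>T. 0 \<le> T \<Longrightarrow> (SUP t\<in>{0..T}. sup_norm (Gam L (P t g) (P t g)) + sup_norm (GZ (P t g) (P t g))) < \<infinity>"
    and t: "0 < t"
  shows "t / \<rho>2 * Gam L (P t g) (P t g) x \<le> K / 2 * M\<^sup>2"
proof -
  let ?u = "\<lambda>t. P t g"
  \<comment> \<open>The maximum principle concerns times strictly before T, so T must exceed
    t.\<close>
  define T where "T = t + 1"
  have T: "0 < T" "t < T" using t by (auto simp: T_def)
  define S where "S = (SUP t\<in>{0..T}. sup_norm (Gam L (P t g) (P t g)) + sup_norm (GZ (P t g) (P t g)))"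
  have S: "S < \<infinity>" unfolding S_def using bound T by simp
  define B0 where "B0 = enn2real S"
  have B0: "0 \<le> B0" by (simp add: B0_def)
  have le: "Gam L (P s g) (P s g) y \<le> B0" "GZ (P s g) (P s g) y \<le> B0" if s: "0 < s" "s < T" for s y
  proof -
    have "ennreal r \<le> S \<Longrightarrow> r \<le> B0" for r
      using S unfolding B0_def by (metis B0_def B0 enn2real_le enn2real_leI ennreal_enn2real ennreal_le_iff infinity_ennreal_def)
    moreover have "sup_norm (Gam L (P s g) (P s g)) + sup_norm (GZ (P s g) (P s g)) \<le> S"
      unfolding S_def using s by (intro SUP_upper) auto
    moreover have "ennreal (f y) \<le> sup_norm f" for f :: "'a \<Rightarrow> real"
      unfolding sup_norm_def by (rule SUP_upper2[of y]) (auto intro: ennreal_leI)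
    ultimately show "Gam L (P s g) (P s g) y \<le> B0" "GZ (P s g) (P s g) y \<le> B0"
      by (meson add_increasing add_increasing2 order_trans zero_le)+
  qed
  \<comment> \<open>Both gradient terms are linear in s up to time T, because s^2 \<le> T s.\<close>
  define B where "B = B0 / \<rho>2 + T * B0"
  have B: "0 \<le> B" using B0 d_const T by (simp add: B_def)
  define B' where "B' = B * T"
  have B': "0 \<le> B'" using B T by (simp add: B'_def)
  have u: "time_smooth ?u" by (rule time_smooth_P[OF g])
  have M0: "0 \<le> M" using M[of x] by simp
  have G_le: "G ?u s y \<le> B * s + K / 2 * M\<^sup>2" if s: "0 < s" "s < T" for s y
  proof -
    have "s / \<rho>2 * Gam L (P s g) (P s g) y \<le> s / \<rho>2 * B0"
      using le[OF s] s d_const by (intro mult_left_mono) auto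
    moreover have "s\<^sup>2 * GZ (P s g) (P s g) y \<le> s\<^sup>2 * B0"
      using le[OF s] by (intro mult_left_mono) auto
    moreover have "s\<^sup>2 * B0 \<le> (T * s) * B0"
      using s B0 by (intro mult_right_mono) (auto simp: power2_eq_square)
    moreover have "P s g y * P s g y \<le> M\<^sup>2"
      using P_bounded[OF s(1) borel_measurable_smooth[OF test_fun_smooth[OF g]] M, of y] M0
      by (metis abs_le_square_iff abs_of_nonneg power2_eq_square)
    then have "K / 2 * (P s g y * P s g y) \<le> K / 2 * M\<^sup>2"
      using K_nonneg by (intro mult_left_mono) auto
    ultimately show ?thesis by (simp add: G_def B_def algebra_simps)
  qed
  \<comment> \<open>An upper bound for \<open>G\<close> on the whole interval, so that G - k0 is
    nonpositive; near time 0 it lies below - B' up to B s, which leaves room for the comparison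
    function h k B'.\<close>
  define k0 where "k0 = K / 2 * M\<^sup>2 + B'"
  have c: "smooth_fun A (\<lambda>_. k0)" by (rule smooth_fun_const)
  have "G ?u t x - k0 + P t (\<lambda>x. h k x * B') x \<le> 0" for k
  proof (rule maximum_principle[where v="\<lambda>t x. G ?u t x - k0" and T=T and B=B])
    show "test_fun A (\<lambda>x. h k x * B')" by (intro test_fun_mult h_test smooth_fun_const)
    show "time_smooth (\<lambda>t x. G ?u t x - k0)" by (intro time_smooth_diff time_smooth_G u time_smooth_const c)
    fix s y assume s: "0 < s" "s < T"
    have "dt (\<lambda>t x. G ?u t x - k0) s y = dt (G ?u) s y - 0"
      unfolding dt_def[of "\<lambda>t x. G ?u t x - k0"]
      by (intro DERIV_imp_deriv DERIV_diff DERIV_const time_smooth_has_derivative time_smooth_G u s)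
    also have "\<dots> \<le> L (G ?u s) y"
      using G_subsolution[OF u _ s(1)] heat_equation[OF g] by (simp add: fun_eq_iff)
    also have "\<dots> = L (\<lambda>x. 1 * G ?u s x + (- k0) * 1) y"
      using L_linear[OF time_smooth_slice[OF time_smooth_G[OF u] s(1)] smooth_fun_const[of 1], of 1 "- k0" y] L_one by simp
    finally show "dt (\<lambda>t x. G ?u t x - k0) s y \<le> L (\<lambda>x. G ?u s x - k0) y" by simp
    have "B * s \<le> B'" using s B by (simp add: B'_def mult_left_mono)
    then show "G ?u s y - k0 \<le> 0" using G_le[OF s, of y] by (simp add: k0_def)
    have "h k y * B' \<le> B'" using mult_right_mono[OF h_le_1 B', of k y] by simp
    then show "G ?u s y - k0 \<le> B * s - h k y * B'" using G_le[OF s, of y] by (simp add: k0_def)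
  qed (use t T in auto)
  moreover have "(\<lambda>k. G ?u t x - k0 + P t (\<lambda>x. h k x * B') x) \<longlonglongrightarrow> G ?u t x - k0 + P t (\<lambda>_. B') x"
    by (intro tendsto_intros P_h_tendsto[OF t, where M=B']) (use B' in auto)
  ultimately have "G ?u t x - k0 + P t (\<lambda>_. B') x \<le> 0"
    by (intro LIMSEQ_le_const2) auto
  moreover have "P t (\<lambda>_. B') x = B'"
    using integral_kernel[OF t, of x] by (simp add: P_pos[OF t])
  ultimately have "G ?u t x \<le> K / 2 * M\<^sup>2" by (simp add: k0_def)
  moreover have "0 \<le> t\<^sup>2 * GZ (P t g) (P t g) x" using GZ_nonneg[OF smooth_fun_P[OF g t]] by simp
  moreover have "0 \<le> K / 2 * (P t g x * P t g x)" using K_nonneg by simp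
  ultimately show ?thesis by (simp add: G_def)
qed

text \<open>The distance is by definition a supremum over such functions, but
  \<open>enn2real\<close> sends an infinite supremum to 0. A metric is nonzero at distinct points,
  which makes the supremum finite there.\<close>

lemma abs_diff_le_carnot_dist:
  assumes metric: "Metric_space UNIV (carnot_dist A L)"
    and q: "smooth_fun A q" "\<And>x. Gam L q q x \<le> 1"
  shows "\<bar>q x - q y\<bar> \<le> carnot_dist A L x y"
proof (cases "x = y")
  case False
  let ?S = "SUP f\<in>{f. smooth_fun A f \<and> sup_norm (Gam L f f) \<le> 1}. ennreal \<bar>f x - f y\<bar>"
  have "carnot_dist A L x y \<noteq> 0" using Metric_space.zero[OF metric, of x y] False by simp
  then have fin: "?S \<noteq> \<infinity>"
    unfolding carnot_dist_def by (metis enn2real_top infinity_ennreal_def)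
  have "sup_norm (Gam L q q) \<le> 1"
    unfolding sup_norm_def using q(2) Gam_nonneg[OF q(1)] by (intro SUP_least) (simp add: ennreal_le_1)
  then have "ennreal \<bar>q x - q y\<bar> \<le> ?S"
    using q(1) by (intro SUP_upper) auto
  moreover have "?S < top"
    using fin unfolding infinity_ennreal_def by (rule top.not_eq_extremum[THEN iffD1])
  ultimately have "enn2real (ennreal \<bar>q x - q y\<bar>) \<le> enn2real ?S" by (rule enn2real_mono)
  then show ?thesis
    unfolding carnot_dist_def by (simp only: enn2real_ennreal[OF abs_ge_zero])
qed (use Metric_space.nonneg[OF metric] in simp)

text \<open>Gradients are estimated for the test functions h k f only, uniformly in k. What passes
  to the limit is the resulting bound on differences of values, so the gradient of P t f is never
  considered. The time t is arbitrary because f = P t f.\<close>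

theorem Liouville:
  assumes metric: "Metric_space UNIV (carnot_dist A L)"
    and bound: "\<And>f T. test_fun A f \<Longrightarrow> 0 \<le> T \<Longrightarrow>
      (SUP t\<in>{0..T}. sup_norm (Gam L (P t f) (P t f)) + sup_norm (GZ (P t f) (P t f))) < \<infinity>"
    and f: "smooth_fun A f" and harm: "\<And>x. L f x = 0" and M: "\<And>x. \<bar>f x\<bar> \<le> M"
  shows "f x = f y"
proof -
  obtain H where H: "1 \<le> H" "\<And>k x. \<bar>h k x\<bar> \<le> H" by (rule h_bounded) (rule that; assumption)
  have M0: "0 \<le> M" using M[of x] by simp
  \<comment> \<open>H M bounds h k f for every k, so the reverse Poincare inequality bounds t
    \<Gamma>(P t (h k f)) by the first summand. The added 1 makes N positive, which allows division
    by sqrt (N / t).\<close>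
  define N where "N = \<rho>2 * (K / 2 * (H * M)\<^sup>2) + 1"
  have N: "0 < N" using d_const K_nonneg by (auto simp: N_def intro!: add_nonneg_pos mult_nonneg_nonneg)
  let ?D = "carnot_dist A L x y"
  have "\<bar>f x - f y\<bar> \<le> sqrt (N / t) * ?D" if t: "0 < t" for t
  proof -
    define c where "c = sqrt (N / t)"
    have c: "0 < c" "c\<^sup>2 = N / t" using N t by (simp_all add: c_def)
    have "\<bar>P t (\<lambda>x. h k x * f x) x - P t (\<lambda>x. h k x * f x) y\<bar> \<le> c * ?D" for k
    proof -
      let ?g = "\<lambda>x. h k x * f x"
      have g: "test_fun A ?g" by (intro test_fun_mult h_test f)
      have gM: "\<bar>?g x\<bar> \<le> H * M" for x
        unfolding abs_mult using H M M0 by (intro mult_mono) auto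
      have Gam_le: "Gam L (P t ?g) (P t ?g) x \<le> N / t" for x
      proof -
        have "t / \<rho>2 * Gam L (P t ?g) (P t ?g) x \<le> K / 2 * (H * M)\<^sup>2"
          by (rule reverse_Poincare[OF g gM bound[OF g] t])
        then have "t * Gam L (P t ?g) (P t ?g) x \<le> N"
          using d_const by (simp add: N_def field_simps)
        then show ?thesis using t by (simp add: field_simps)
      qed
      have Ps: "smooth_fun A (P t ?g)" by (rule smooth_fun_P[OF g t])
      have "\<bar>1 / c * P t ?g x - 1 / c * P t ?g y\<bar> \<le> ?D"
      proof (rule abs_diff_le_carnot_dist[OF metric])
        show "smooth_fun A (\<lambda>x. 1 / c * P t ?g x)" by (intro smooth_fun_mult smooth_fun_const Ps)
        show "Gam L (\<lambda>x. 1 / c * P t ?g x) (\<lambda>x. 1 / c * P t ?g x) x \<le> 1" for x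
          unfolding Gam_cmult[OF Ps] power_divide c(2) using Gam_le[of x] N t by (simp add: field_simps)
      qed
      then show ?thesis using c(1) by (simp add: field_simps flip: diff_divide_distrib)
    qed
    moreover have "(\<lambda>k. \<bar>P t (\<lambda>x. h k x * f x) x - P t (\<lambda>x. h k x * f x) y\<bar>) \<longlonglongrightarrow> \<bar>P t f x - P t f y\<bar>"
      by (intro tendsto_intros P_h_tendsto[OF t borel_measurable_smooth[OF f] M])
    ultimately have "\<bar>P t f x - P t f y\<bar> \<le> c * ?D"
      by (intro LIMSEQ_le_const2) auto
    then show ?thesis
      using bounded_harmonic_P[OF f harm M t] by (simp add: c_def)
  qed
  then have "\<forall>\<^sub>F t in at_top. \<bar>f x - f y\<bar> \<le> sqrt (N / t) * ?D"
    by (intro eventually_mono[OF eventually_gt_at_top[of 0]])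
  moreover have "((\<lambda>t. sqrt (N / t) * ?D) \<longlongrightarrow> sqrt 0 * ?D) at_top"
    by (intro tendsto_intros tendsto_divide_0[OF tendsto_const] filterlim_at_top_imp_at_infinity filterlim_ident)
  ultimately have "\<bar>f x - f y\<bar> \<le> sqrt 0 * ?D"
    by (intro tendsto_lowerbound[where F=at_top]) auto
  then show ?thesis by simp
qed

end

theorem theorem9p2:
  fixes A :: "('a::{t2_space,second_countable_topology}, 'e::euclidean_space) chart set"
    and \<mu> :: "'a measure"
    and L :: "('a \<Rightarrow> real) \<Rightarrow> 'a \<Rightarrow> real"
    and GZ :: "('a \<Rightarrow> real) \<Rightarrow> ('a \<Rightarrow> real) \<Rightarrow> 'a \<Rightarrow> real"
    and p :: "'a \<Rightarrow> 'a \<Rightarrow> real \<Rightarrow> real"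
    and h :: "nat \<Rightarrow> 'a \<Rightarrow> real"
    and \<rho>1 \<rho>2 \<kappa> d :: real
  assumes manifold: "smooth_atlas A" "connected (UNIV :: 'a set)"
    and measure: "smooth_measure A \<mu>"
    and L_diffusion: "diffusion_operator A L" "L (\<lambda>_. 1) = (\<lambda>_. 0)"
    and L_symmetric: "symmetric_nonpositive A \<mu> L"
    and L_subelliptic: "locally_subelliptic A \<mu> L"
    and L_squares: "locally_sum_of_squares A \<mu> L"
    and paths: "subunit_connected A \<mu> L"
    and complete: "Metric_space UNIV (carnot_dist A L)"
      "Metric_space.mcomplete UNIV (carnot_dist A L)"
    and GZ_form: "first_order_form A GZ"
    and GZ_nonneg: "\<And>f x. smooth_fun A f \<Longrightarrow> 0 \<le> GZ f f x"
    and L_esa: "essentially_self_adjoint \<mu> (test_graph A L)"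
    and kernel: "heat_kernel A \<mu> L p"
    and a_test: "\<And>k. test_fun A (h k)"
    and a_incr: "\<And>x. incseq (\<lambda>k. h k x)"
    and a_lim: "\<And>x. (\<lambda>k. h k x) \<longlonglongrightarrow> 1"
    and a_grad: "(\<lambda>k. sup_norm (Gam L (h k) (h k)) + sup_norm (GZ (h k) (h k))) \<longlonglongrightarrow> 0"
    and b: "\<And>f. smooth_fun A f \<Longrightarrow> Gam L f (GZ f f) = GZ f (Gam L f f)"
    and c_conserv: "\<And>t. 0 \<le> t \<Longrightarrow> heat_op \<mu> p t (\<lambda>_. 1) = (\<lambda>_. 1)"
    and c_bound: "\<And>f T. test_fun A f \<Longrightarrow> 0 \<le> T \<Longrightarrow>
      (SUP t\<in>{0..T}. sup_norm (Gam L (heat_op \<mu> p t f) (heat_op \<mu> p t f))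
                    + sup_norm (GZ (heat_op \<mu> p t f) (heat_op \<mu> p t f))) < \<infinity>"
    and d_const: "0 \<le> \<rho>1" "0 < \<rho>2" "0 \<le> \<kappa>" "0 < d"
    and d_ineq: "\<And>f \<nu> x. smooth_fun A f \<Longrightarrow> 0 < \<nu> \<Longrightarrow>
      Gam2 L f x + \<nu> * Gam2Z L GZ f x
        \<ge> 1 / d * (L f x)\<^sup>2 + (\<rho>1 - \<kappa> / \<nu>) * Gam L f f x + \<rho>2 * GZ f f x"
  shows "\<not> (\<exists>f. smooth_fun A f \<and> (\<forall>x. L f x = 0) \<and> bounded (range f) \<and> \<not> f constant_on UNIV)"
proof
  assume "\<exists>f. smooth_fun A f \<and> (\<forall>x. L f x = 0) \<and> bounded (range f) \<and> \<not> f constant_on UNIV"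
  then obtain f where f: "smooth_fun A f" "\<And>x. L f x = 0" "bounded (range f)" "\<not> f constant_on UNIV"
    by blast
  obtain M where M: "\<And>x. \<bar>f x\<bar> \<le> M" using f(3) by (auto simp: bounded_iff)
  have grad: "(\<lambda>k. sup_norm (Gam L (h k) (h k))) \<longlonglongrightarrow> 0"
    by (rule tendsto_sandwich[OF _ _ tendsto_const a_grad]) (simp_all add: add_increasing2)
  interpret curvature_dimension A \<mu> L p h GZ \<rho>1 \<rho>2 \<kappa> d
    by unfold_locales
      (rule manifold(1) measure L_diffusion L_symmetric kernel c_conserv a_test a_incr a_lim grad
        GZ_form GZ_nonneg d_const d_ineq; assumption?)+
  have "f x = f y" for x y
    by (rule Liouville[OF complete(1) c_bound f(1,2) M])
  then have "f constant_on UNIV" unfolding constant_on_def by blast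
  then show False using f(4) by contradiction
qed

end
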